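(* Let $H_1,\ldots,H_m$ be positive kernel operators on $L^2(X,\mu)$ and let $\tau,\nu$ be permutations of $\{1,\ldots,m\}$. Denote $$Q_j=H_{\tau(j)}^*H_{\nu(j)}\cdots H_{\tau(m)}^*H_{\nu(m)}H_{\tau(1)}^*H_{\nu(1)}\cdots H_{\tau(j-1)}^*H_{\nu(j-1)}$$ for $j=1,\ldots,m$. (i) Then $$\|H_1^{(\frac1m)}\circ\cdots\circ H_m^{(\frac1m)}\|\le r\big((H_{\tau(1)}^*H_{\nu(1)})^{(\frac1m)}\circ\cdots\circ(H_{\tau(m)}^*H_{\nu(m)})^{(\frac1m)}\big)^{\frac12}$$ $$\le r\big(Q_1^{(\frac1m)}\circ\cdots\circ Q_m^{(\frac1m)}\big)^{\frac1{2m}}\le r\big(H_{\tau(1)}^*H_{\nu(1)}\cdots H_{\tau(m)}^*H_{\nu(m)}\big)^{\frac1{2m}}.$$ (ii) If $H_1,\ldots,H_m$ are nonnegative matrices that define operators on $l^2(R)$ and if $\alpha\ge\frac1m$, then $$\|H_1^{(\alpha)}\circ\cdots\circ H_m^{(\alpha)}\|\le r\big((H_{\tau(1)}^*H_{\nu(1)})^{(\alpha)}\circ\cdots\circ(H_{\tau(m)}^*H_{\nu(m)})^{(\alpha)}\big)^{\frac12}$$ $$\le r\big(Q_1^{(\alpha)}\circ\cdots\circ Q_m^{(\alpha)}\big)^{\frac1{2m}}\le r\big(H_{\tau(1)}^*H_{\nu(1)}\cdots H_{\tau(m)}^*H_{\nu(m)}\big)^{\frac\alpha2}.$$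
   Context: $\mu$ is a $\sigma$-finite positive measure on a $\sigma$-algebra of subsets of a nonempty set $X$; $L^2(X,\mu)$ is the complex Hilbert space. A kernel operator $K$ on $L^2(X,\mu)$ is a linear operator $(Kf)(x)=\int_X k(x,y)f(y)\,d\mu(y)$ with $\mu\times\mu$-measurable kernel $k$ such that $\int_X|k(x,y)f(y)|\,d\mu(y)<\infty$ for all $f$ and almost all $x$. It is positive if it maps nonnegative functions to nonnegative functions (equivalently $k\ge0$ a.e.). $K^*$ is the adjoint, with kernel $k(y,x)$ at $(x,y)$; juxtaposition is composition. The Hadamard product $K\circ H$ has kernel $k(x,y)h(x,y)$, and the Hadamard power $K^{(t)}$ has kernel $k(x,y)^t$. $R$ is $\{1,\ldots,N\}$ for some $N\in\mathbb N$ or $R=\mathbb N$; a nonnegative matrix $K=[k(i,j)]_{i,j\in R}$ defines an operator on $l^2(R)$ if $Kx\in l^2(R)$ for all $x\in l^2(R)$, where $(Kx)_i=\sum_jk(i,j)x_j$; for matrices the Hadamard product and power are entrywise. $r$ is the spectral radius and $\|\cdot\|$ the operator norm. *)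

theory Defs
  imports "HOL-Analysis.Analysis" "HOL-Combinatorics.Permutations"
begin

text \<open>
  The space \<open>L\<^sup>2(X, \<mu>)\<close> is represented by the complex-valued square-integrable functions
  themselves, and an operator by a map between functions.  Elements of \<open>L\<^sup>2\<close> are identified
  only up to equality almost everywhere, so every identity between them is stated with \<open>AE\<close>,
  and the values of an operator outside \<open>L2 M\<close> never matter.  For \<open>M = count_space R\<close>, \<open>AE\<close> means
  everywhere on \<open>R\<close> and \<open>L2 M\<close> is \<open>l\<^sup>2(R)\<close>.
\<close>

type_synonym 'a operator = "('a \<Rightarrow> complex) \<Rightarrow> 'a \<Rightarrow> complex"

definition L2 :: "'a measure \<Rightarrow> ('a \<Rightarrow> complex) set" where
  "L2 M = {f \<in> borel_measurable M. integrable M (\<lambda>x. (cmod (f x))\<^sup>2)}"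

definition L2_inner :: "'a measure \<Rightarrow> ('a \<Rightarrow> complex) \<Rightarrow> ('a \<Rightarrow> complex) \<Rightarrow> complex" where
  "L2_inner M f g = (\<integral>x. f x * cnj (g x) \<partial>M)"

definition L2_norm :: "'a measure \<Rightarrow> ('a \<Rightarrow> complex) \<Rightarrow> real" where
  "L2_norm M f = sqrt (\<integral>x. (cmod (f x))\<^sup>2 \<partial>M)"

text \<open>Compatibility with equality almost everywhere follows from linearity and boundedness.\<close>

definition bounded_operator :: "'a measure \<Rightarrow> 'a operator \<Rightarrow> bool" where
  "bounded_operator M T \<longleftrightarrow>
     (\<forall>f \<in> L2 M. T f \<in> L2 M) \<and>
     (\<forall>f \<in> L2 M. \<forall>g \<in> L2 M. \<forall>a b.
        AE x in M. T (\<lambda>y. a * f y + b * g y) x = a * T f x + b * T g x) \<and>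
     (\<exists>C. \<forall>f \<in> L2 M. L2_norm M (T f) \<le> C * L2_norm M f)"

definition operator_norm :: "'a measure \<Rightarrow> 'a operator \<Rightarrow> real" where
  "operator_norm M T = Sup {L2_norm M (T f) | f. f \<in> L2 M \<and> L2_norm M f \<le> 1}"

definition op_spectrum :: "'a measure \<Rightarrow> 'a operator \<Rightarrow> complex set" where
  "op_spectrum M T = {z. \<not> (\<exists>S. bounded_operator M S \<and>
     (\<forall>f \<in> L2 M. (AE x in M. S (\<lambda>y. z * f y - T f y) x = f x) \<and>
                 (AE x in M. z * S f x - T (S f) x = f x)))}"

text \<open>Inserting \<open>0\<close> only matters for the zero measure, where \<open>L\<^sup>2\<close> is trivial and the
  spectrum is empty.\<close>

definition op_spectral_radius :: "'a measure \<Rightarrow> 'a operator \<Rightarrow> real" where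
  "op_spectral_radius M T = Sup (insert 0 (cmod ` op_spectrum M T))"

definition L2_adjoint :: "'a measure \<Rightarrow> 'a operator \<Rightarrow> 'a operator" where
  "L2_adjoint M T = (SOME S. (\<forall>g \<in> L2 M. S g \<in> L2 M) \<and>
     (\<forall>f \<in> L2 M. \<forall>g \<in> L2 M. L2_inner M (T f) g = L2_inner M f (S g)))"

definition kernel_op :: "'a measure \<Rightarrow> ('a \<Rightarrow> 'a \<Rightarrow> complex) \<Rightarrow> 'a operator" where
  "kernel_op M k f = (\<lambda>x. \<integral>y. k x y * f y \<partial>M)"

definition has_kernel :: "'a measure \<Rightarrow> 'a operator \<Rightarrow> ('a \<Rightarrow> 'a \<Rightarrow> complex) \<Rightarrow> bool" where
  "has_kernel M T k \<longleftrightarrow>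
     (\<lambda>(x, y). k x y) \<in> borel_measurable (M \<Otimes>\<^sub>M M) \<and>
     (\<forall>f \<in> L2 M. (AE x in M. integrable M (\<lambda>y. k x y * f y)) \<and>
                 T f \<in> L2 M \<and> (AE x in M. T f x = kernel_op M k f x))"

definition positive_operator :: "'a measure \<Rightarrow> 'a operator \<Rightarrow> bool" where
  "positive_operator M T \<longleftrightarrow>
     (\<forall>f \<in> L2 M. (AE x in M. f x \<in> \<real>\<^sub>\<ge>\<^sub>0) \<longrightarrow> (AE x in M. T f x \<in> \<real>\<^sub>\<ge>\<^sub>0))"

definition positive_kernel_operator :: "'a measure \<Rightarrow> 'a operator \<Rightarrow> bool" where
  "positive_kernel_operator M T \<longleftrightarrow> (\<exists>k. has_kernel M T k) \<and> positive_operator M T"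

text \<open>The kernel of a positive kernel operator is nonnegative almost everywhere, and over a
  \<open>\<sigma>\<close>-finite measure it is unique up to a null set; so it has a version that is real and
  nonnegative everywhere.\<close>

definition pos_kernel :: "'a measure \<Rightarrow> 'a operator \<Rightarrow> 'a \<Rightarrow> 'a \<Rightarrow> real" where
  "pos_kernel M T = (SOME k. (\<forall>x y. 0 \<le> k x y) \<and> has_kernel M T (\<lambda>x y. of_real (k x y)))"

text \<open>The Hadamard product of the Hadamard powers \<open>T\<^sub>1\<^sup>(\<^sup>t\<^sup>) \<circ> \<dots> \<circ> T\<^sub>m\<^sup>(\<^sup>t\<^sup>)\<close>.  It is formed on kernels in
  one step because a single power \<open>T\<^sub>i\<^sup>(\<^sup>t\<^sup>)\<close> need not define an operator on \<open>L\<^sup>2\<close>.\<close>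

definition hadamard :: "'a measure \<Rightarrow> real \<Rightarrow> nat \<Rightarrow> (nat \<Rightarrow> 'a operator) \<Rightarrow> 'a operator" where
  "hadamard M t m T =
     kernel_op M (\<lambda>x y. of_real (\<Prod>i = 1..m. pos_kernel M (T i) x y powr t))"

text \<open>The composition \<open>P\<^sub>j \<dots> P\<^sub>m P\<^sub>1 \<dots> P\<^sub>j\<^sub>-\<^sub>1\<close>; for \<open>j = 1\<close> this is \<open>P\<^sub>1 \<dots> P\<^sub>m\<close>.\<close>

definition cyclic_product :: "nat \<Rightarrow> (nat \<Rightarrow> 'a operator) \<Rightarrow> nat \<Rightarrow> 'a operator" where
  "cyclic_product m P j = foldr (\<circ>) (map P ([j..<Suc m] @ [1..<j])) id"

definition matrix_op :: "nat set \<Rightarrow> (nat \<Rightarrow> nat \<Rightarrow> real) \<Rightarrow> nat operator" where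
  "matrix_op R A v = (\<lambda>i. \<Sum>\<^sub>\<infinity>j\<in>R. of_real (A i j) * v j)"

definition defines_l2_operator :: "nat set \<Rightarrow> (nat \<Rightarrow> nat \<Rightarrow> real) \<Rightarrow> bool" where
  "defines_l2_operator R A \<longleftrightarrow> (\<forall>v \<in> L2 (count_space R).
     (\<forall>i\<in>R. (\<lambda>j. of_real (A i j) * v j) summable_on R) \<and>
     matrix_op R A v \<in> L2 (count_space R))"

end

theory Submission
  imports Defs
begin

text \<open>
  Why the inequalities hold.  Write \<open>P\<^sub>j = H\<^sub>\<tau>\<^sub>(\<^sub>j\<^sub>)\<^sup>* H\<^sub>\<nu>\<^sub>(\<^sub>j\<^sub>)\<close> and let \<open>\<circ>\<close> stand for the Hadamard product of the
  \<open>\<alpha>\<close>-th Hadamard powers.  All three rest on one pointwise inequality between kernels: the product of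
  \<open>\<circ> K\<^sub>i\<close> and \<open>\<circ> L\<^sub>i\<close> has a kernel below that of \<open>\<circ> (K\<^sub>i L\<^sub>i)\<close>
  (\<open>kernel_comp_hadamard_le\<close>, iterated in \<open>kernel_prod_hadamard_le\<close>).  For \<open>\<alpha> = 1/m\<close> this is the
  Hoelder inequality for \<open>m\<close> functions.  For matrices and \<open>\<alpha> \<ge> 1/m\<close> it follows from that case, because a
  nonnegative sequence divided by its sum has all its entries at most \<open>1\<close>, so that its \<open>\<alpha>\<close>-th powers lie
  below its \<open>1/m\<close>-th powers.  The predicate \<open>hadamard_exponent\<close> covers both cases, and both parts of the
  theorem are instances of \<open>hadamard_spectral_inequalities\<close>.

  Since \<open>\<tau>\<close>, \<open>\<nu>\<close> and the cyclic shifts of the indices are permutations, they do not change a Hadamard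
  product.  With \<open>S = \<circ> H\<^sub>i\<close>, \<open>T = \<circ> P\<^sub>j\<close> and \<open>W = \<circ> Q\<^sub>j\<close> the pointwise inequality therefore yields
  \<open>S\<^sup>* S \<le> T\<close>, \<open>T\<^sup>m \<le> W\<close> and \<open>W\<^sup>n \<le> \<circ> (Q\<^sub>j\<^sup>n)\<close>.  The first gives \<open>\<parallel>S\<parallel>\<^sup>2 \<le> r(T)\<close>, because the norm of a
  self-adjoint operator is its growth rate; the second gives \<open>r(T)\<^sup>m \<le> r(W)\<close>; the third, together with
  \<open>\<parallel>\<circ> K\<^sub>i\<parallel> \<le> \<Prod> \<parallel>K\<^sub>i\<parallel>\<^sup>\<alpha>\<close> (\<open>kernel_bound_hadamard\<close>) and with the fact that all \<open>Q\<^sub>j\<close> grow at the same rate as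
  \<open>Q\<^sub>1\<close>, gives \<open>r(W) \<le> r(Q\<^sub>1)\<^sup>m\<^sup>\<alpha>\<close>.

  These arguments compare growth rates of iterates, so the spectral radius, which is defined through
  resolvents, has to be identified with the growth rate.  That it is at most the growth rate is the
  Neumann series (\<open>neumann_resolvent\<close>).  The converse (\<open>growth_of_spectral_radius\<close>) uses positivity: there
  are real points \<open>l\<close>, arbitrarily close to the spectral radius and to the right of it, at which the
  resolvent \<open>S\<close> is positive (\<open>exists_positive_resolvent_near\<close>), and for every \<open>f \<ge> 0\<close> the function \<open>s = S f\<close>
  satisfies \<open>f \<le> l s\<close> and \<open>T s \<le> l s\<close>, whence \<open>T\<^sup>n f \<le> l\<^sup>n\<^sup>+\<^sup>1 S f\<close>.

  Inequalities between kernels are proved for kernels and functions with values in the extended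
  nonnegative reals, where iterated integrals can always be interchanged.  The predicate \<open>acts\<close> transports them to operators on \<open>L\<^sup>2\<close>; the kernel is unique almost
  everywhere (\<open>acts_kernel_unique\<close>), so that \<open>pos_kernel\<close> agrees with it up to a null set.
\<close>

section \<open>Powers of nonnegative extended reals and the Hoelder inequality\<close>

text \<open>
  The value at \<open>\<infinity>\<close> is \<open>\<infinity>\<close> for every exponent.  Together with the library convention \<open>0 powr a = 0\<close> this
  makes the power multiplicative without side conditions, \<open>0 \<cdot> \<infinity> = 0\<close> included.
\<close>

definition ennpowr :: "ennreal \<Rightarrow> real \<Rightarrow> ennreal" where
  "ennpowr x a = (if x = top then top else ennreal (enn2real x powr a))"

lemma ennpowr_ennreal: "0 \<le> x \<Longrightarrow> ennpowr (ennreal x) a = ennreal (x powr a)"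
  by (simp add: ennpowr_def)

lemma ennpowr_top [simp]: "ennpowr top a = top"
  by (simp add: ennpowr_def)

lemma ennpowr_zero [simp]: "ennpowr 0 a = 0"
  by (simp add: ennpowr_def)

lemma ennpowr_eq_0_iff [simp]: "ennpowr x a = 0 \<longleftrightarrow> x = 0"
  by (cases x) (auto simp: ennpowr_def ennreal_eq_0_iff)

lemma ennpowr_mult: "ennpowr (x * y) a = ennpowr x a * ennpowr y a"
proof (cases "x = top \<or> y = top")
  case True
  then show ?thesis
    by (auto simp: ennreal_mult_eq_top_iff ennreal_top_mult ennreal_mult_top)
next
  case False
  then obtain u v where "x = ennreal u" "0 \<le> u" "y = ennreal v" "0 \<le> v"
    by (metis ennreal_cases)
  then show ?thesis
    by (simp add: ennpowr_ennreal powr_mult flip: ennreal_mult)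
qed

lemma ennpowr_power2: "(ennpowr x a)\<^sup>2 = ennpowr (x\<^sup>2) a"
  by (simp add: power2_eq_square ennpowr_mult)

lemma ennpowr_mono:
  assumes "0 \<le> a" "x \<le> y"
  shows "ennpowr x a \<le> ennpowr y a"
proof (cases "y = top")
  case False
  then have "x \<noteq> top"
    using assms(2) by (auto simp: top_unique)
  with False assms show ?thesis
    by (auto simp: ennpowr_def less_top intro!: ennreal_leI powr_mono2 enn2real_mono)
qed simp

lemma borel_measurable_ennpowr [measurable (raw)]:
  assumes [measurable]: "f \<in> borel_measurable M"
  shows "(\<lambda>x. ennpowr (f x) a) \<in> borel_measurable M"
  unfolding ennpowr_def by measurable

lemma prod_ennpowr_inverse_card:
  assumes "1 \<le> m"
  shows "(\<Prod>i=1..m. ennpowr x (1 / real m)) = x"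
proof (cases x)
  case (real r)
  have "(r powr (1 / real m)) ^ m = r"
    using assms real by (cases "r = 0") (auto simp: powr_powr powr_realpow[symmetric])
  then show ?thesis
    using real by (simp add: ennpowr_ennreal ennreal_power)
qed (use assms in \<open>simp add: top_power_ennreal\<close>)

text \<open>
  The two situations of the theorem: an arbitrary measure with \<open>m \<alpha> = 1\<close>, or matrices with \<open>m \<alpha> \<ge> 1\<close>.
\<close>

definition hadamard_exponent :: "'a measure \<Rightarrow> nat \<Rightarrow> real \<Rightarrow> bool" where
  "hadamard_exponent M m \<alpha> \<longleftrightarrow>
     1 \<le> m \<and> (\<alpha> = 1 / real m \<or> 1 / real m \<le> \<alpha> \<and> (\<exists>R. M = count_space R))"

lemma hadamard_exponent_pos:
  assumes "hadamard_exponent M m \<alpha>"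
  shows "0 < \<alpha>" "1 \<le> m"
proof -
  show "1 \<le> m"
    using assms by (auto simp: hadamard_exponent_def)
  then have "0 < 1 / real m"
    by simp
  moreover have "1 / real m \<le> \<alpha>"
    using assms by (auto simp: hadamard_exponent_def)
  ultimately show "0 < \<alpha>"
    by (rule less_le_trans)
qed

text \<open>
  Numbers in \<open>[0, 1]\<close> get smaller when the exponent grows, which reduces the second case to the
  inequality between the geometric and the arithmetic mean.
\<close>

lemma prod_powr_le_mean:
  fixes g :: "nat \<Rightarrow> real"
  assumes "1 \<le> m" and g: "\<And>i. i \<in> {1..m} \<Longrightarrow> 0 \<le> g i"
    and \<alpha>: "\<alpha> = 1 / real m \<or> 1 / real m \<le> \<alpha> \<and> (\<forall>i\<in>{1..m}. g i \<le> 1)"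
  shows "(\<Prod>i=1..m. g i powr \<alpha>) \<le> (\<Sum>i=1..m. g i / real m)"
proof -
  have "(\<Prod>i=1..m. g i powr \<alpha>) \<le> (\<Prod>i=1..m. g i powr (1 / real m))"
    using \<alpha> g by (auto intro!: prod_mono powr_mono')
  also have "\<dots> = (\<Prod>i=1..m. g i) powr (1 / real m)"
    using g by (simp add: prod_powr_distrib)
  also have "\<dots> \<le> (\<Sum>i=1..m. g i / real m)"
    using arith_geom_mean[of "{1..m}" g] g assms(1) by auto
  finally show ?thesis .
qed

lemma prod_ennreal_eq_top:
  fixes f :: "'i \<Rightarrow> ennreal"
  assumes "finite I" "\<And>i. i \<in> I \<Longrightarrow> f i \<noteq> 0" "k \<in> I" "f k = top"
  shows "(\<Prod>i\<in>I. f i) = top"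
proof -
  have "(\<Prod>i\<in>I. f i) = f k * (\<Prod>i\<in>I - {k}. f i)"
    using assms by (simp add: prod.remove)
  moreover have "(\<Prod>i\<in>I - {k}. f i) \<noteq> 0"
    using assms by simp
  ultimately show ?thesis
    using assms by (simp add: ennreal_top_mult)
qed

text \<open>
  The Hoelder inequality for \<open>m\<close> functions.  Once every function is divided by its integral, it is the
  inequality of the means, integrated.  On a counting measure a function divided by its integral is at
  most \<open>1\<close>, which is why larger exponents are admitted there.
\<close>

lemma nn_integral_prod_ennpowr_le:
  fixes f :: "nat \<Rightarrow> 'a \<Rightarrow> ennreal"
  assumes exp: "hadamard_exponent M m \<alpha>"
    and f [measurable]: "\<And>i. i \<in> {1..m} \<Longrightarrow> f i \<in> borel_measurable M"
  shows "(\<integral>\<^sup>+x. (\<Prod>i=1..m. ennpowr (f i x) \<alpha>) \<partial>M) \<le> (\<Prod>i=1..m. ennpowr (\<integral>\<^sup>+x. f i x \<partial>M) \<alpha>)"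
proof -
  note \<alpha> = hadamard_exponent_pos[OF exp]
  define I where "I i = (\<integral>\<^sup>+x. f i x \<partial>M)" for i
  consider i where "i \<in> {1..m}" "I i = 0" | i where "i \<in> {1..m}" "I i = top" "\<forall>i\<in>{1..m}. I i \<noteq> 0"
    | "\<forall>i\<in>{1..m}. I i \<noteq> 0 \<and> I i \<noteq> top" by blast
  then show ?thesis
  proof cases
    case (1 i)
    then have "AE x in M. f i x = 0"
      by (simp add: I_def nn_integral_0_iff_AE)
    then have "AE x in M. (\<Prod>i=1..m. ennpowr (f i x) \<alpha>) = 0"
      by eventually_elim (use 1 in \<open>auto intro!: prod_zero bexI[of _ i]\<close>)
    then have "(\<integral>\<^sup>+x. (\<Prod>i=1..m. ennpowr (f i x) \<alpha>) \<partial>M) = (\<integral>\<^sup>+x. 0 \<partial>M)"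
      by (rule nn_integral_cong_AE)
    then show ?thesis by simp
  next
    case (2 i)
    then have "(\<Prod>i=1..m. ennpowr (I i) \<alpha>) = top"
      by (intro prod_ennreal_eq_top[of _ _ i]) auto
    then show ?thesis by (simp add: I_def)
  next
    case 3
    define s where "s i = enn2real (I i)" for i
    have s: "0 < s i" "I i = ennreal (s i)" if "i \<in> {1..m}" for i
      using 3 that by (auto simp: s_def enn2real_positive_iff less_top zero_less_iff_neq_zero)
    have fin: "AE x in M. \<forall>i\<in>{1..m}. f i x \<noteq> top"
    proof (subst AE_finite_all, simp, intro ballI)
      fix i assume "i \<in> {1..m}"
      then show "AE x in M. f i x \<noteq> top"
        using 3 nn_integral_PInf_AE[of "f i" M] by (simp add: I_def)
    qed
    have small: "AE x in M. \<alpha> = 1 / real m \<or> 1 / real m \<le> \<alpha> \<and> (\<forall>i\<in>{1..m}. f i x \<le> I i)"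
      using exp by (auto simp: hadamard_exponent_def I_def AE_count_space intro: nn_integral_ge_point)
    have "AE x in M. (\<Prod>i=1..m. ennpowr (f i x) \<alpha>)
        \<le> (\<Prod>i=1..m. ennpowr (I i) \<alpha>) * (\<Sum>i=1..m. ennreal (1 / (s i * real m)) * f i x)"
      using fin small
    proof eventually_elim
      case (elim x)
      define g where "g i = enn2real (f i x) / s i" for i
      have g: "0 \<le> g i" "f i x = ennreal (s i * g i)" if "i \<in> {1..m}" for i
        using s[OF that] elim that by (auto simp: g_def less_top)
      have g1: "g i \<le> 1" if "f i x \<le> I i" "i \<in> {1..m}" for i
        using s[OF that(2)] g[OF that(2)] that by (auto simp: ennreal_le_iff)
      have "(\<Prod>i=1..m. ennpowr (f i x) \<alpha>) = (\<Prod>i=1..m. ennpowr (I i) \<alpha> * ennreal (g i powr \<alpha>))"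
        using g s by (intro prod.cong refl)
          (simp add: ennpowr_ennreal powr_mult less_imp_le flip: ennreal_mult)
      also have "\<dots> = (\<Prod>i=1..m. ennpowr (I i) \<alpha>) * ennreal (\<Prod>i=1..m. g i powr \<alpha>)"
        by (simp add: prod.distrib prod_ennreal)
      also have "ennreal (\<Prod>i=1..m. g i powr \<alpha>) \<le> ennreal (\<Sum>i=1..m. g i / real m)"
        using \<alpha> g g1 elim by (intro ennreal_leI prod_powr_le_mean) auto
      also have "\<dots> = (\<Sum>i=1..m. ennreal (1 / (s i * real m)) * f i x)"
      proof (subst sum_ennreal[symmetric])
        show "(\<Sum>i=1..m. ennreal (g i / real m)) = (\<Sum>i=1..m. ennreal (1 / (s i * real m)) * f i x)"
        proof (intro sum.cong refl)
          fix i assume i: "i \<in> {1..m}"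
          have "g i / real m = 1 / (s i * real m) * (s i * g i)"
            using s(1)[OF i] by simp
          then show "ennreal (g i / real m) = ennreal (1 / (s i * real m)) * f i x"
            using g[OF i] s(1)[OF i] by (simp add: less_imp_le flip: ennreal_mult)
        qed
      qed (use g in auto)
      finally show ?case by (simp add: mult_left_mono)
    qed
    then have "(\<integral>\<^sup>+x. (\<Prod>i=1..m. ennpowr (f i x) \<alpha>) \<partial>M)
      \<le> (\<integral>\<^sup>+x. (\<Prod>i=1..m. ennpowr (I i) \<alpha>) * (\<Sum>i=1..m. ennreal (1 / (s i * real m)) * f i x) \<partial>M)"
      by (rule nn_integral_mono_AE)
    also have "\<dots> = (\<Prod>i=1..m. ennpowr (I i) \<alpha>) * (\<Sum>i=1..m. ennreal (1 / (s i * real m)) * I i)"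
      by (subst nn_integral_cmult, measurable, subst nn_integral_sum) (auto simp: nn_integral_cmult I_def)
    also have "(\<Sum>i=1..m. ennreal (1 / (s i * real m)) * I i) = (\<Sum>i=1..m. ennreal (1 / real m))"
      using s by (intro sum.cong refl) (simp add: less_imp_le less_imp_neq[symmetric] flip: ennreal_mult)
    also have "\<dots> = 1"
      using \<alpha> by (simp add: ennreal_of_nat_eq_real_of_nat flip: ennreal_mult)
    finally show ?thesis by (simp add: I_def)
  qed
qed


section \<open>Kernels, their compositions and their Hadamard products\<close>

definition kernel_apply :: "'a measure \<Rightarrow> ('a \<Rightarrow> 'a \<Rightarrow> ennreal) \<Rightarrow> ('a \<Rightarrow> ennreal) \<Rightarrow> 'a \<Rightarrow> ennreal" where
  "kernel_apply M K f x = (\<integral>\<^sup>+y. K x y * f y \<partial>M)"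

abbreviation (input) kernel_measurable :: "'a measure \<Rightarrow> ('a \<Rightarrow> 'a \<Rightarrow> 'b::topological_space) \<Rightarrow> bool" where
  "kernel_measurable M K \<equiv> case_prod K \<in> borel_measurable (M \<Otimes>\<^sub>M M)"

definition kernel_comp ::
    "'a measure \<Rightarrow> ('a \<Rightarrow> 'a \<Rightarrow> ennreal) \<Rightarrow> ('a \<Rightarrow> 'a \<Rightarrow> ennreal) \<Rightarrow> 'a \<Rightarrow> 'a \<Rightarrow> ennreal" where
  "kernel_comp M K L x y = (\<integral>\<^sup>+z. K x z * L z y \<partial>M)"

text \<open>
  The index is one less than the number of factors: \<open>kernel_prod M n L\<close> is \<open>L 0 L 1 \<dots> L n\<close>.  An empty product
  would be the identity, which in general has no kernel.
\<close>

fun kernel_prod :: "'a measure \<Rightarrow> nat \<Rightarrow> (nat \<Rightarrow> 'a \<Rightarrow> 'a \<Rightarrow> ennreal) \<Rightarrow> 'a \<Rightarrow> 'a \<Rightarrow> ennreal" where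
  "kernel_prod M 0 L = L 0"
| "kernel_prod M (Suc n) L = kernel_comp M (L 0) (kernel_prod M n (\<lambda>p. L (Suc p)))"

definition hadamard_kernel :: "real \<Rightarrow> nat \<Rightarrow> (nat \<Rightarrow> 'a \<Rightarrow> 'a \<Rightarrow> ennreal) \<Rightarrow> 'a \<Rightarrow> 'a \<Rightarrow> ennreal" where
  "hadamard_kernel \<alpha> m K x y = (\<Prod>i=1..m. ennpowr (K i x y) \<alpha>)"

definition sq_norm :: "'a measure \<Rightarrow> ('a \<Rightarrow> ennreal) \<Rightarrow> ennreal" where
  "sq_norm M f = (\<integral>\<^sup>+x. (f x)\<^sup>2 \<partial>M)"

text \<open>
  The number \<open>c\<close> bounds the square of the operator norm, since \<open>sq_norm\<close> is the square of the norm.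
\<close>

definition kernel_bound :: "'a measure \<Rightarrow> ('a \<Rightarrow> 'a \<Rightarrow> ennreal) \<Rightarrow> real \<Rightarrow> bool" where
  "kernel_bound M K c \<longleftrightarrow>
     0 \<le> c \<and> (\<forall>f\<in>borel_measurable M. sq_norm M (kernel_apply M K f) \<le> ennreal c * sq_norm M f)"

lemma kernel_boundD:
  assumes "kernel_bound M K c"
  shows "0 \<le> c" "f \<in> borel_measurable M \<Longrightarrow> sq_norm M (kernel_apply M K f) \<le> ennreal c * sq_norm M f"
  using assms by (auto simp: kernel_bound_def)

lemma sq_norm_mono:
  "(\<And>x. x \<in> space M \<Longrightarrow> f x \<le> g x) \<Longrightarrow> sq_norm M f \<le> sq_norm M g"
  unfolding sq_norm_def by (intro nn_integral_mono power_mono) auto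

lemma sq_norm_cong_AE:
  "AE x in M. f x = g x \<Longrightarrow> sq_norm M f = sq_norm M g"
  unfolding sq_norm_def by (intro nn_integral_cong_AE) auto

lemma kernel_apply_mono:
  "\<lbrakk>\<And>x y. x \<in> space M \<Longrightarrow> y \<in> space M \<Longrightarrow> K x y \<le> L x y; \<And>x. x \<in> space M \<Longrightarrow> f x \<le> g x; x \<in> space M\<rbrakk>
    \<Longrightarrow> kernel_apply M K f x \<le> kernel_apply M L g x"
  unfolding kernel_apply_def by (intro nn_integral_mono mult_mono) auto

lemma kernel_apply_cong_AE:
  "AE y in M. f y = g y \<Longrightarrow> kernel_apply M K f = kernel_apply M K g"
  unfolding kernel_apply_def by (intro ext nn_integral_cong_AE) auto

lemma hadamard_kernel_measurable:
  assumes [measurable]: "\<And>i. i \<in> {1..m} \<Longrightarrow> kernel_measurable M (K i)"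
  shows "kernel_measurable M (hadamard_kernel \<alpha> m K)"
proof -
  have "case_prod (hadamard_kernel \<alpha> m K) = (\<lambda>z. \<Prod>i=1..m. ennpowr (case_prod (K i) z) \<alpha>)"
    by (auto simp: hadamard_kernel_def)
  then show ?thesis by simp
qed

context sigma_finite_measure
begin

interpretation pair: pair_sigma_finite M M ..

lemma kernel_apply_measurable [measurable (raw)]:
  assumes [measurable]: "kernel_measurable M K" "f \<in> borel_measurable M"
  shows "kernel_apply M K f \<in> borel_measurable M"
  unfolding kernel_apply_def by measurable

lemma kernel_comp_measurable [measurable (raw)]:
  assumes [measurable]: "kernel_measurable M K" "kernel_measurable M L"
  shows "kernel_measurable M (kernel_comp M K L)"
  unfolding kernel_comp_def by measurable

lemma kernel_prod_measurable:
  assumes "\<And>p. p \<le> n \<Longrightarrow> kernel_measurable M (L p)"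
  shows "kernel_measurable M (kernel_prod M n L)"
  using assms by (induction n arbitrary: L) (simp_all add: kernel_comp_measurable)

lemma kernel_apply_comp:
  assumes [measurable]: "kernel_measurable M K" "kernel_measurable M L"
    "f \<in> borel_measurable M" and [measurable]: "x \<in> space M"
  shows "kernel_apply M (kernel_comp M K L) f x = kernel_apply M K (kernel_apply M L f) x"
proof -
  have "kernel_apply M (kernel_comp M K L) f x = (\<integral>\<^sup>+y. (\<integral>\<^sup>+z. K x z * L z y * f y \<partial>M) \<partial>M)"
    unfolding kernel_apply_def kernel_comp_def
    by (intro nn_integral_cong nn_integral_multc[symmetric]) measurable
  also have "\<dots> = (\<integral>\<^sup>+z. (\<integral>\<^sup>+y. K x z * L z y * f y \<partial>M) \<partial>M)"
    by (rule pair.Fubini') measurable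
  also have "\<dots> = kernel_apply M K (kernel_apply M L f) x"
    unfolding kernel_apply_def
    by (intro nn_integral_cong) (simp add: mult.assoc nn_integral_cmult)
  finally show ?thesis .
qed

lemma kernel_comp_mono:
  assumes "\<And>x y. x \<in> space M \<Longrightarrow> y \<in> space M \<Longrightarrow> K x y \<le> K' x y"
    "\<And>x y. x \<in> space M \<Longrightarrow> y \<in> space M \<Longrightarrow> L x y \<le> L' x y"  "x \<in> space M" "y \<in> space M"
  shows "kernel_comp M K L x y \<le> kernel_comp M K' L' x y"
  unfolding kernel_comp_def using assms by (intro nn_integral_mono mult_mono) auto

text \<open>
  The Hoelder inequality in the variable over which the composition integrates.
\<close>

lemma kernel_comp_hadamard_le:
  assumes exp: "hadamard_exponent M m \<alpha>"
    and [measurable]: "\<And>i. i \<in> {1..m} \<Longrightarrow> kernel_measurable M (K i)"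
      "\<And>i. i \<in> {1..m} \<Longrightarrow> kernel_measurable M (L i)"
    and [measurable]: "x \<in> space M" "y \<in> space M"
  shows "kernel_comp M (hadamard_kernel \<alpha> m K) (hadamard_kernel \<alpha> m L) x y
       \<le> hadamard_kernel \<alpha> m (\<lambda>i. kernel_comp M (K i) (L i)) x y"
proof -
  have "kernel_comp M (hadamard_kernel \<alpha> m K) (hadamard_kernel \<alpha> m L) x y
      = (\<integral>\<^sup>+z. (\<Prod>i=1..m. ennpowr (K i x z * L i z y) \<alpha>) \<partial>M)"
    by (simp add: kernel_comp_def hadamard_kernel_def ennpowr_mult prod.distrib)
  also have "\<dots> \<le> (\<Prod>i=1..m. ennpowr (\<integral>\<^sup>+z. K i x z * L i z y \<partial>M) \<alpha>)"
    by (rule nn_integral_prod_ennpowr_le[OF exp]) measurable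
  finally show ?thesis
    by (simp add: kernel_comp_def hadamard_kernel_def)
qed

lemma kernel_prod_hadamard_le:
  assumes exp: "hadamard_exponent M m \<alpha>"
    and "\<And>i p. i \<in> {1..m} \<Longrightarrow> p \<le> n \<Longrightarrow> kernel_measurable M (L i p)"
    and "x \<in> space M" "y \<in> space M"
  shows "kernel_prod M n (\<lambda>p. hadamard_kernel \<alpha> m (\<lambda>i. L i p)) x y
       \<le> hadamard_kernel \<alpha> m (\<lambda>i. kernel_prod M n (L i)) x y"
  using assms(2-)
proof (induction n arbitrary: L x y)
  case (Suc n)
  have "kernel_prod M (Suc n) (\<lambda>p. hadamard_kernel \<alpha> m (\<lambda>i. L i p)) x y
      \<le> kernel_comp M (hadamard_kernel \<alpha> m (\<lambda>i. L i 0))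
          (hadamard_kernel \<alpha> m (\<lambda>i. kernel_prod M n (\<lambda>p. L i (Suc p)))) x y"
    using Suc.prems by (auto intro!: kernel_comp_mono Suc.IH)
  also have "\<dots> \<le> hadamard_kernel \<alpha> m (\<lambda>i. kernel_prod M (Suc n) (L i)) x y"
    using Suc.prems
    by (auto intro!: kernel_comp_hadamard_le[OF exp, THEN order_trans] kernel_prod_measurable)
  finally show ?case .
qed simp

text \<open>
  Since \<open>f = f\<^sup>1\<^sup>/\<^sup>m \<cdots> f\<^sup>1\<^sup>/\<^sup>m\<close>, the Hadamard product applied to \<open>f\<close> is, by the Hoelder inequality, at most the
  geometric mean of the functions \<open>K\<^sub>i f\<close>; a second use of the inequality bounds the norm of that mean.
\<close>

lemma kernel_bound_hadamard_mean:
  assumes "1 \<le> m"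
    and [measurable]: "\<And>i. i \<in> {1..m} \<Longrightarrow> kernel_measurable M (K i)"
    and bound: "\<And>i. i \<in> {1..m} \<Longrightarrow> kernel_bound M (K i) (c i)"
  shows "kernel_bound M (hadamard_kernel (1 / real m) m K) (\<Prod>i=1..m. c i powr (1 / real m))"
  unfolding kernel_bound_def
proof (intro conjI ballI)
  let ?a = "1 / real m"
  have exp: "hadamard_exponent M m ?a"
    using assms(1) by (simp add: hadamard_exponent_def)
  fix f :: "'a \<Rightarrow> ennreal" assume [measurable]: "f \<in> borel_measurable M"
  have split: "hadamard_kernel ?a m K x y * f y = (\<Prod>i=1..m. ennpowr (K i x y * f y) ?a)" for x y
    using prod_ennpowr_inverse_card[OF assms(1), of "f y"]
    by (simp add: hadamard_kernel_def ennpowr_mult prod.distrib)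
  have "kernel_apply M (hadamard_kernel ?a m K) f x
      \<le> (\<Prod>i=1..m. ennpowr (kernel_apply M (K i) f x) ?a)" if [measurable]: "x \<in> space M" for x
    unfolding kernel_apply_def split
    by (rule nn_integral_prod_ennpowr_le[OF exp]) measurable
  then have "sq_norm M (kernel_apply M (hadamard_kernel ?a m K) f)
      \<le> sq_norm M (\<lambda>x. \<Prod>i=1..m. ennpowr (kernel_apply M (K i) f x) ?a)"
    by (rule sq_norm_mono)
  also have "\<dots> = (\<integral>\<^sup>+x. (\<Prod>i=1..m. ennpowr ((kernel_apply M (K i) f x)\<^sup>2) ?a) \<partial>M)"
    by (simp add: sq_norm_def prod_power_distrib ennpowr_power2)
  also have "\<dots> \<le> (\<Prod>i=1..m. ennpowr (sq_norm M (kernel_apply M (K i) f)) ?a)"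
    unfolding sq_norm_def by (rule nn_integral_prod_ennpowr_le[OF exp]) measurable
  also have "\<dots> \<le> (\<Prod>i=1..m. ennpowr (ennreal (c i) * sq_norm M f) ?a)"
    by (intro prod_mono_ennreal ennpowr_mono kernel_boundD(2)[OF bound]) auto
  also have "\<dots> = ennreal (\<Prod>i=1..m. c i powr ?a) * sq_norm M f"
    using kernel_boundD(1)[OF bound] prod_ennpowr_inverse_card[OF assms(1), of "sq_norm M f"]
    by (simp add: ennpowr_mult prod.distrib ennpowr_ennreal prod_ennreal)
  finally show "sq_norm M (kernel_apply M (hadamard_kernel ?a m K) f)
      \<le> ennreal (\<Prod>i=1..m. c i powr ?a) * sq_norm M f" .
qed (simp add: prod_nonneg)

end

text \<open>
  An entry of a matrix is a coordinate of the image of a unit vector.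
\<close>

lemma kernel_entry_le:
  assumes "M = count_space R" "kernel_bound M K c" "x \<in> R" "y \<in> R"
  shows "K x y \<le> ennreal (sqrt c)"
proof -
  have *: "kernel_apply M K (indicator {y}) x = K x y" if "x \<in> R" for x
    using assms by (simp add: kernel_apply_def nn_integral_indicator_singleton)
  have "(K x y)\<^sup>2 \<le> sq_norm M (kernel_apply M K (indicator {y}))"
    unfolding sq_norm_def assms(1)
    using nn_integral_ge_point[of x R "\<lambda>x. (kernel_apply M K (indicator {y}) x)\<^sup>2"] assms * by simp
  also have "\<dots> \<le> ennreal c * sq_norm M (indicator {y})"
    by (rule kernel_boundD(2)[OF assms(2)]) (simp add: assms(1))
  also have "sq_norm M (indicator {y}) = 1"
    using assms(4) by (simp add: sq_norm_def assms(1) power2_eq_square flip: indicator_inter_arith)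
  finally have "(K x y)\<^sup>2 \<le> (ennreal (sqrt c))\<^sup>2"
    using kernel_boundD(1)[OF assms(2)] by (simp add: ennreal_power)
  then show ?thesis
    by (cases "K x y") (auto simp: ennreal_power top_unique ennreal_le_iff abs_le_square_iff real_sqrt_le_iff
        kernel_boundD(1)[OF assms(2)] intro!: real_le_rsqrt)
qed

text \<open>
  An exponent above \<open>1/m\<close> is handled by splitting off the factor \<open>K\<^sup>\<alpha>\<^sup>-\<^sup>1\<^sup>/\<^sup>m\<close> of every entry and bounding it
  by the same power of the norm of the matrix.
\<close>

lemma (in sigma_finite_measure) kernel_bound_hadamard:
  assumes exp: "hadamard_exponent M m \<alpha>"
    and meas: "\<And>i. i \<in> {1..m} \<Longrightarrow> kernel_measurable M (K i)"
    and bound: "\<And>i. i \<in> {1..m} \<Longrightarrow> kernel_bound M (K i) (c i)"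
  shows "kernel_bound M (hadamard_kernel \<alpha> m K) (\<Prod>i=1..m. c i powr \<alpha>)"
proof (cases "\<alpha> = 1 / real m")
  case True
  then show ?thesis
    using kernel_bound_hadamard_mean[OF _ meas bound] exp by (auto simp: hadamard_exponent_def)
next
  case False
  let ?a = "1 / real m"
  from False exp obtain R where R: "M = count_space R" "?a \<le> \<alpha>" and m: "1 \<le> m"
    by (auto simp: hadamard_exponent_def)
  define d where "d = (\<Prod>i=1..m. sqrt (c i) powr (\<alpha> - ?a))"
  have c: "0 \<le> c i" if "i \<in> {1..m}" for i
    using kernel_boundD(1)[OF bound[OF that]] .
  have entry: "ennpowr (K i x y) \<alpha> \<le> ennreal (sqrt (c i) powr (\<alpha> - ?a)) * ennpowr (K i x y) ?a"
    if i: "i \<in> {1..m}" and xy: "x \<in> R" "y \<in> R" for i x y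
  proof -
    have "K i x y \<le> ennreal (sqrt (c i))"
      by (rule kernel_entry_le[OF R(1) bound[OF i] xy])
    then obtain k where k: "K i x y = ennreal k" "0 \<le> k" "k \<le> sqrt (c i)"
      using c[OF i] by (cases "K i x y") (auto simp: top_unique)
    have "k powr \<alpha> = k powr (\<alpha> - ?a) * k powr ?a"
      by (simp flip: powr_add)
    also have "\<dots> \<le> sqrt (c i) powr (\<alpha> - ?a) * k powr ?a"
      using k R by (intro mult_right_mono powr_mono2) auto
    finally show ?thesis
      using k by (simp add: ennpowr_ennreal flip: ennreal_mult)
  qed
  have "hadamard_kernel \<alpha> m K x y \<le> ennreal d * hadamard_kernel ?a m K x y"
    if "x \<in> R" "y \<in> R" for x y
  proof -
    have "hadamard_kernel \<alpha> m K x y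
        \<le> (\<Prod>i=1..m. ennreal (sqrt (c i) powr (\<alpha> - ?a)) * ennpowr (K i x y) ?a)"
      unfolding hadamard_kernel_def using entry that by (intro prod_mono_ennreal) auto
    then show ?thesis
      by (simp add: prod.distrib prod_ennreal d_def hadamard_kernel_def)
  qed note le = this
  have d: "0 \<le> d" by (simp add: d_def prod_nonneg)
  show ?thesis
    unfolding kernel_bound_def
  proof (intro conjI ballI)
    fix f :: "'a \<Rightarrow> ennreal" assume f [measurable]: "f \<in> borel_measurable M"
    have "kernel_apply M (hadamard_kernel \<alpha> m K) f x
        \<le> ennreal d * kernel_apply M (hadamard_kernel ?a m K) f x" if "x \<in> space M" for x
    proof -
      have "kernel_apply M (hadamard_kernel \<alpha> m K) f x
          \<le> (\<integral>\<^sup>+y. ennreal d * (hadamard_kernel ?a m K x y * f y) \<partial>M)"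
        unfolding kernel_apply_def
        using le that R(1) by (intro nn_integral_mono) (auto simp: mult.assoc[symmetric] intro!: mult_right_mono)
      then show ?thesis
        by (simp add: kernel_apply_def R(1) nn_integral_cmult)
    qed
    then have "sq_norm M (kernel_apply M (hadamard_kernel \<alpha> m K) f)
        \<le> sq_norm M (\<lambda>x. ennreal d * kernel_apply M (hadamard_kernel ?a m K) f x)"
      by (rule sq_norm_mono)
    also have "\<dots> = ennreal (d\<^sup>2) * sq_norm M (kernel_apply M (hadamard_kernel ?a m K) f)"
      using d by (simp add: sq_norm_def R(1) nn_integral_cmult power_mult_distrib ennreal_power)
    also have "\<dots> \<le> ennreal (d\<^sup>2) * (ennreal (\<Prod>i=1..m. c i powr ?a) * sq_norm M f)"
      by (intro mult_left_mono kernel_boundD(2)[OF kernel_bound_hadamard_mean[OF m meas bound]] f) auto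
    also have "\<dots> = ennreal (d\<^sup>2 * (\<Prod>i=1..m. c i powr ?a)) * sq_norm M f"
      by (simp add: ennreal_mult prod_nonneg mult.assoc)
    also have "d\<^sup>2 * (\<Prod>i=1..m. c i powr ?a) = (\<Prod>i=1..m. c i powr \<alpha>)"
      using c by (simp add: d_def power2_eq_square real_sqrt_mult flip: prod.distrib powr_mult powr_add)
    finally show "sq_norm M (kernel_apply M (hadamard_kernel \<alpha> m K) f)
        \<le> ennreal (\<Prod>i=1..m. c i powr \<alpha>) * sq_norm M f" .
  qed (simp add: prod_nonneg)
qed

section \<open>Bounds and growth of kernels\<close>

text \<open>
  The iterates have operator norm at most a constant times \<open>\<rho>\<^sup>n\<close>.  The exponent is doubled because \<open>sq_norm\<close>
  is the square of the norm.
\<close>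

definition kernel_growth :: "'a measure \<Rightarrow> ('a \<Rightarrow> 'a \<Rightarrow> ennreal) \<Rightarrow> real \<Rightarrow> bool" where
  "kernel_growth M K \<rho> \<longleftrightarrow> (\<exists>C\<ge>0. \<forall>n. \<forall>f\<in>borel_measurable M.
     sq_norm M ((kernel_apply M K ^^ n) f) \<le> ennreal (C * \<rho> ^ (2 * n)) * sq_norm M f)"

text \<open>
  For input only: the right-hand side matches every binary function, so that printing must not fold it.
\<close>

abbreviation (input) kernel_transpose :: "('a \<Rightarrow> 'a \<Rightarrow> ennreal) \<Rightarrow> 'a \<Rightarrow> 'a \<Rightarrow> ennreal" where
  "kernel_transpose K \<equiv> (\<lambda>x y. K y x)"

lemma sq_norm_cmult:
  assumes [measurable]: "f \<in> borel_measurable M"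
  shows "sq_norm M (\<lambda>x. a * f x) = a\<^sup>2 * sq_norm M f"
  unfolding sq_norm_def power_mult_distrib by (rule nn_integral_cmult) measurable

lemma sq_norm_eq_0_iff:
  assumes [measurable]: "f \<in> borel_measurable M"
  shows "sq_norm M f = 0 \<longleftrightarrow> (AE x in M. f x = 0)"
  by (simp add: sq_norm_def nn_integral_0_iff_AE)

lemma kernel_apply_eq_0:
  assumes "f \<in> borel_measurable M" "sq_norm M f = 0"
  shows "kernel_apply M K f = (\<lambda>_. 0)"
proof -
  have "kernel_apply M K f = kernel_apply M K (\<lambda>_. 0)"
    using assms by (intro kernel_apply_cong_AE) (simp add: sq_norm_eq_0_iff)
  then show ?thesis by (simp add: kernel_apply_def fun_eq_iff)
qed

lemma kernel_apply_cong_space: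
  "\<lbrakk>\<And>y. y \<in> space M \<Longrightarrow> f y = g y\<rbrakk> \<Longrightarrow> kernel_apply M K f = kernel_apply M K g"
  by (rule kernel_apply_cong_AE) simp

lemma funpow_mono_on_space:
  fixes S T :: "('a \<Rightarrow> ennreal) \<Rightarrow> 'a \<Rightarrow> ennreal"
  assumes "\<And>f g x. \<lbrakk>\<And>y. y \<in> space M \<Longrightarrow> f y \<le> g y; f \<in> borel_measurable M; g \<in> borel_measurable M; x \<in> space M\<rbrakk> \<Longrightarrow> S f x \<le> T g x"
    and "\<And>f. f \<in> borel_measurable M \<Longrightarrow> S f \<in> borel_measurable M" "\<And>f. f \<in> borel_measurable M \<Longrightarrow> T f \<in> borel_measurable M"
    and "f \<in> borel_measurable M" "x \<in> space M"
  shows "(S ^^ n) f x \<le> (T ^^ n) f x \<and> (S ^^ n) f \<in> borel_measurable M \<and> (T ^^ n) f \<in> borel_measurable M"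
  using assms(5)
proof (induction n arbitrary: x)
  case (Suc n)
  then show ?case
    using assms(1-4) by (auto intro!: assms(1))
qed (use assms in auto)

lemma sq_norm_top_bound:
  assumes "0 < c" "sq_norm M f = top"
  shows "y \<le> ennreal c * sq_norm M f"
  using assms by (simp add: ennreal_mult_top ennreal_eq_0_iff)

context sigma_finite_measure
begin

interpretation pair: pair_sigma_finite M M ..

lemma funpow_kernel_apply_measurable:
  assumes "kernel_measurable M K" "f \<in> borel_measurable M"
  shows "(kernel_apply M K ^^ n) f \<in> borel_measurable M"
  using assms by (induction n) (auto intro: kernel_apply_measurable)

lemma kernel_apply_cmult:
  assumes [measurable]: "kernel_measurable M K" "f \<in> borel_measurable M" "x \<in> space M"
  shows "kernel_apply M K (\<lambda>y. a * f y) x = a * kernel_apply M K f x"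
  unfolding kernel_apply_def mult.left_commute[of _ a] by (rule nn_integral_cmult) measurable

lemma kernel_bound_comp:
  assumes [measurable]: "kernel_measurable M K" "kernel_measurable M L"
    and K: "kernel_bound M K c" and L: "kernel_bound M L d"
  shows "kernel_bound M (kernel_comp M K L) (c * d)"
  unfolding kernel_bound_def
proof (intro conjI ballI)
  fix f :: "'a \<Rightarrow> ennreal" assume f [measurable]: "f \<in> borel_measurable M"
  have "sq_norm M (kernel_apply M (kernel_comp M K L) f) = sq_norm M (kernel_apply M K (kernel_apply M L f))"
    by (intro sq_norm_cong_AE AE_I2 kernel_apply_comp) measurable
  also have "\<dots> \<le> ennreal c * sq_norm M (kernel_apply M L f)"
    by (intro kernel_boundD(2)[OF K]) measurable
  also have "\<dots> \<le> ennreal c * (ennreal d * sq_norm M f)"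
    by (intro mult_left_mono kernel_boundD(2)[OF L] f) simp
  finally show "sq_norm M (kernel_apply M (kernel_comp M K L) f) \<le> ennreal (c * d) * sq_norm M f"
    using kernel_boundD(1)[OF K] kernel_boundD(1)[OF L] by (simp add: ennreal_mult mult.assoc)
qed (use kernel_boundD(1)[OF K] kernel_boundD(1)[OF L] in simp)

lemma kernel_bound_prod:
  assumes "\<And>p. p \<le> n \<Longrightarrow> kernel_measurable M (L p)"
    and "\<And>p. p \<le> n \<Longrightarrow> \<exists>c. kernel_bound M (L p) c"
  shows "\<exists>c. kernel_bound M (kernel_prod M n L) c"
  using assms
proof (induction n arbitrary: L)
  case (Suc n)
  obtain c where "kernel_bound M (L 0) c" using Suc.prems(2)[of 0] by auto
  moreover obtain d where "kernel_bound M (kernel_prod M n (\<lambda>p. L (Suc p))) d"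
    using Suc.IH[of "\<lambda>p. L (Suc p)"] Suc.prems by auto
  ultimately show ?case
    using Suc.prems(1) by (auto intro!: exI kernel_bound_comp kernel_prod_measurable)
qed simp

lemma funpow_kernel_apply_Suc:
  assumes K: "kernel_measurable M K" and f: "f \<in> borel_measurable M" and "x \<in> space M"
  shows "(kernel_apply M K ^^ Suc n) f x = kernel_apply M (kernel_prod M n (\<lambda>_. K)) f x"
  using assms(3)
proof (induction n arbitrary: x)
  case (Suc n)
  have "(kernel_apply M K ^^ Suc (Suc n)) f x = kernel_apply M K (kernel_apply M (kernel_prod M n (\<lambda>_. K)) f) x"
    using Suc.IH by (simp add: kernel_apply_cong_space[of M "kernel_apply M K ((kernel_apply M K ^^ n) f)"])
  also have "\<dots> = kernel_apply M (kernel_prod M (Suc n) (\<lambda>_. K)) f x"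
    using K f Suc.prems by (auto intro!: kernel_apply_comp[symmetric] kernel_prod_measurable)
  finally show ?case .
qed simp

lemma kernel_apply_transpose:
  assumes [measurable]: "kernel_measurable M K"
    and [measurable]: "f \<in> borel_measurable M" "g \<in> borel_measurable M"
  shows "(\<integral>\<^sup>+x. kernel_apply M K f x * g x \<partial>M) = (\<integral>\<^sup>+y. f y * kernel_apply M (kernel_transpose K) g y \<partial>M)"
proof -
  have "(\<integral>\<^sup>+x. kernel_apply M K f x * g x \<partial>M) = (\<integral>\<^sup>+x. (\<integral>\<^sup>+y. K x y * f y * g x \<partial>M) \<partial>M)"
    unfolding kernel_apply_def by (intro nn_integral_cong nn_integral_multc[symmetric]) measurable
  also have "\<dots> = (\<integral>\<^sup>+y. (\<integral>\<^sup>+x. K x y * f y * g x \<partial>M) \<partial>M)"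
    by (rule pair.Fubini') measurable
  also have "\<dots> = (\<integral>\<^sup>+y. f y * kernel_apply M (kernel_transpose K) g y \<partial>M)"
    unfolding kernel_apply_def
    by (intro nn_integral_cong) (simp add: mult.assoc mult.left_commute nn_integral_cmult)
  finally show ?thesis .
qed

lemma kernel_transpose_measurable:
  assumes "kernel_measurable M K"
  shows "kernel_measurable M (kernel_transpose K)"
  using measurable_pair_swap[OF assms] by (simp add: case_prod_beta')

text \<open>
  If \<open>h = K\<^sup>* g\<close> were known to have a finite norm, \<open>\<parallel>h\<parallel>\<^sup>2 = \<langle>K h, g\<rangle>\<close> and the Cauchy-Schwarz inequality would do.
  The argument is applied to bounded truncations of \<open>h\<close> supported on sets of finite measure, and Fatou's
  lemma passes to the limit.
\<close>

lemma kernel_bound_transpose: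
  assumes [measurable]: "kernel_measurable M K"
    and K: "kernel_bound M K c" and "0 < c"
  shows "kernel_bound M (kernel_transpose K) c"
  unfolding kernel_bound_def
proof (intro conjI ballI)
  show "0 \<le> c" using \<open>0 < c\<close> by simp
  fix g :: "'a \<Rightarrow> ennreal" assume [measurable]: "g \<in> borel_measurable M"
  note [measurable] = kernel_transpose_measurable[OF assms(1)]
  define h where "h = kernel_apply M (kernel_transpose K) g"
  have [measurable]: "h \<in> borel_measurable M" by (simp add: h_def)
  show "sq_norm M (kernel_apply M (kernel_transpose K) g) \<le> ennreal c * sq_norm M g"
  proof (cases "sq_norm M g = top")
    case False
    obtain A :: "nat \<Rightarrow> 'a set" where A: "range A \<subseteq> sets M" "(\<Union>i. A i) = space M"
        "\<And>i. emeasure M (A i) \<noteq> \<infinity>" "incseq A"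
      by (rule sigma_finite_incseq) blast
    have [measurable]: "A n \<in> sets M" for n using A(1) by auto
    define f where "f n x = min (h x) (of_nat n) * indicator (A n) x" for n x
    have [measurable]: "f n \<in> borel_measurable M" for n
      unfolding f_def by measurable
    have bound: "sq_norm M (f n) \<le> ennreal c * sq_norm M g" for n
    proof -
      have "sq_norm M (f n) \<le> (\<integral>\<^sup>+x. of_nat n * of_nat n * indicator (A n) x \<partial>M)"
        unfolding sq_norm_def f_def power2_eq_square
        by (intro nn_integral_mono) (auto split: split_indicator intro!: mult_mono)
      also have "\<dots> < top"
        using A(3)[of n]
        by (simp add: nn_integral_cmult ennreal_mult_less_top less_top of_nat_less_top)
      finally have fin: "sq_norm M (f n) < top" .
      have "sq_norm M (f n) \<le> (\<integral>\<^sup>+x. f n x * h x \<partial>M)"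
        unfolding sq_norm_def power2_eq_square
        by (intro nn_integral_mono mult_left_mono) (auto simp: f_def split: split_indicator)
      also have "\<dots> = (\<integral>\<^sup>+x. kernel_apply M K (f n) x * g x \<partial>M)"
        unfolding h_def by (rule kernel_apply_transpose[symmetric]) measurable
      finally have "(sq_norm M (f n))\<^sup>2 \<le> (\<integral>\<^sup>+x. kernel_apply M K (f n) x * g x \<partial>M)\<^sup>2"
        by (intro power_mono) auto
      also have "\<dots> \<le> sq_norm M (kernel_apply M K (f n)) * sq_norm M g"
        unfolding sq_norm_def by (rule Cauchy_Schwarz_nn_integral) measurable
      also have "\<dots> \<le> ennreal c * sq_norm M (f n) * sq_norm M g"
        by (intro mult_right_mono kernel_boundD(2)[OF K]) auto
      finally have *: "sq_norm M (f n) * sq_norm M (f n) \<le> sq_norm M (f n) * (ennreal c * sq_norm M g)"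
        by (simp add: power2_eq_square mult_ac)
      then show ?thesis
        using fin by (cases "sq_norm M (f n) = 0") (auto simp: ennreal_mult_le_mult_iff)
    qed
    have lim: "(\<lambda>n. (f n x)\<^sup>2) \<longlonglongrightarrow> (h x)\<^sup>2" if "x \<in> space M" for x
    proof -
      from A(2) that obtain k where k: "x \<in> A k" by blast
      have ev: "eventually (\<lambda>n. min (h x) (of_nat n) = f n x) sequentially"
        using eventually_ge_at_top[of k]
        by eventually_elim (use k A(4) in \<open>auto simp: f_def incseq_def split: split_indicator\<close>)
      have "(\<lambda>n. min (h x) (of_nat n)) \<longlonglongrightarrow> min (h x) top"
        by (intro tendsto_min tendsto_const of_nat_tendsto_top_ennreal)
      then have "(\<lambda>n. f n x) \<longlonglongrightarrow> h x"
        using tendsto_cong[OF ev] by simp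
      then show ?thesis
        unfolding power2_eq_square by (intro tendsto_mult_ennreal) auto
    qed
    have "sq_norm M h = (\<integral>\<^sup>+x. liminf (\<lambda>n. (f n x)\<^sup>2) \<partial>M)"
      unfolding sq_norm_def using lim by (intro nn_integral_cong lim_imp_Liminf[symmetric]) auto
    also have "\<dots> \<le> liminf (\<lambda>n. sq_norm M (f n))"
      unfolding sq_norm_def by (rule nn_integral_liminf) measurable
    also have "\<dots> \<le> ennreal c * sq_norm M g"
      by (rule Liminf_le) (use bound in auto)
    finally show ?thesis by (simp add: h_def)
  qed (use \<open>0 < c\<close> in \<open>simp add: sq_norm_top_bound\<close>)
qed

text \<open>
  A gliding hump: if the kernel were unbounded, there would be unit vectors \<open>h\<^sub>n\<close> with very large images,
  and the supremum of \<open>2\<^sup>-\<^sup>n h\<^sub>n\<close> is square-integrable with an image that dominates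
  all \<open>2\<^sup>-\<^sup>n K h\<^sub>n\<close>.
\<close>

lemma kernel_bound_of_finite:
  assumes [measurable]: "kernel_measurable M K"
    and fin: "\<And>f. f \<in> borel_measurable M \<Longrightarrow> sq_norm M f < top \<Longrightarrow> sq_norm M (kernel_apply M K f) < top"
  shows "\<exists>c>0. kernel_bound M K c"
proof (rule ccontr)
  assume no: "\<not> ?thesis"
  have "\<exists>h\<in>borel_measurable M. sq_norm M h = 1 \<and> ennreal (8 ^ n) \<le> sq_norm M (kernel_apply M K h)" for n
  proof -
    have "\<not> kernel_bound M K (8 ^ n)" using no by auto
    then obtain f where [measurable]: "f \<in> borel_measurable M"
      and f: "\<not> sq_norm M (kernel_apply M K f) \<le> ennreal (8 ^ n) * sq_norm M f"
      by (auto simp: kernel_bound_def)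
    have "sq_norm M f \<noteq> 0"
    proof
      assume "sq_norm M f = 0"
      then have "kernel_apply M K f = (\<lambda>_. 0)"
        by (intro kernel_apply_eq_0) measurable
      then show False using f by (simp add: sq_norm_def)
    qed
    moreover have "sq_norm M f \<noteq> top"
      using f sq_norm_top_bound[of "8 ^ n" M f] by auto
    ultimately obtain s where s: "sq_norm M f = ennreal s" "0 < s"
      by (cases "sq_norm M f") (auto simp: ennreal_eq_0_iff not_le)
    define a where "a = 1 / sqrt s"
    have a: "0 < a" "a\<^sup>2 * s = 1" using s by (auto simp: a_def power_divide)
    have "kernel_apply M K (\<lambda>x. ennreal a * f x) x = ennreal a * kernel_apply M K f x" if "x \<in> space M" for x
      using that by (intro kernel_apply_cmult) measurable
    then have "sq_norm M (kernel_apply M K (\<lambda>x. ennreal a * f x)) = sq_norm M (\<lambda>x. ennreal a * kernel_apply M K f x)"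
      by (intro sq_norm_cong_AE) auto
    also have "\<dots> = ennreal (a\<^sup>2) * sq_norm M (kernel_apply M K f)"
      using a by (simp add: sq_norm_cmult ennreal_power)
    also have "\<dots> \<ge> ennreal (a\<^sup>2) * (ennreal (8 ^ n) * sq_norm M f)"
      using f by (intro mult_left_mono) auto
    also have "ennreal (a\<^sup>2) * (ennreal (8 ^ n) * sq_norm M f) = ennreal (8 ^ n) * ennreal (a\<^sup>2 * s)"
      using s by (simp add: ennreal_mult mult_ac)
    finally have "ennreal (8 ^ n) \<le> sq_norm M (kernel_apply M K (\<lambda>x. ennreal a * f x))"
      using a by simp
    moreover have "sq_norm M (\<lambda>x. ennreal a * f x) = 1"
      using a s by (simp add: sq_norm_cmult ennreal_power flip: ennreal_mult)
    ultimately show ?thesis by (intro bexI[of _ "\<lambda>x. ennreal a * f x"]) auto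
  qed
  then obtain h where [measurable]: "\<And>n. h n \<in> borel_measurable M" and h: "\<And>n. sq_norm M (h n) = 1"
      "\<And>n. ennreal (8 ^ n) \<le> sq_norm M (kernel_apply M K (h n))"
    by metis
  \<comment> \<open>The factor \<open>8\<^sup>n\<close> beats the factor \<open>4\<^sup>-\<^sup>n\<close> that the square norm of \<open>2\<^sup>-\<^sup>n K h\<^sub>n\<close> contains.\<close>
  define u where "u n x = ennreal ((1/2) ^ n) * h n x" for n x
  define g where "g x = (SUP n. u n x)" for x
  have [measurable]: "u n \<in> borel_measurable M" for n unfolding u_def by measurable
  have [measurable]: "g \<in> borel_measurable M" unfolding g_def by measurable
  have quarter: "((1/2) ^ n)\<^sup>2 = (1/4::real) ^ n" for n
    by (simp add: power2_eq_square flip: power_mult_distrib)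
  have sq_u: "sq_norm M (u n) = ennreal ((1/4) ^ n)" for n
    unfolding u_def by (simp add: sq_norm_cmult h ennreal_power quarter)
  have "(g x)\<^sup>2 \<le> (\<Sum>n. (u n x)\<^sup>2)" for x
  proof -
    have "u i x * u j x \<le> (\<Sum>n. (u n x)\<^sup>2)" for i j
    proof -
      have "u i x * u j x \<le> (u (if u i x \<le> u j x then j else i) x)\<^sup>2"
        by (auto simp: power2_eq_square intro!: mult_mono)
      also have "\<dots> \<le> (\<Sum>n. (u n x)\<^sup>2)"
        using sum_le_suminf[of "\<lambda>n. (u n x)\<^sup>2" "{if u i x \<le> u j x then j else i}"] by simp
      finally show ?thesis .
    qed
    then show ?thesis
      by (simp add: power2_eq_square g_def SUP_mult_left_ennreal SUP_mult_right_ennreal SUP_le_iff)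
  qed
  then have "sq_norm M g \<le> (\<integral>\<^sup>+x. (\<Sum>n. (u n x)\<^sup>2) \<partial>M)"
    unfolding sq_norm_def by (intro nn_integral_mono) auto
  also have "\<dots> = (\<Sum>n. sq_norm M (u n))"
    unfolding sq_norm_def by (rule nn_integral_suminf) measurable
  also have "\<dots> = ennreal (\<Sum>n. (1/4) ^ n)"
    unfolding sq_u by (intro suminf_ennreal2 summable_geometric) auto
  finally have "sq_norm M g < top" by (simp add: order_le_less_trans)
  then have fin_g: "sq_norm M (kernel_apply M K g) < top" by (intro fin) measurable
  have large: "ennreal (2 ^ n) \<le> sq_norm M (kernel_apply M K g)" for n
  proof -
    have "ennreal (2 ^ n) = ennreal ((1/4) ^ n) * ennreal (8 ^ n)"
      by (simp flip: ennreal_mult power_mult_distrib)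
    also have "\<dots> \<le> ennreal ((1/4) ^ n) * sq_norm M (kernel_apply M K (h n))"
      by (intro mult_left_mono h) auto
    also have "\<dots> = sq_norm M (\<lambda>x. ennreal ((1/2) ^ n) * kernel_apply M K (h n) x)"
      by (simp add: sq_norm_cmult ennreal_power quarter)
    also have "\<dots> = sq_norm M (kernel_apply M K (u n))"
      unfolding u_def by (intro sq_norm_cong_AE AE_I2 kernel_apply_cmult[symmetric]) measurable
    also have "\<dots> \<le> sq_norm M (kernel_apply M K g)"
      by (intro sq_norm_mono kernel_apply_mono) (auto simp: g_def intro: SUP_upper)
    finally show ?thesis .
  qed
  obtain s where s: "sq_norm M (kernel_apply M K g) = ennreal s" "0 \<le> s"
    using fin_g by (cases "sq_norm M (kernel_apply M K g)") auto
  obtain n where "s < 2 ^ n" using real_arch_pow[of 2 s] by auto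
  then show False using large[of n] s by (simp add: ennreal_le_iff2)
qed


lemma kernel_growth_mono:
  assumes [measurable]: "kernel_measurable M K" "kernel_measurable M L"
    and le: "\<And>x y. x \<in> space M \<Longrightarrow> y \<in> space M \<Longrightarrow> K x y \<le> L x y" and L: "kernel_growth M L \<rho>"
  shows "kernel_growth M K \<rho>"
proof -
  obtain C where C: "0 \<le> C" "\<And>n f. f \<in> borel_measurable M \<Longrightarrow>
      sq_norm M ((kernel_apply M L ^^ n) f) \<le> ennreal (C * \<rho> ^ (2 * n)) * sq_norm M f"
    using L by (auto simp: kernel_growth_def)
  have "sq_norm M ((kernel_apply M K ^^ n) f) \<le> sq_norm M ((kernel_apply M L ^^ n) f)"
    if [measurable]: "f \<in> borel_measurable M" for n f
  proof (rule sq_norm_mono)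
    fix x assume x: "x \<in> space M"
    show "(kernel_apply M K ^^ n) f x \<le> (kernel_apply M L ^^ n) f x"
      by (rule funpow_mono_on_space[THEN conjunct1, of M])
        (use le x in \<open>auto intro: kernel_apply_mono kernel_apply_measurable\<close>)
  qed
  then show ?thesis
    unfolding kernel_growth_def using C by (meson order_trans)
qed

text \<open>
  Bounds for the powers \<open>K\<^sup>1, K\<^sup>2, \<dots>\<close> suffice; the maximum with \<open>1\<close> in the constant takes care of the
  identity.
\<close>

lemma kernel_growthI:
  assumes K: "kernel_measurable M K" and "0 \<le> C"
    and bound: "\<And>n. kernel_bound M (kernel_prod M n (\<lambda>_. K)) (C * \<rho> ^ (2 * Suc n))"
  shows "kernel_growth M K \<rho>"
  unfolding kernel_growth_def
proof (intro exI[of _ "max 1 C"] conjI allI ballI)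
  fix n and f :: "'a \<Rightarrow> ennreal" assume f: "f \<in> borel_measurable M"
  show "sq_norm M ((kernel_apply M K ^^ n) f) \<le> ennreal (max 1 C * \<rho> ^ (2 * n)) * sq_norm M f"
  proof (cases n)
    case (Suc k)
    have "sq_norm M ((kernel_apply M K ^^ n) f) = sq_norm M (kernel_apply M (kernel_prod M k (\<lambda>_. K)) f)"
      unfolding Suc by (intro sq_norm_cong_AE AE_I2 funpow_kernel_apply_Suc K f)
    also have "\<dots> \<le> ennreal (C * \<rho> ^ (2 * n)) * sq_norm M f"
      unfolding Suc by (rule kernel_boundD(2)[OF bound f])
    also have "\<dots> \<le> ennreal (max 1 C * \<rho> ^ (2 * n)) * sq_norm M f"
      by (intro mult_right_mono ennreal_leI) (auto simp: power_mult)
    finally show ?thesis .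
  next
    case 0
    have "1 * sq_norm M f \<le> ennreal (max 1 C) * sq_norm M f"
      by (intro mult_right_mono) (auto simp flip: ennreal_1 intro!: ennreal_leI)
    then show ?thesis by (simp add: 0)
  qed
qed simp

lemma kernel_growthD:
  assumes K: "kernel_measurable M K" and "kernel_growth M K \<rho>"
  shows "\<exists>C\<ge>0. \<forall>n. kernel_bound M (kernel_prod M n (\<lambda>_. K)) (C * \<rho> ^ (2 * Suc n))"
proof -
  obtain C where C: "0 \<le> C" "\<And>n f. f \<in> borel_measurable M \<Longrightarrow>
      sq_norm M ((kernel_apply M K ^^ n) f) \<le> ennreal (C * \<rho> ^ (2 * n)) * sq_norm M f"
    using assms(2) by (auto simp: kernel_growth_def)
  show ?thesis
  proof (intro exI conjI allI, rule C(1))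
    fix n
    show "kernel_bound M (kernel_prod M n (\<lambda>_. K)) (C * \<rho> ^ (2 * Suc n))"
      unfolding kernel_bound_def
    proof (intro conjI ballI)
      show "0 \<le> C * \<rho> ^ (2 * Suc n)" using C(1) unfolding power_mult by simp
      fix f :: "'a \<Rightarrow> ennreal" assume f: "f \<in> borel_measurable M"
      have "sq_norm M (kernel_apply M (kernel_prod M n (\<lambda>_. K)) f) = sq_norm M ((kernel_apply M K ^^ Suc n) f)"
        by (intro sq_norm_cong_AE AE_I2 funpow_kernel_apply_Suc[symmetric] K f)
      also have "\<dots> \<le> ennreal (C * \<rho> ^ (2 * Suc n)) * sq_norm M f"
        by (rule C(2)[OF f])
      finally show "sq_norm M (kernel_apply M (kernel_prod M n (\<lambda>_. K)) f)
          \<le> ennreal (C * \<rho> ^ (2 * Suc n)) * sq_norm M f" .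
    qed
  qed
qed

end

section \<open>Growth of Hadamard products, of products and of roots\<close>

lemma le_ennreal_of_power2_le:
  assumes "x\<^sup>2 \<le> ennreal (y\<^sup>2)" "0 \<le> y"
  shows "x \<le> ennreal y"
proof (cases x)
  case (real r)
  with assms(1) have "r\<^sup>2 \<le> y\<^sup>2"
    by (simp add: ennreal_power ennreal_le_iff)
  then have "r \<le> y"
    using assms(2) by (rule power2_le_imp_le)
  with real show ?thesis
    by (simp add: ennreal_leI)
qed (use assms in \<open>simp add: top_unique\<close>)

lemma kernel_bound_mono:
  assumes "\<And>x y. x \<in> space M \<Longrightarrow> y \<in> space M \<Longrightarrow> K x y \<le> L x y" "kernel_bound M L c"
  shows "kernel_bound M K c"
  unfolding kernel_bound_def
proof (intro conjI ballI)
  fix f :: "'a \<Rightarrow> ennreal" assume f: "f \<in> borel_measurable M"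
  have "sq_norm M (kernel_apply M K f) \<le> sq_norm M (kernel_apply M L f)"
    using assms(1) by (intro sq_norm_mono kernel_apply_mono) auto
  also have "\<dots> \<le> ennreal c * sq_norm M f"
    by (rule kernel_boundD(2)[OF assms(2) f])
  finally show "sq_norm M (kernel_apply M K f) \<le> ennreal c * sq_norm M f" .
qed (use kernel_boundD(1)[OF assms(2)] in simp)

context sigma_finite_measure
begin

text \<open>
  The \<open>n\<close>-th power of the Hadamard product lies below the Hadamard product of the \<open>n\<close>-th powers, whose
  norm is at most the product of the norms raised to \<open>\<alpha>\<close>.
\<close>

lemma kernel_growth_hadamard:
  assumes exp: "hadamard_exponent M m \<alpha>" and "0 < \<rho>"
    and meas: "\<And>i. i \<in> {1..m} \<Longrightarrow> kernel_measurable M (K i)"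
    and growth: "\<And>i. i \<in> {1..m} \<Longrightarrow> kernel_growth M (K i) \<rho>"
  shows "kernel_growth M (hadamard_kernel \<alpha> m K) (\<rho> powr (real m * \<alpha>))"
proof -
  have "\<forall>i\<in>{1..m}. \<exists>C\<ge>0. \<forall>n. kernel_bound M (kernel_prod M n (\<lambda>_. K i)) (C * \<rho> ^ (2 * Suc n))"
    using kernel_growthD[OF meas growth] by blast
  then obtain C where C: "\<And>i. i \<in> {1..m} \<Longrightarrow> 0 \<le> C i"
      "\<And>i n. i \<in> {1..m} \<Longrightarrow> kernel_bound M (kernel_prod M n (\<lambda>_. K i)) (C i * \<rho> ^ (2 * Suc n))"
    by metis
  show ?thesis
  proof (rule kernel_growthI)
    show "kernel_measurable M (hadamard_kernel \<alpha> m K)"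
      by (rule hadamard_kernel_measurable[OF meas])
    show "0 \<le> (\<Prod>i=1..m. C i powr \<alpha>)" by (simp add: prod_nonneg)
    fix n
    have pw: "((\<rho> ^ k) powr \<alpha>) ^ m = (\<rho> powr (real m * \<alpha>)) ^ k" for k
      using \<open>0 < \<rho>\<close> by (simp add: powr_realpow[symmetric] powr_powr mult_ac)
    have "(\<Prod>i=1..m. (C i * \<rho> ^ (2 * Suc n)) powr \<alpha>) = (\<Prod>i=1..m. C i powr \<alpha> * (\<rho> ^ (2 * Suc n)) powr \<alpha>)"
      by (simp add: powr_mult)
    also have "\<dots> = (\<Prod>i=1..m. C i powr \<alpha>) * ((\<rho> ^ (2 * Suc n)) powr \<alpha>) ^ m"
      by (simp add: prod.distrib)
    also have "((\<rho> ^ (2 * Suc n)) powr \<alpha>) ^ m = (\<rho> powr (real m * \<alpha>)) ^ (2 * Suc n)"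
      using pw .
    finally have c: "(\<Prod>i=1..m. (C i * \<rho> ^ (2 * Suc n)) powr \<alpha>)
        = (\<Prod>i=1..m. C i powr \<alpha>) * (\<rho> powr (real m * \<alpha>)) ^ (2 * Suc n)" .
    have "kernel_bound M (hadamard_kernel \<alpha> m (\<lambda>i. kernel_prod M n (\<lambda>_. K i)))
        (\<Prod>i=1..m. (C i * \<rho> ^ (2 * Suc n)) powr \<alpha>)"
      by (rule kernel_bound_hadamard[OF exp kernel_prod_measurable[OF meas] C(2)])
    then show "kernel_bound M (kernel_prod M n (\<lambda>_. hadamard_kernel \<alpha> m K))
        ((\<Prod>i=1..m. C i powr \<alpha>) * (\<rho> powr (real m * \<alpha>)) ^ (2 * Suc n))"
      unfolding c[symmetric]
      by (rule kernel_bound_mono[rotated])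
         (rule kernel_prod_hadamard_le[OF exp, of n "\<lambda>i _. K i"], use meas in auto)
  qed
qed

lemma funpow_kernel_apply_comp:
  assumes K: "kernel_measurable M K" and L: "kernel_measurable M L"
    and f: "f \<in> borel_measurable M" and "x \<in> space M"
  shows "(kernel_apply M (kernel_comp M K L) ^^ n) f x = ((\<lambda>g. kernel_apply M K (kernel_apply M L g)) ^^ n) f x
    \<and> ((\<lambda>g. kernel_apply M K (kernel_apply M L g)) ^^ n) f \<in> borel_measurable M"
  using assms(4)
proof (induction n arbitrary: x)
  case (Suc n)
  let ?g = "((\<lambda>g. kernel_apply M K (kernel_apply M L g)) ^^ n) f"
  have g: "?g \<in> borel_measurable M" using Suc by blast
  have eq: "kernel_apply M (kernel_comp M K L) ((kernel_apply M (kernel_comp M K L) ^^ n) f)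
      = kernel_apply M (kernel_comp M K L) ?g"
    by (rule kernel_apply_cong_space) (use Suc.IH in blast)
  have "(kernel_apply M (kernel_comp M K L) ^^ Suc n) f x = kernel_apply M (kernel_comp M K L) ?g x"
    by (simp only: funpow.simps comp_apply eq)
  also have "\<dots> = kernel_apply M K (kernel_apply M L ?g) x"
    by (rule kernel_apply_comp[OF K L g Suc.prems])
  finally show ?case
    using kernel_apply_measurable[OF K kernel_apply_measurable[OF L g]]
    by (simp only: funpow.simps comp_apply)
qed (use f in simp)

text \<open>
  This is \<open>r(K L) = r(L K)\<close>, from \<open>(L K)\<^sup>n\<^sup>+\<^sup>1 = L (K L)\<^sup>n K\<close>.
\<close>

lemma kernel_growth_comp_commute:
  assumes K: "kernel_measurable M K" "\<exists>c. kernel_bound M K c"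
    and L: "kernel_measurable M L" "\<exists>c. kernel_bound M L c"
    and "0 < \<rho>" and growth: "kernel_growth M (kernel_comp M K L) \<rho>"
  shows "kernel_growth M (kernel_comp M L K) \<rho>"
proof -
  obtain a b where a: "kernel_bound M K a" and b: "kernel_bound M L b" using K L by auto
  obtain C where C: "0 \<le> C" "\<And>n f. f \<in> borel_measurable M \<Longrightarrow>
      sq_norm M ((kernel_apply M (kernel_comp M K L) ^^ n) f) \<le> ennreal (C * \<rho> ^ (2 * n)) * sq_norm M f"
    using growth by (auto simp: kernel_growth_def)
  define D where "D = max 1 (b * C * a / \<rho>\<^sup>2)"
  have ab: "0 \<le> a" "0 \<le> b" using a b by (auto dest: kernel_boundD)
  have swap: "((\<lambda>g. kernel_apply M L (kernel_apply M K g)) ^^ Suc n) f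
      = kernel_apply M L (((\<lambda>g. kernel_apply M K (kernel_apply M L g)) ^^ n) (kernel_apply M K f))" for n f
    by (induction n) auto
  show ?thesis
    unfolding kernel_growth_def
  proof (intro exI[of _ D] conjI allI ballI)
    fix n and f :: "'a \<Rightarrow> ennreal" assume f: "f \<in> borel_measurable M"
    have Kf: "kernel_apply M K f \<in> borel_measurable M" using K f by (intro kernel_apply_measurable)
    show "sq_norm M ((kernel_apply M (kernel_comp M L K) ^^ n) f) \<le> ennreal (D * \<rho> ^ (2 * n)) * sq_norm M f"
    proof (cases n)
      case 0
      have "1 * sq_norm M f \<le> ennreal D * sq_norm M f"
        by (intro mult_right_mono) (auto simp: D_def simp flip: ennreal_1 intro!: ennreal_leI)
      then show ?thesis by (simp add: 0)
    next
      case (Suc k)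
      let ?g = "((\<lambda>g. kernel_apply M K (kernel_apply M L g)) ^^ k) (kernel_apply M K f)"
      let ?h = "(kernel_apply M (kernel_comp M K L) ^^ k) (kernel_apply M K f)"
      have "sq_norm M ((kernel_apply M (kernel_comp M L K) ^^ n) f) = sq_norm M (kernel_apply M L ?g)"
        unfolding Suc swap[symmetric] using funpow_kernel_apply_comp[OF L(1) K(1) f]
        by (intro sq_norm_cong_AE AE_I2) blast
      also have "\<dots> = sq_norm M (kernel_apply M L ?h)"
        using funpow_kernel_apply_comp[OF K(1) L(1) Kf]
        by (subst kernel_apply_cong_space[of M ?g ?h]) auto
      also have "\<dots> \<le> ennreal b * sq_norm M ?h"
        using K L Kf by (intro kernel_boundD(2)[OF b] funpow_kernel_apply_measurable kernel_comp_measurable)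
      also have "\<dots> \<le> ennreal b * (ennreal (C * \<rho> ^ (2 * k)) * sq_norm M (kernel_apply M K f))"
        by (intro mult_left_mono C Kf) simp
      also have "\<dots> \<le> ennreal b * (ennreal (C * \<rho> ^ (2 * k)) * (ennreal a * sq_norm M f))"
        by (intro mult_left_mono kernel_boundD(2)[OF a] f) simp_all
      also have "\<dots> = ennreal (b * C * a * \<rho> ^ (2 * k)) * sq_norm M f"
        using ab C \<open>0 < \<rho>\<close> by (simp add: ennreal_mult[symmetric] mult.assoc[symmetric]) (simp add: mult_ac)
      also have "\<dots> \<le> ennreal (D * \<rho> ^ (2 * n)) * sq_norm M f"
      proof (intro mult_right_mono ennreal_leI)
        have "b * C * a * \<rho> ^ (2 * k) = (b * C * a / \<rho>\<^sup>2) * \<rho> ^ (2 * n)"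
          using \<open>0 < \<rho>\<close> by (simp add: Suc power2_eq_square)
        also have "\<dots> \<le> D * \<rho> ^ (2 * n)"
          using \<open>0 < \<rho>\<close> by (intro mult_right_mono) (auto simp: D_def)
        finally show "b * C * a * \<rho> ^ (2 * k) \<le> D * \<rho> ^ (2 * n)" .
      qed simp
      finally show ?thesis .
    qed
  qed (simp add: D_def)
qed

text \<open>
  Growth along the multiples of \<open>n + 1\<close> determines the growth: the remaining at most \<open>n\<close> factors cost a
  bounded amount.
\<close>

lemma kernel_growth_root:
  assumes K: "kernel_measurable M K" "\<exists>c. kernel_bound M K c"
    and "0 < \<sigma>" and growth: "kernel_growth M (kernel_prod M n (\<lambda>_. K)) (\<sigma> ^ Suc n)"
  shows "kernel_growth M K \<sigma>"
proof -
  let ?P = "kernel_prod M n (\<lambda>_. K)" and ?k = "kernel_apply M K"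
  have P: "kernel_measurable M ?P" by (intro kernel_prod_measurable K)
  obtain b where b: "kernel_bound M K b" using K by auto
  obtain C where C: "0 \<le> C" "\<And>q f. f \<in> borel_measurable M \<Longrightarrow>
      sq_norm M ((kernel_apply M ?P ^^ q) f) \<le> ennreal (C * (\<sigma> ^ Suc n) ^ (2 * q)) * sq_norm M f"
    using growth by (auto simp: kernel_growth_def)
  have b0: "0 \<le> b" using b by (rule kernel_boundD)
  have blocks: "(?k ^^ (q * Suc n)) f x = (kernel_apply M ?P ^^ q) f x"
    if f: "f \<in> borel_measurable M" and "x \<in> space M" for q f x
    using that(2)
  proof (induction q arbitrary: x)
    case (Suc q)
    let ?g = "(?k ^^ (q * Suc n)) f"
    have "(?k ^^ (Suc q * Suc n)) f x = (?k ^^ Suc n) ?g x"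
      by (simp only: mult_Suc funpow_add comp_apply)
    also have "\<dots> = kernel_apply M ?P ?g x"
      by (rule funpow_kernel_apply_Suc[OF K(1) funpow_kernel_apply_measurable[OF K(1) f] Suc.prems])
    also have "kernel_apply M ?P ?g = kernel_apply M ?P ((kernel_apply M ?P ^^ q) f)"
      by (rule kernel_apply_cong_space) (rule Suc.IH)
    also have "\<dots> x = (kernel_apply M ?P ^^ Suc q) f x"
      by simp
    finally show ?case .
  qed simp
  have rest: "sq_norm M ((?k ^^ s) f) \<le> ennreal (b ^ s) * sq_norm M f" if f: "f \<in> borel_measurable M" for s f
  proof (induction s)
    case (Suc s)
    have "sq_norm M ((?k ^^ Suc s) f) \<le> ennreal b * sq_norm M ((?k ^^ s) f)"
      using kernel_boundD(2)[OF b funpow_kernel_apply_measurable[OF K(1) f]] by simp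
    also have "\<dots> \<le> ennreal b * (ennreal (b ^ s) * sq_norm M f)"
      by (intro mult_left_mono Suc) simp
    finally show ?case using b0 by (simp add: ennreal_mult mult.assoc)
  qed simp
  define d where "d = max 1 (b / \<sigma>\<^sup>2)"
  show ?thesis
    unfolding kernel_growth_def
  proof (intro exI[of _ "C * d ^ Suc n"] conjI allI ballI)
    show "0 \<le> C * d ^ Suc n" using C by (simp add: d_def)
    fix l and f :: "'a \<Rightarrow> ennreal" assume f: "f \<in> borel_measurable M"
    define q s where "q = l div Suc n" and "s = l mod Suc n"
    have l: "l = s + q * Suc n"
      unfolding q_def s_def by (metis mod_mult_div_eq mult.commute)
    have s: "s \<le> Suc n"
      unfolding s_def by (rule less_imp_le) simp
    have "sq_norm M ((?k ^^ l) f) = sq_norm M ((?k ^^ s) ((?k ^^ (q * Suc n)) f))"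
      by (simp only: l funpow_add comp_apply)
    also have "\<dots> \<le> ennreal (b ^ s) * sq_norm M ((?k ^^ (q * Suc n)) f)"
      by (intro rest funpow_kernel_apply_measurable K f)
    also have "sq_norm M ((?k ^^ (q * Suc n)) f) = sq_norm M ((kernel_apply M ?P ^^ q) f)"
      by (intro sq_norm_cong_AE AE_I2 blocks f)
    also have "ennreal (b ^ s) * \<dots> \<le> ennreal (b ^ s) * (ennreal (C * (\<sigma> ^ Suc n) ^ (2 * q)) * sq_norm M f)"
      by (intro mult_left_mono C f) simp
    also have "\<dots> = ennreal (b ^ s * (C * (\<sigma> ^ Suc n) ^ (2 * q))) * sq_norm M f"
      using b0 C(1) \<open>0 < \<sigma>\<close> by (simp add: ennreal_mult mult.assoc)
    also have "\<dots> \<le> ennreal (C * d ^ Suc n * \<sigma> ^ (2 * l)) * sq_norm M f"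
    proof (intro mult_right_mono ennreal_leI)
      have "(b / \<sigma>\<^sup>2) ^ s \<le> d ^ s"
        using b0 by (intro power_mono) (auto simp: d_def)
      also have "\<dots> \<le> d ^ Suc n"
        by (rule power_increasing[OF s]) (simp add: d_def)
      finally have "b ^ s \<le> d ^ Suc n * \<sigma> ^ (2 * s)"
        using \<open>0 < \<sigma>\<close> by (simp add: power_divide field_simps flip: power_mult)
      then have "b ^ s * (C * (\<sigma> ^ Suc n) ^ (2 * q)) \<le> d ^ Suc n * \<sigma> ^ (2 * s) * (C * (\<sigma> ^ Suc n) ^ (2 * q))"
        using C(1) \<open>0 < \<sigma>\<close> by (intro mult_right_mono) auto
      also have "\<dots> = C * d ^ Suc n * (\<sigma> ^ (2 * s) * \<sigma> ^ (Suc n * (2 * q)))"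
        unfolding power_mult[of \<sigma> "Suc n"] by (simp only: mult_ac)
      also have "\<sigma> ^ (2 * s) * \<sigma> ^ (Suc n * (2 * q)) = \<sigma> ^ (2 * l)"
        unfolding power_add[symmetric] l by (simp add: algebra_simps)
      finally show "b ^ s * (C * (\<sigma> ^ Suc n) ^ (2 * q)) \<le> C * d ^ Suc n * \<sigma> ^ (2 * l)" .
    qed simp
    finally show "sq_norm M ((?k ^^ l) f) \<le> ennreal (C * d ^ Suc n * \<sigma> ^ (2 * l)) * sq_norm M f" .
  qed
qed

lemma nn_integral_symmetric_funpow:
  assumes sym: "\<And>f g. \<lbrakk>f \<in> borel_measurable M; g \<in> borel_measurable M\<rbrakk>
      \<Longrightarrow> (\<integral>\<^sup>+x. u f x * g x \<partial>M) = (\<integral>\<^sup>+x. f x * u g x \<partial>M)"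
    and u: "\<And>f. f \<in> borel_measurable M \<Longrightarrow> u f \<in> borel_measurable M"
    and "f \<in> borel_measurable M" "g \<in> borel_measurable M"
  shows "(\<integral>\<^sup>+x. (u ^^ n) f x * g x \<partial>M) = (\<integral>\<^sup>+x. f x * (u ^^ n) g x \<partial>M)"
  using assms(3,4)
proof (induction n arbitrary: f g)
  case (Suc n)
  have meas: "(u ^^ k) h \<in> borel_measurable M" if "h \<in> borel_measurable M" for k h
    using that by (induction k) (auto intro: u)
  have "(\<integral>\<^sup>+x. (u ^^ Suc n) f x * g x \<partial>M) = (\<integral>\<^sup>+x. (u ^^ n) f x * u g x \<partial>M)"
    using sym[of "(u ^^ n) f" g] Suc.prems meas by simp
  also have "\<dots> = (\<integral>\<^sup>+x. f x * (u ^^ n) (u g) x \<partial>M)"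
    by (rule Suc.IH) (use Suc.prems u in auto)
  finally show ?case by (simp add: funpow_swap1)
qed simp

text \<open>
  For \<open>u = S\<^sup>* S\<close> the Cauchy-Schwarz inequality gives \<open>\<parallel>u\<^sup>n f\<parallel>\<^sup>2 \<le> \<parallel>u\<^sup>2\<^sup>n f\<parallel> \<parallel>f\<parallel>\<close>.  Repeated doubling shows that
  \<open>\<parallel>u f\<parallel> / \<parallel>f\<parallel>\<close> is at most the growth rate of \<open>u\<close>, hence at most that of any kernel above it, and
  \<open>\<parallel>S f\<parallel>\<^sup>2 \<le> \<parallel>u f\<parallel> \<parallel>f\<parallel>\<close>.
\<close>

lemma sq_norm_le_of_transpose_growth:
  assumes [measurable]: "kernel_measurable M S" "kernel_measurable M W"
    and le: "\<And>x y. x \<in> space M \<Longrightarrow> y \<in> space M \<Longrightarrow> kernel_comp M (kernel_transpose S) S x y \<le> W x y"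
    and W: "kernel_growth M W \<rho>" and "0 < \<rho>" and [measurable]: "f \<in> borel_measurable M"
  shows "sq_norm M (kernel_apply M S f) \<le> ennreal \<rho> * sq_norm M f"
proof (cases "sq_norm M f = 0 \<or> sq_norm M f = top")
  case True
  have "kernel_apply M S f = (\<lambda>_. 0)" if "sq_norm M f = 0"
    using that by (intro kernel_apply_eq_0) measurable
  with True \<open>0 < \<rho>\<close> show ?thesis
    by (auto simp: sq_norm_def[of M "\<lambda>_. 0"] sq_norm_top_bound)
next
  case False
  then obtain \<beta> where \<beta>: "sq_norm M f = ennreal \<beta>" "0 < \<beta>"
    by (cases "sq_norm M f") (auto simp: ennreal_eq_0_iff not_le)
  note [measurable] = kernel_transpose_measurable[OF assms(1)]
  define u where "u = kernel_apply M (kernel_transpose S) \<circ> kernel_apply M S"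
  have u [measurable]: "u g \<in> borel_measurable M" if [measurable]: "g \<in> borel_measurable M" for g
    unfolding u_def comp_apply by measurable
  have un [measurable]: "(u ^^ n) g \<in> borel_measurable M" if "g \<in> borel_measurable M" for n g
    using that by (induction n) (auto intro: u)
  have sym: "(\<integral>\<^sup>+x. u f x * g x \<partial>M) = (\<integral>\<^sup>+x. f x * u g x \<partial>M)"
    if [measurable]: "f \<in> borel_measurable M" "g \<in> borel_measurable M" for f g
  proof -
    have "(\<integral>\<^sup>+x. u f x * g x \<partial>M) = (\<integral>\<^sup>+x. kernel_apply M S f x * kernel_apply M S g x \<partial>M)"
      unfolding u_def comp_apply by (subst kernel_apply_transpose) measurable
    also have "\<dots> = (\<integral>\<^sup>+x. f x * u g x \<partial>M)"
      unfolding u_def comp_apply by (subst kernel_apply_transpose) measurable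
    finally show ?thesis .
  qed
  obtain C where C: "0 \<le> C" "\<And>n. sq_norm M ((kernel_apply M W ^^ n) f) \<le> ennreal (C * \<rho> ^ (2 * n)) * sq_norm M f"
    using W by (auto simp: kernel_growth_def)
  have "(u ^^ n) f x \<le> (kernel_apply M W ^^ n) f x" if "x \<in> space M" for n x
  proof (rule funpow_mono_on_space[THEN conjunct1, of M])
    fix f g :: "'a \<Rightarrow> ennreal" and x assume fg: "\<And>y. y \<in> space M \<Longrightarrow> f y \<le> g y" "x \<in> space M"
      and [measurable]: "f \<in> borel_measurable M" "g \<in> borel_measurable M"
    have "u f x = kernel_apply M (kernel_comp M (kernel_transpose S) S) f x"
      unfolding u_def comp_apply using fg(2) by (intro kernel_apply_comp[symmetric]) measurable
    also have "\<dots> \<le> kernel_apply M W g x"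
      by (intro kernel_apply_mono le fg)
    finally show "u f x \<le> kernel_apply M W g x" .
  qed (use that assms(2,6) u in \<open>auto intro: kernel_apply_measurable\<close>)
  then have "sq_norm M ((u ^^ n) f) \<le> ennreal (C * \<rho> ^ (2 * n)) * sq_norm M f" for n
    by (intro order_trans[OF sq_norm_mono C(2)]) auto
  then have up: "sq_norm M ((u ^^ n) f) \<le> ennreal (C * \<rho> ^ (2 * n) * \<beta>)" for n
    using \<beta> C \<open>0 < \<rho>\<close> by (simp add: ennreal_mult)
  define b where "b n = enn2real (sq_norm M ((u ^^ n) f))" for n
  have b: "sq_norm M ((u ^^ n) f) = ennreal (b n)" "0 \<le> b n" "b n \<le> C * \<rho> ^ (2 * n) * \<beta>" for n
  proof -
    have "sq_norm M ((u ^^ n) f) < top" using up[of n] by (rule order_le_less_trans) simp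
    then show 1: "sq_norm M ((u ^^ n) f) = ennreal (b n)" by (simp add: b_def)
    show "0 \<le> b n" by (simp add: b_def)
    show "b n \<le> C * \<rho> ^ (2 * n) * \<beta>"
      using up[of n] C \<beta> \<open>0 < \<rho>\<close> unfolding 1 by (simp add: ennreal_le_iff)
  qed
  have double: "b n ^ 2 \<le> b (2 * n) * \<beta>" for n
  proof -
    have "sq_norm M ((u ^^ n) f) = (\<integral>\<^sup>+x. (u ^^ n) f x * (u ^^ n) f x \<partial>M)"
      by (simp add: sq_norm_def power2_eq_square)
    also have "\<dots> = (\<integral>\<^sup>+x. (u ^^ n) ((u ^^ n) f) x * f x \<partial>M)"
      by (rule nn_integral_symmetric_funpow[OF sym u un[OF assms(6)] assms(6), symmetric])
    also have "\<dots> = (\<integral>\<^sup>+x. (u ^^ (2 * n)) f x * f x \<partial>M)"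
      by (simp add: mult_2 funpow_add)
    finally have "(sq_norm M ((u ^^ n) f))\<^sup>2 \<le> sq_norm M ((u ^^ (2 * n)) f) * sq_norm M f"
      unfolding sq_norm_def by (simp add: Cauchy_Schwarz_nn_integral)
    then show ?thesis
      using b \<beta> by (simp add: ennreal_power ennreal_le_iff flip: ennreal_mult)
  qed
  \<comment> \<open>A number whose powers \<open>t^(2^k)\<close> stay bounded is at most \<open>1\<close>.\<close>
  define t where "t = b 1 / (\<beta> * \<rho>\<^sup>2)"
  have iter: "(b 1 / \<beta>) ^ (2 ^ k) \<le> b (2 ^ k) / \<beta>" for k
  proof (induction k)
    case (Suc k)
    have "(b 1 / \<beta>) ^ (2 ^ Suc k) = ((b 1 / \<beta>) ^ (2 ^ k))\<^sup>2"
      by (simp add: power_mult[symmetric] mult.commute)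
    also have "\<dots> \<le> (b (2 ^ k) / \<beta>)\<^sup>2"
      using b \<beta> by (intro power_mono Suc) auto
    also have "\<dots> \<le> b (2 ^ Suc k) / \<beta>"
      using double[of "2 ^ k"] \<beta> by (simp add: power2_eq_square field_simps)
    finally show ?case .
  qed simp
  have t: "t ^ (2 ^ k) \<le> C" for k
  proof -
    have "t ^ (2 ^ k) = (b 1 / \<beta>) ^ (2 ^ k) / \<rho> ^ (2 * 2 ^ k)"
      by (simp add: t_def power_divide power_mult_distrib power_mult)
    also have "\<dots> \<le> (C * \<rho> ^ (2 * 2 ^ k) * \<beta> / \<beta>) / \<rho> ^ (2 * 2 ^ k)"
      using \<beta> \<open>0 < \<rho>\<close> b(3)[of "2 ^ k"] by (intro divide_right_mono order_trans[OF iter]) auto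
    finally show ?thesis using \<beta> \<open>0 < \<rho>\<close> by simp
  qed
  have "t \<le> 1"
  proof (rule ccontr)
    assume "\<not> t \<le> 1"
    then obtain k where "C < t ^ k" using real_arch_pow[of t C] by auto
    also have "\<dots> \<le> t ^ (2 ^ k)"
      using \<open>\<not> t \<le> 1\<close> by (intro power_increasing) (auto simp: less_imp_le[OF less_exp])
    finally show False using t[of k] by simp
  qed
  then have b1: "b 1 \<le> \<beta> * \<rho>\<^sup>2" using \<beta> \<open>0 < \<rho>\<close> by (simp add: t_def field_simps)
  have "sq_norm M (kernel_apply M S f) = (\<integral>\<^sup>+x. u f x * f x \<partial>M)"
    unfolding u_def comp_apply sq_norm_def power2_eq_square
    by (subst kernel_apply_transpose) measurable
  then have "(sq_norm M (kernel_apply M S f))\<^sup>2 \<le> sq_norm M (u f) * sq_norm M f"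
    unfolding sq_norm_def by (simp add: Cauchy_Schwarz_nn_integral)
  also have "\<dots> = ennreal (b 1 * \<beta>)"
    using b(1)[of 1] b(2)[of 1] \<beta> by (simp add: ennreal_mult)
  also have "\<dots> \<le> ennreal ((\<rho> * \<beta>)\<^sup>2)"
    using b1 \<beta> by (intro ennreal_leI) (simp add: power2_eq_square field_simps)
  finally have "sq_norm M (kernel_apply M S f) \<le> ennreal (\<rho> * \<beta>)"
    by (rule le_ennreal_of_power2_le) (use \<beta> \<open>0 < \<rho>\<close> in simp)
  then show ?thesis using \<beta> \<open>0 < \<rho>\<close> by (simp add: ennreal_mult)
qed

end

section \<open>Measures and integrals compared on rectangles\<close>

text \<open>
  Sets on which one measure is below another do not form a Dynkin system, so induction over the
  generated \<open>\<sigma>\<close>-algebra is not available.  Instead, the larger measure is the outer measure of its own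
  restriction to the ring generated by the semiring, hence an infimum over countable coverings by sets
  on which the inequality is known.
\<close>

lemma emeasure_le_on_generated:
  assumes semiring: "semiring_of_sets \<Omega> G" and "\<Omega> \<in> G"
    and sets: "sets P = sigma_sets \<Omega> G" "sets N = sigma_sets \<Omega> G"
    and fin: "emeasure N \<Omega> \<noteq> \<infinity>"
    and le: "\<And>A. A \<in> G \<Longrightarrow> emeasure P A \<le> emeasure N A"
    and E: "E \<in> sets P"
  shows "emeasure P E \<le> emeasure N E"
proof -
  interpret semiring_of_sets \<Omega> G by fact
  interpret R: ring_of_sets \<Omega> generated_ring by (rule generating_ring)
  let ?R = generated_ring and ?f = "emeasure N"
  let ?O = "outer_measure ?R ?f"
  have R_sets: "?R \<subseteq> sets N"
    using sigma_sets_superset_generator[of ?R \<Omega>] by (simp add: sets sigma_sets_generated_ring_eq)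
  have pos: "positive ?R ?f" by (simp add: positive_def)
  have ca: "countably_additive ?R ?f"
    using R_sets by (auto simp: countably_additive_def intro!: suminf_emeasure)
  have inc: "increasing ?R ?f"
    by (metis R.additive_increasing ca R.countably_additive_additive pos)
  define ls where "ls = lambda_system \<Omega> (Pow \<Omega>) ?O"
  have mls: "measure_space \<Omega> ls ?O"
    using sigma_algebra.caratheodory_lemma
            [OF sigma_algebra_Pow R.outer_measure_space_outer_measure [OF pos inc]]
    by (simp add: ls_def)
  have "?R \<subseteq> ls"
    unfolding ls_def
    by (intro R.algebra_subset_lambda_system pos inc R.countably_additive_additive ca)
  then have "sigma_sets \<Omega> ?R \<subseteq> ls"
    using sigma_algebra.sigma_sets_subset[of \<Omega> ls ?R] mls by (simp add: measure_space_def)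
  then have mO: "measure_space \<Omega> (sigma_sets \<Omega> ?R) ?O"
    by (intro measure_down[OF mls] sigma_algebra_sigma_sets R.space_closed)
  define Q where "Q = measure_of \<Omega> (sigma_sets \<Omega> ?R) ?O"
  have sets_Q: "sets Q = sigma_sets \<Omega> ?R"
  proof -
    have "sigma_sets \<Omega> ?R \<subseteq> Pow \<Omega>"
      using sigma_sets_into_sp[OF R.space_closed] by auto
    then show ?thesis
      by (simp add: Q_def sets_measure_of sigma_sets_sigma_sets_eq[OF R.space_closed])
  qed
  have emO: "emeasure Q X = ?O X" if "X \<in> sigma_sets \<Omega> ?R" for X
    using mO that unfolding Q_def by (intro emeasure_measure_of_sigma) (auto simp: measure_space_def)
  have "Q = N"
  proof (rule measure_eqI_generator_eq[of ?R \<Omega> _ _ "\<lambda>_. \<Omega>"])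
    show "Int_stable ?R" by (auto simp: Int_stable_def)
    show "?R \<subseteq> Pow \<Omega>" by (rule R.space_closed)
    show "emeasure Q X = emeasure N X" if "X \<in> ?R" for X
      using that emO[of X] R.outer_measure_agrees[OF pos ca] by (simp add: sigma_sets.Basic)
    show "sets N = sigma_sets \<Omega> ?R" by (simp add: sets sigma_sets_generated_ring_eq)
    show "range (\<lambda>_. \<Omega>) \<subseteq> ?R" using \<open>\<Omega> \<in> G\<close> by (auto intro: generated_ringI_Basic)
    show "emeasure Q \<Omega> \<noteq> \<infinity>"
      using emO[of \<Omega>] R.outer_measure_agrees[OF pos ca generated_ringI_Basic[OF \<open>\<Omega> \<in> G\<close>]] fin
      by (simp add: sigma_sets.Basic generated_ringI_Basic[OF \<open>\<Omega> \<in> G\<close>])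
  qed (use sets_Q in auto)
  then have N: "emeasure N E = ?O E"
    using emO[of E] E by (simp add: sets sigma_sets_generated_ring_eq)
  have ring_le: "emeasure P A \<le> emeasure N A" if "A \<in> ?R" for A
  proof -
    from that obtain C where C: "finite C" "disjoint C" "C \<subseteq> G" "A = \<Union>C"
      by (rule generated_ringE)
    have "C \<subseteq> sets P" "C \<subseteq> sets N"
      using C(3) by (auto simp: sets)
    then have "emeasure P A = (\<Sum>c\<in>C. emeasure P c)" "emeasure N A = (\<Sum>c\<in>C. emeasure N c)"
      unfolding C(4) using C(1,2)
      by (auto simp: disjoint_def disjoint_family_on_def
          intro!: sum_emeasure[of "\<lambda>c. c", symmetric, simplified])
    then show ?thesis using C(3) le by (auto intro!: sum_mono)
  qed
  have "emeasure P E \<le> ?O E"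
    unfolding outer_measure_def
  proof (intro INF_greatest, clarify)
    fix A :: "nat \<Rightarrow> _" assume A: "range A \<subseteq> ?R" "disjoint_family A" "E \<subseteq> (\<Union>i. A i)"
    have AP: "range A \<subseteq> sets P" using A(1) R_sets sets by auto
    have "emeasure P E \<le> emeasure P (\<Union>i. A i)"
      using A(3) AP by (intro emeasure_mono) auto
    also have "\<dots> = (\<Sum>i. emeasure P (A i))"
      using A(2) AP by (intro suminf_emeasure[symmetric]) auto
    also have "\<dots> \<le> (\<Sum>i. emeasure N (A i))"
      using A(1) by (intro suminf_le ring_le) auto
    finally show "emeasure P E \<le> (\<Sum>i. emeasure N (A i))" .
  qed
  with N show ?thesis by simp
qed

lemma semiring_of_rectangles:
  "semiring_of_sets (space M \<times> space N) {A \<times> B | A B. A \<in> sets M \<and> B \<in> sets N}"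
    (is "semiring_of_sets _ ?G")
proof
  show "?G \<subseteq> Pow (space M \<times> space N)" by (auto dest: sets.sets_into_space)
  show "{} \<in> ?G" by auto
  fix a b assume "a \<in> ?G" "b \<in> ?G"
  then obtain A B C D where ab: "a = A \<times> B" "b = C \<times> D" "A \<in> sets M" "B \<in> sets N" "C \<in> sets M" "D \<in> sets N"
    by auto
  then show "a \<inter> b \<in> ?G"
    by (auto simp: Times_Int_Times)
  have d: "a - b = \<Union>{(A - C) \<times> B, (A \<inter> C) \<times> (B - D)}"
    unfolding ab by auto
  have s: "{(A - C) \<times> B, (A \<inter> C) \<times> (B - D)} \<subseteq> ?G"
    using ab by auto
  have "disjoint {(A - C) \<times> B, (A \<inter> C) \<times> (B - D)}"
    by (auto simp: disjoint_def)
  with d s show "\<exists>C\<subseteq>?G. finite C \<and> disjoint C \<and> a - b = \<Union>C"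
    by (intro exI[of _ "{(A - C) \<times> B, (A \<inter> C) \<times> (B - D)}"]) simp
qed

text \<open>
  The positive and the negative part of \<open>F\<close> are the densities of two finite measures that can be compared
  on rectangles, hence on the set where \<open>F\<close> is negative.
\<close>

lemma AE_nonneg_of_rectangles:
  fixes F :: "'a \<times> 'b \<Rightarrow> real"
  assumes F: "integrable (M \<Otimes>\<^sub>M N) F"
    and rect: "\<And>A B. A \<in> sets M \<Longrightarrow> B \<in> sets N \<Longrightarrow> 0 \<le> (\<integral>z. indicator (A \<times> B) z * F z \<partial>(M \<Otimes>\<^sub>M N))"
  shows "AE z in M \<Otimes>\<^sub>M N. 0 \<le> F z"
proof -
  let ?P = "M \<Otimes>\<^sub>M N" and ?G = "{A \<times> B | A B. A \<in> sets M \<and> B \<in> sets N}"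
  have [measurable]: "F \<in> borel_measurable ?P" using F by auto
  define p where "p = density ?P (\<lambda>z. ennreal (- F z))"
  define n where "n = density ?P (\<lambda>z. ennreal (F z))"
  have fin: "(\<integral>\<^sup>+z. ennreal (F z) \<partial>?P) < \<infinity>" "(\<integral>\<^sup>+z. ennreal (- F z) \<partial>?P) < \<infinity>"
    using F by (auto simp: real_integrable_def less_top)
  have le: "emeasure p X \<le> emeasure n X" if "X \<in> ?G" for X
  proof -
    from that obtain A B where X: "X = A \<times> B" "A \<in> sets M" "B \<in> sets N" by auto
    then have [measurable]: "X \<in> sets ?P" by auto
    have i: "integrable ?P (\<lambda>z. indicator X z * F z)"
      using integrable_mult_indicator[of X ?P F] F by simp
    then have f: "(\<integral>\<^sup>+z. ennreal (indicator X z * F z) \<partial>?P) < \<infinity>"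
        "(\<integral>\<^sup>+z. ennreal (- (indicator X z * F z)) \<partial>?P) < \<infinity>"
      by (auto simp: real_integrable_def less_top)
    have "enn2real (\<integral>\<^sup>+z. ennreal (- (indicator X z * F z)) \<partial>?P)
        \<le> enn2real (\<integral>\<^sup>+z. ennreal (indicator X z * F z) \<partial>?P)"
      using rect[OF X(2,3)] i unfolding X(1)[symmetric] by (simp add: real_lebesgue_integral_def)
    then have "(\<integral>\<^sup>+z. ennreal (- (indicator X z * F z)) \<partial>?P) \<le> (\<integral>\<^sup>+z. ennreal (indicator X z * F z) \<partial>?P)"
      using f by (cases "\<integral>\<^sup>+z. ennreal (- (indicator X z * F z)) \<partial>?P";
          cases "\<integral>\<^sup>+z. ennreal (indicator X z * F z) \<partial>?P") (auto intro: ennreal_leI)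
    moreover have "emeasure p X = (\<integral>\<^sup>+z. ennreal (- (indicator X z * F z)) \<partial>?P)"
      unfolding p_def by (simp add: emeasure_density) (intro nn_integral_cong, simp split: split_indicator)
    moreover have "emeasure n X = (\<integral>\<^sup>+z. ennreal (indicator X z * F z) \<partial>?P)"
      unfolding n_def by (simp add: emeasure_density) (intro nn_integral_cong, simp split: split_indicator)
    ultimately show ?thesis by simp
  qed
  define E where "E = {z \<in> space ?P. F z < 0}"
  have [measurable]: "E \<in> sets ?P" unfolding E_def by measurable
  have "emeasure p E \<le> emeasure n E"
  proof (rule emeasure_le_on_generated[OF semiring_of_rectangles[of M N]])
    show "space M \<times> space N \<in> ?G" by auto
    show "sets p = sigma_sets (space M \<times> space N) ?G" "sets n = sigma_sets (space M \<times> space N) ?G"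
      by (simp_all add: p_def n_def sets_pair_measure)
    have "emeasure n (space ?P) = (\<integral>\<^sup>+z. ennreal (F z) \<partial>?P)"
      unfolding n_def by (subst emeasure_density) (auto intro!: nn_integral_cong)
    then show "emeasure n (space M \<times> space N) \<noteq> \<infinity>"
      using fin by (simp add: space_pair_measure)
  qed (use le in \<open>auto simp: p_def\<close>)
  also have "emeasure n E = (\<integral>\<^sup>+z. ennreal (F z) * indicator E z \<partial>?P)"
    unfolding n_def by (rule emeasure_density) measurable
  also have "\<dots> = (\<integral>\<^sup>+z. 0 \<partial>?P)"
    by (intro nn_integral_cong) (auto simp: E_def ennreal_neg split: split_indicator)
  finally have "(\<integral>\<^sup>+z. ennreal (- F z) * indicator E z \<partial>?P) = 0"
    unfolding p_def by (subst (asm) emeasure_density) auto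
  then have "AE z in ?P. ennreal (- F z) * indicator E z = 0"
    by (subst (asm) nn_integral_0_iff_AE) auto
  with AE_space show ?thesis
    by eventually_elim (auto simp: E_def ennreal_eq_0_iff split: split_indicator_asm)
qed

section \<open>Square-integrable functions\<close>

lemma L2_iff:
  "f \<in> L2 M \<longleftrightarrow> f \<in> borel_measurable M \<and> sq_norm M (\<lambda>x. ennreal (cmod (f x))) < top"
proof (cases "f \<in> borel_measurable M")
  case True
  note [measurable] = True
  have "integrable M (\<lambda>x. (cmod (f x))\<^sup>2) \<longleftrightarrow> (\<integral>\<^sup>+x. ennreal ((cmod (f x))\<^sup>2) \<partial>M) < top"
    by (subst integrable_iff_bounded) auto
  then show ?thesis using True
    by (simp add: L2_def sq_norm_def ennreal_power)
qed (simp add: L2_def)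

lemma L2_measurable: "f \<in> L2 M \<Longrightarrow> f \<in> borel_measurable M"
  by (simp add: L2_def)

lemma L2_norm_nonneg [simp]: "0 \<le> L2_norm M f"
  by (simp add: L2_norm_def integral_nonneg_AE)

lemma sq_norm_cmod:
  assumes "f \<in> L2 M"
  shows "sq_norm M (\<lambda>x. ennreal (cmod (f x))) = ennreal ((L2_norm M f)\<^sup>2)"
proof -
  have "sq_norm M (\<lambda>x. ennreal (cmod (f x))) = (\<integral>\<^sup>+x. ennreal ((cmod (f x))\<^sup>2) \<partial>M)"
    by (simp add: sq_norm_def ennreal_power)
  also have "\<dots> = ennreal (\<integral>x. (cmod (f x))\<^sup>2 \<partial>M)"
    using assms by (intro nn_integral_eq_integral) (auto simp: L2_def)
  finally show ?thesis
    by (simp add: L2_norm_def integral_nonneg_AE)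
qed

lemma L2_norm_cong_AE:
  assumes "f \<in> borel_measurable M" "g \<in> borel_measurable M" "AE x in M. f x = g x"
  shows "L2_norm M f = L2_norm M g"
proof -
  have "(\<integral>x. (cmod (f x))\<^sup>2 \<partial>M) = (\<integral>x. (cmod (g x))\<^sup>2 \<partial>M)"
    using assms by (intro integral_cong_AE) auto
  then show ?thesis by (simp add: L2_norm_def)
qed

lemma L2_dominated:
  assumes "g \<in> L2 M" "f \<in> borel_measurable M" "AE x in M. cmod (f x) \<le> cmod (g x)"
  shows "f \<in> L2 M" "L2_norm M f \<le> L2_norm M g"
proof -
  have le: "sq_norm M (\<lambda>x. ennreal (cmod (f x))) \<le> sq_norm M (\<lambda>x. ennreal (cmod (g x)))"
    unfolding sq_norm_def using assms(3)
    by (intro nn_integral_mono_AE) (auto elim!: eventually_mono intro!: power_mono ennreal_leI)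
  then show f: "f \<in> L2 M"
    using assms by (auto simp: L2_iff)
  have "(L2_norm M f)\<^sup>2 \<le> (L2_norm M g)\<^sup>2"
    using le by (simp add: sq_norm_cmod f assms(1) ennreal_le_iff)
  then show "L2_norm M f \<le> L2_norm M g"
    by (rule power2_le_imp_le) simp
qed

lemma L2_cong_AE:
  "\<lbrakk>g \<in> L2 M; f \<in> borel_measurable M; AE x in M. f x = g x\<rbrakk> \<Longrightarrow> f \<in> L2 M"
  by (rule L2_dominated(1)) auto

lemma L2_zero [simp]: "(\<lambda>x. 0) \<in> L2 M"
  by (simp add: L2_def)

lemma L2_cmult: "f \<in> L2 M \<Longrightarrow> (\<lambda>x. a * f x) \<in> L2 M"
  by (auto simp: L2_def norm_mult power_mult_distrib)

lemma L2_norm_cmult: "L2_norm M (\<lambda>x. a * f x) = cmod a * L2_norm M f"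
  by (simp add: L2_norm_def norm_mult power_mult_distrib real_sqrt_mult)

lemma L2_mult_integrable:
  assumes "f \<in> L2 M" "g \<in> L2 M"
  shows "integrable M (\<lambda>x. cmod (f x) * cmod (g x))"
    and "(\<integral>x. cmod (f x) * cmod (g x) \<partial>M) \<le> L2_norm M f * L2_norm M g"
proof -
  note [measurable] = assms[THEN L2_measurable]
  have "(\<integral>\<^sup>+x. ennreal (cmod (f x)) * ennreal (cmod (g x)) \<partial>M)\<^sup>2
      \<le> ennreal ((L2_norm M f * L2_norm M g)\<^sup>2)"
    using Cauchy_Schwarz_nn_integral[of "\<lambda>x. ennreal (cmod (f x))" M "\<lambda>x. ennreal (cmod (g x))"]
    unfolding sq_norm_def[symmetric] by (simp add: sq_norm_cmod assms power_mult_distrib ennreal_mult)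
  then have le: "(\<integral>\<^sup>+x. ennreal (cmod (f x) * cmod (g x)) \<partial>M) \<le> ennreal (L2_norm M f * L2_norm M g)"
    unfolding ennreal_mult[OF norm_ge_zero norm_ge_zero] by (rule le_ennreal_of_power2_le) simp
  show i: "integrable M (\<lambda>x. cmod (f x) * cmod (g x))"
    by (rule integrableI_nonneg) (use le in \<open>auto simp: top.not_eq_extremum[symmetric] top_unique\<close>)
  show "(\<integral>x. cmod (f x) * cmod (g x) \<partial>M) \<le> L2_norm M f * L2_norm M g"
    using le nn_integral_eq_integral[OF i] by (simp add: ennreal_le_iff)
qed

lemma L2_add_triangle:
  assumes f: "f \<in> L2 M" and g: "g \<in> L2 M"
  shows "(\<lambda>x. f x + g x) \<in> L2 M" "L2_norm M (\<lambda>x. f x + g x) \<le> L2_norm M f + L2_norm M g"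
proof -
  note [measurable] = f[THEN L2_measurable] g[THEN L2_measurable]
  have int: "integrable M (\<lambda>x. (cmod (f x))\<^sup>2)" "integrable M (\<lambda>x. (cmod (g x))\<^sup>2)"
    using f g by (auto simp: L2_def)
  define h where "h x = (cmod (f x))\<^sup>2 + 2 * (cmod (f x) * cmod (g x)) + (cmod (g x))\<^sup>2" for x
  have h: "integrable M h"
    unfolding h_def by (intro Bochner_Integration.integrable_add integrable_mult_right int L2_mult_integrable f g)
  have le: "(cmod (f x + g x))\<^sup>2 \<le> h x" for x
  proof -
    have "(cmod (f x + g x))\<^sup>2 \<le> (cmod (f x) + cmod (g x))\<^sup>2"
      by (intro power_mono norm_triangle_ineq) simp
    then show ?thesis by (simp add: h_def power2_sum algebra_simps)
  qed
  have i: "integrable M (\<lambda>x. (cmod (f x + g x))\<^sup>2)"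
    by (rule Bochner_Integration.integrable_bound[OF h]) (use le in \<open>auto intro: order_trans[OF _ abs_ge_self]\<close>)
  then show "(\<lambda>x. f x + g x) \<in> L2 M" by (auto simp: L2_def)
  have sq: "(L2_norm M u)\<^sup>2 = (\<integral>x. (cmod (u x))\<^sup>2 \<partial>M)" for u
    by (simp add: L2_norm_def integral_nonneg_AE)
  have "(L2_norm M (\<lambda>x. f x + g x))\<^sup>2 \<le> (\<integral>x. h x \<partial>M)"
    unfolding sq by (rule integral_mono[OF i h le])
  also have "\<dots> = (L2_norm M f)\<^sup>2 + 2 * (\<integral>x. cmod (f x) * cmod (g x) \<partial>M) + (L2_norm M g)\<^sup>2"
    unfolding h_def sq using int L2_mult_integrable[OF f g] by simp
  also have "\<dots> \<le> (L2_norm M f + L2_norm M g)\<^sup>2"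
    using L2_mult_integrable(2)[OF f g] by (simp add: power2_sum)
  finally show "L2_norm M (\<lambda>x. f x + g x) \<le> L2_norm M f + L2_norm M g"
    by (rule power2_le_imp_le) simp
qed

lemma L2_lincomb: "f \<in> L2 M \<Longrightarrow> g \<in> L2 M \<Longrightarrow> (\<lambda>x. a * f x + b * g x) \<in> L2 M"
  by (intro L2_add_triangle L2_cmult)

lemma L2_norm_eq_0_iff:
  assumes "f \<in> L2 M"
  shows "L2_norm M f = 0 \<longleftrightarrow> (AE x in M. f x = 0)"
proof -
  have "L2_norm M f = 0 \<longleftrightarrow> sq_norm M (\<lambda>x. ennreal (cmod (f x))) = 0"
    by (simp add: sq_norm_cmod assms)
  also have "\<dots> \<longleftrightarrow> (AE x in M. f x = 0)"
    using L2_measurable[OF assms] by (subst sq_norm_eq_0_iff) auto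
  finally show ?thesis .
qed

section \<open>Operators given by a nonnegative kernel\<close>

lemma enn2real_inj: "\<lbrakk>a < top; b < top; enn2real a = enn2real b\<rbrakk> \<Longrightarrow> a = b"
  by (cases a; cases b) auto

lemma ennreal_mult_right_cancel_pos:
  assumes "0 < c" "x * ennreal c = y * ennreal c"
  shows "x = y"
proof -
  have "z * ennreal c * ennreal (1 / c) = z" for z
    using assms(1) by (simp add: mult.assoc flip: ennreal_mult)
  with assms(2) show ?thesis by metis
qed

lemma sq_norm_mono_AE:
  "AE x in M. f x \<le> g x \<Longrightarrow> sq_norm M f \<le> sq_norm M g"
  unfolding sq_norm_def by (intro nn_integral_mono_AE) (auto elim!: eventually_mono intro!: power_mono)

definition L2_linear :: "'a measure \<Rightarrow> 'a operator \<Rightarrow> bool" where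
  "L2_linear M T \<longleftrightarrow> (\<forall>f \<in> L2 M. T f \<in> L2 M) \<and>
     (\<forall>f \<in> L2 M. \<forall>g \<in> L2 M. \<forall>a b. AE x in M. T (\<lambda>y. a * f y + b * g y) x = a * T f x + b * T g x)"

lemma L2_linearD:
  assumes "L2_linear M T"
  shows "f \<in> L2 M \<Longrightarrow> T f \<in> L2 M"
    and "f \<in> L2 M \<Longrightarrow> g \<in> L2 M \<Longrightarrow> AE x in M. T (\<lambda>y. a * f y + b * g y) x = a * T f x + b * T g x"
  using assms by (auto simp: L2_linear_def)

lemma L2_of_real:
  "(\<lambda>x. complex_of_real (u x)) \<in> L2 M \<longleftrightarrow> u \<in> borel_measurable M \<and> integrable M (\<lambda>x. (u x)\<^sup>2)"
proof -
  have "u \<in> borel_measurable M" if [measurable]: "(\<lambda>x. complex_of_real (u x)) \<in> borel_measurable M"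
  proof -
    have "(\<lambda>x. Re (complex_of_real (u x))) \<in> borel_measurable M" by measurable
    then show ?thesis by simp
  qed
  moreover have "(\<lambda>x. complex_of_real (u x)) \<in> borel_measurable M" if [measurable]: "u \<in> borel_measurable M"
    by measurable
  ultimately have "(\<lambda>x. complex_of_real (u x)) \<in> borel_measurable M \<longleftrightarrow> u \<in> borel_measurable M"
    by blast
  then show ?thesis by (simp add: L2_def)
qed

text \<open>
  A complex function is a combination of four nonnegative ones.
\<close>

lemma L2_linear_eq_of_nonneg:
  assumes T: "L2_linear M T" and S: "L2_linear M S"
    and eq: "\<And>u. \<lbrakk>\<And>x. 0 \<le> u x; (\<lambda>x. complex_of_real (u x)) \<in> L2 M\<rbrakk>
      \<Longrightarrow> AE x in M. T (\<lambda>x. complex_of_real (u x)) x = S (\<lambda>x. complex_of_real (u x)) x"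
    and f: "f \<in> L2 M"
  shows "AE x in M. T f x = S f x"
proof -
  note [measurable] = L2_measurable[OF f]
  define p where "p h x = complex_of_real (max 0 (h (f x)))" for h :: "complex \<Rightarrow> real" and x
  have p: "p h \<in> L2 M" if [measurable]: "h \<in> borel_measurable borel" and h: "\<And>z. \<bar>h z\<bar> \<le> cmod z" for h
  proof (rule L2_dominated[OF f])
    show "p h \<in> borel_measurable M" unfolding p_def by measurable
    have "cmod (p h x) \<le> cmod (f x)" for x
      using h[of "f x"] by (simp add: p_def abs_le_iff)
    then show "AE x in M. cmod (p h x) \<le> cmod (f x)" by simp
  qed
  have e: "AE x in M. T (p h) x = S (p h) x" if "h \<in> borel_measurable borel" "\<And>z. \<bar>h z\<bar> \<le> cmod z" for h
    using eq[of "\<lambda>x. max 0 (h (f x))"] p[OF that] by (simp add: p_def[abs_def])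
  let ?h1 = Re and ?h2 = "\<lambda>z. - Re z" and ?h3 = Im and ?h4 = "\<lambda>z. - Im z"
  have P: "p ?h1 \<in> L2 M" "p ?h2 \<in> L2 M" "p ?h3 \<in> L2 M" "p ?h4 \<in> L2 M"
    by (auto intro!: p abs_Re_le_cmod abs_Im_le_cmod)
  have E: "AE x in M. T (p ?h1) x = S (p ?h1) x" "AE x in M. T (p ?h2) x = S (p ?h2) x"
      "AE x in M. T (p ?h3) x = S (p ?h3) x" "AE x in M. T (p ?h4) x = S (p ?h4) x"
    by (auto intro!: e abs_Re_le_cmod abs_Im_le_cmod)
  define r s where "r = (\<lambda>y. 1 * p ?h1 y + (-1) * p ?h2 y)" and "s = (\<lambda>y. 1 * p ?h3 y + (-1) * p ?h4 y)"
  have rs: "r \<in> L2 M" "s \<in> L2 M"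
    unfolding r_def s_def by (intro L2_lincomb P)+
  have f_eq: "f = (\<lambda>y. 1 * r y + \<i> * s y)"
    by (auto simp: r_def s_def p_def fun_eq_iff complex_eq_iff max_def)
  have "AE x in M. T r x = S r x"
    using L2_linearD(2)[OF T P(1,2), of 1 "-1"] L2_linearD(2)[OF S P(1,2), of 1 "-1"] E(1,2)
    unfolding r_def[symmetric] by eventually_elim auto
  moreover have "AE x in M. T s x = S s x"
    using L2_linearD(2)[OF T P(3,4), of 1 "-1"] L2_linearD(2)[OF S P(3,4), of 1 "-1"] E(3,4)
    unfolding s_def[symmetric] by eventually_elim auto
  ultimately show ?thesis
    using L2_linearD(2)[OF T rs, of 1 \<i>] L2_linearD(2)[OF S rs, of 1 \<i>]
    unfolding f_eq[symmetric] by eventually_elim auto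
qed

text \<open>
  The action is prescribed on nonnegative functions only, where it is a Lebesgue integral of nonnegative
  functions; linearity determines the rest.  This makes the rule for compositions a matter of Tonelli's
  theorem and postpones the integrability of complex kernels to \<open>acts_has_kernel\<close>.
\<close>

definition acts :: "'a measure \<Rightarrow> 'a operator \<Rightarrow> ('a \<Rightarrow> 'a \<Rightarrow> ennreal) \<Rightarrow> bool" where
  "acts M T K \<longleftrightarrow> kernel_measurable M K \<and> (\<exists>c>0. kernel_bound M K c) \<and> L2_linear M T \<and>
     (\<forall>u. (\<forall>x. 0 \<le> u x) \<and> (\<lambda>x. complex_of_real (u x)) \<in> L2 M \<longrightarrow>
       (AE x in M. T (\<lambda>x. complex_of_real (u x)) x
         = complex_of_real (enn2real (kernel_apply M K (\<lambda>y. ennreal (u y)) x))))"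

lemma actsD:
  assumes "acts M T K"
  shows "kernel_measurable M K" "\<exists>c>0. kernel_bound M K c" "L2_linear M T"
    "\<And>u. \<lbrakk>\<And>x. 0 \<le> u x; (\<lambda>x. complex_of_real (u x)) \<in> L2 M\<rbrakk> \<Longrightarrow>
      AE x in M. T (\<lambda>x. complex_of_real (u x)) x
         = complex_of_real (enn2real (kernel_apply M K (\<lambda>y. ennreal (u y)) x))"
  using assms by (auto simp: acts_def)

context sigma_finite_measure
begin

interpretation pair: pair_sigma_finite M M ..

lemma kernel_apply_AE_finite:
  assumes [measurable]: "kernel_measurable M K" "f \<in> borel_measurable M"
    and "kernel_bound M K c" "sq_norm M f < top"
  shows "AE x in M. kernel_apply M K f x < top" "sq_norm M (kernel_apply M K f) < top"
proof -
  have "sq_norm M (kernel_apply M K f) \<le> ennreal c * sq_norm M f"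
    by (rule kernel_boundD(2)[OF assms(3)]) measurable
  also have "\<dots> < top" using assms(4) by (simp add: ennreal_mult_less_top)
  finally show fin: "sq_norm M (kernel_apply M K f) < top" .
  then have "AE x in M. (kernel_apply M K f x)\<^sup>2 \<noteq> \<infinity>"
    unfolding sq_norm_def by (intro nn_integral_PInf_AE) auto
  then show "AE x in M. kernel_apply M K f x < top"
    by eventually_elim (auto simp: less_top[symmetric])
qed

text \<open>
  A strictly positive square-integrable weight turns statements about a kernel into statements about an
  integrable function on the product space without changing its null sets.
\<close>

lemma square_integrable_weight:
  obtains w :: "'a \<Rightarrow> real" where "w \<in> borel_measurable M" "\<And>x. 0 < w x" "\<And>x. w x \<le> 1" "integrable M w"
    "sq_norm M (\<lambda>x. ennreal (w x)) < top"
proof -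
  obtain w :: "'a \<Rightarrow> real" where w: "w \<in> borel_measurable M" "\<And>x. 0 < w x" "\<And>x. w x \<le> 1" "integrable M w"
    using obtain_positive_integrable_function by blast
  have "sq_norm M (\<lambda>x. ennreal (w x)) \<le> (\<integral>\<^sup>+x. ennreal (w x) \<partial>M)"
    unfolding sq_norm_def using w(2,3)
    by (intro nn_integral_mono) (simp add: less_imp_le ennreal_power power_le_one_iff ennreal_leI power2_eq_square mult_left_le)
  also have "\<dots> < top"
    using w(2,4) nn_integral_eq_integral[OF w(4)] by (simp add: less_imp_le)
  finally show ?thesis using that w by blast
qed

lemma nn_integral_weighted_kernel:
  assumes [measurable]: "kernel_measurable M K" "f \<in> borel_measurable M" "g \<in> borel_measurable M"
  shows "(\<integral>\<^sup>+z. K (fst z) (snd z) * f (snd z) * g (fst z) \<partial>(M \<Otimes>\<^sub>M M)) = (\<integral>\<^sup>+x. kernel_apply M K f x * g x \<partial>M)"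
proof -
  have "(\<integral>\<^sup>+z. K (fst z) (snd z) * f (snd z) * g (fst z) \<partial>(M \<Otimes>\<^sub>M M))
      = (\<integral>\<^sup>+x. (\<integral>\<^sup>+y. K x y * f y * g x \<partial>M) \<partial>M)"
    by (subst nn_integral_fst[symmetric]) auto
  also have "\<dots> = (\<integral>\<^sup>+x. kernel_apply M K f x * g x \<partial>M)"
    unfolding kernel_apply_def by (intro nn_integral_cong nn_integral_multc) measurable
  finally show ?thesis .
qed

lemma nn_integral_weighted_kernel_finite:
  assumes [measurable]: "kernel_measurable M K" "f \<in> borel_measurable M" "g \<in> borel_measurable M"
    and "kernel_bound M K c" "sq_norm M f < top" "sq_norm M g < top"
  shows "(\<integral>\<^sup>+z. K (fst z) (snd z) * f (snd z) * g (fst z) \<partial>(M \<Otimes>\<^sub>M M)) < top"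
proof -
  have "(\<integral>\<^sup>+x. kernel_apply M K f x * g x \<partial>M)\<^sup>2 \<le> sq_norm M (kernel_apply M K f) * sq_norm M g"
    unfolding sq_norm_def by (rule Cauchy_Schwarz_nn_integral) measurable
  also have "\<dots> < top"
    using kernel_apply_AE_finite(2)[OF assms(1,2,4,5)] assms(6) by (simp add: ennreal_mult_less_top)
  finally have "(\<integral>\<^sup>+x. kernel_apply M K f x * g x \<partial>M) < top"
    by (simp add: power_less_top_ennreal)
  then show ?thesis by (simp add: nn_integral_weighted_kernel)
qed

lemma kernel_AE_finite:
  assumes [measurable]: "kernel_measurable M K" and "kernel_bound M K c"
  shows "AE z in M \<Otimes>\<^sub>M M. K (fst z) (snd z) < top"
proof -
  obtain w :: "'a \<Rightarrow> real" where w: "w \<in> borel_measurable M" "\<And>x. 0 < w x" "sq_norm M (\<lambda>x. ennreal (w x)) < top"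
    using square_integrable_weight by metis
  note [measurable] = w(1)
  have "(\<integral>\<^sup>+z. K (fst z) (snd z) * ennreal (w (snd z)) * ennreal (w (fst z)) \<partial>(M \<Otimes>\<^sub>M M)) < top"
    by (rule nn_integral_weighted_kernel_finite[OF _ _ _ assms(2)]) (use w in auto)
  then have "AE z in M \<Otimes>\<^sub>M M. K (fst z) (snd z) * ennreal (w (snd z)) * ennreal (w (fst z)) \<noteq> \<infinity>"
    by (intro nn_integral_PInf_AE) auto
  then show ?thesis
    by eventually_elim (use w(2) in \<open>auto simp: ennreal_mult_eq_top_iff less_top[symmetric] ennreal_eq_0_iff not_le\<close>)
qed

text \<open>
  Multiplied by a positive weight in each variable, the two kernels are densities of finite measures
  that agree on rectangles.
\<close>

lemma acts_kernel_unique: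
  assumes T: "acts M T K" and L: "acts M T L"
  shows "AE z in M \<Otimes>\<^sub>M M. K (fst z) (snd z) = L (fst z) (snd z)"
proof -
  obtain w :: "'a \<Rightarrow> real" where w: "w \<in> borel_measurable M" "\<And>x. 0 < w x" "sq_norm M (\<lambda>x. ennreal (w x)) < top"
    using square_integrable_weight by metis
  note [measurable] = w(1) actsD(1)[OF T] actsD(1)[OF L]
  obtain c d where c: "kernel_bound M K c" and d: "kernel_bound M L d"
    using actsD(2)[OF T] actsD(2)[OF L] by auto
  let ?F = "\<lambda>K z. K (fst z) (snd z) * ennreal (w (snd z)) * ennreal (w (fst z))"
  have fin: "(\<integral>\<^sup>+z. ?F K z \<partial>(M \<Otimes>\<^sub>M M)) < top"
    by (rule nn_integral_weighted_kernel_finite[OF _ _ _ c]) (use w in auto)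
  have em: "emeasure (density (M \<Otimes>\<^sub>M M) (?F K)) (A \<times> B)
      = (\<integral>\<^sup>+x. kernel_apply M K (\<lambda>y. ennreal (w y * indicator B y)) x * (ennreal (w x) * indicator A x) \<partial>M)"
    if [measurable]: "A \<in> sets M" "B \<in> sets M" "kernel_measurable M K" for A B K
  proof -
    have "emeasure (density (M \<Otimes>\<^sub>M M) (?F K)) (A \<times> B) = (\<integral>\<^sup>+z. ?F K z * indicator (A \<times> B) z \<partial>(M \<Otimes>\<^sub>M M))"
      by (rule emeasure_density) auto
    also have "\<dots> = (\<integral>\<^sup>+z. K (fst z) (snd z) * ennreal (w (snd z) * indicator B (snd z))
        * (ennreal (w (fst z)) * indicator A (fst z)) \<partial>(M \<Otimes>\<^sub>M M))"
      by (intro nn_integral_cong) (auto split: split_indicator)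
    also have "\<dots> = (\<integral>\<^sup>+x. kernel_apply M K (\<lambda>y. ennreal (w y * indicator B y)) x
        * (ennreal (w x) * indicator A x) \<partial>M)"
      by (rule nn_integral_weighted_kernel) measurable
    finally show ?thesis .
  qed
  have "density (M \<Otimes>\<^sub>M M) (?F K) = density (M \<Otimes>\<^sub>M M) (?F L)"
  proof (rule measure_eqI_generator_eq[OF Int_stable_pair_measure_generator[of M M], of "space M \<times> space M" _ _ "\<lambda>_. space M \<times> space M"])
    fix X assume "X \<in> {a \<times> b | a b. a \<in> sets M \<and> b \<in> sets M}"
    then obtain A B where X: "X = A \<times> B" and [measurable]: "A \<in> sets M" "B \<in> sets M" by auto
    let ?u = "\<lambda>y. w y * indicator B y"
    have sq: "sq_norm M (\<lambda>y. ennreal (?u y)) \<le> sq_norm M (\<lambda>x. ennreal (w x))"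
      by (rule sq_norm_mono) (auto split: split_indicator)
    have u: "0 \<le> ?u y" for y using w(2)[of y] by (simp add: less_imp_le)
    have uL: "(\<lambda>x. complex_of_real (?u x)) \<in> L2 M"
    proof -
      have "cmod (complex_of_real (?u x)) = ?u x" for x
        using u[of x] by (simp only: norm_of_real abs_of_nonneg)
      moreover have "(\<lambda>x. complex_of_real (?u x)) \<in> borel_measurable M" by measurable
      ultimately show ?thesis using sq w(3) by (simp only: L2_iff) auto
    qed
    have "AE x in M. kernel_apply M K (\<lambda>y. ennreal (?u y)) x = kernel_apply M L (\<lambda>y. ennreal (?u y)) x"
    proof -
      have fin: "sq_norm M (\<lambda>y. ennreal (?u y)) < top" using sq w(3) by (rule order_le_less_trans)
      have m: "(\<lambda>y. ennreal (?u y)) \<in> borel_measurable M" by measurable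
      show ?thesis
        using actsD(4)[OF T u uL] actsD(4)[OF L u uL]
          kernel_apply_AE_finite(1)[OF actsD(1)[OF T] m c fin] kernel_apply_AE_finite(1)[OF actsD(1)[OF L] m d fin]
      proof eventually_elim
        case (elim x)
        from elim(1) have "complex_of_real (enn2real (kernel_apply M K (\<lambda>y. ennreal (?u y)) x))
            = complex_of_real (enn2real (kernel_apply M L (\<lambda>y. ennreal (?u y)) x))"
          unfolding elim(2) by (rule sym)
        then show ?case
          unfolding of_real_eq_iff by (rule enn2real_inj[OF elim(3,4)])
      qed
    qed
    then have "(\<integral>\<^sup>+x. kernel_apply M K (\<lambda>y. ennreal (?u y)) x * (ennreal (w x) * indicator A x) \<partial>M)
        = (\<integral>\<^sup>+x. kernel_apply M L (\<lambda>y. ennreal (?u y)) x * (ennreal (w x) * indicator A x) \<partial>M)"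
      by (intro nn_integral_cong_AE) auto
    then show "emeasure (density (M \<Otimes>\<^sub>M M) (?F K)) X = emeasure (density (M \<Otimes>\<^sub>M M) (?F L)) X"
      unfolding X by (simp add: em)
  next
    have "emeasure (density (M \<Otimes>\<^sub>M M) (?F K)) (space (M \<Otimes>\<^sub>M M)) = (\<integral>\<^sup>+z. ?F K z \<partial>(M \<Otimes>\<^sub>M M))"
      by (subst emeasure_density) (auto intro!: nn_integral_cong)
    then show "emeasure (density (M \<Otimes>\<^sub>M M) (?F K)) (space M \<times> space M) \<noteq> \<infinity>"
      using fin by (simp add: space_pair_measure)
  qed (auto simp: sets_pair_measure dest: sets.sets_into_space)
  moreover have "?F K \<in> borel_measurable (M \<Otimes>\<^sub>M M)" "?F L \<in> borel_measurable (M \<Otimes>\<^sub>M M)"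
    by measurable
  moreover have "(\<integral>\<^sup>+z. ?F K z \<partial>(M \<Otimes>\<^sub>M M)) \<noteq> \<infinity>" using fin by simp
  ultimately have "AE z in M \<Otimes>\<^sub>M M. ?F K z = ?F L z"
    using finite_density_unique[of "?F K" "M \<Otimes>\<^sub>M M" "?F L"] by (simp only: zero_le simp_thms eventually_True)
  then show ?thesis
  proof eventually_elim
    case (elim z)
    have "0 < w (snd z) * w (fst z)" using w(2) by simp
    moreover have "K (fst z) (snd z) * ennreal (w (snd z) * w (fst z)) = L (fst z) (snd z) * ennreal (w (snd z) * w (fst z))"
      using elim w(2) by (simp add: ennreal_mult less_imp_le mult.assoc)
    ultimately show ?case by (rule ennreal_mult_right_cancel_pos)
  qed
qed

lemma kernel_apply_cong_kernel_AE:
  assumes [measurable]: "kernel_measurable M K" "kernel_measurable M L"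
    and "AE z in M \<Otimes>\<^sub>M M. K (fst z) (snd z) = L (fst z) (snd z)"
  shows "AE x in M. \<forall>f. kernel_apply M K f x = kernel_apply M L f x"
proof -
  have "AE x in M. AE y in M. K x y = L x y"
    using pair.AE_pair[OF assms(3)] by simp
  then show ?thesis
    unfolding kernel_apply_def by eventually_elim (auto intro!: nn_integral_cong_AE elim: eventually_mono)
qed

lemma has_kernel_linear:
  assumes "has_kernel M T k"
  shows "L2_linear M T"
  unfolding L2_linear_def
proof (intro conjI ballI allI)
  fix f g a b assume f: "f \<in> L2 M" and g: "g \<in> L2 M"
  have h: "(\<lambda>y. a * f y + b * g y) \<in> L2 M" using f g by (rule L2_lincomb)
  have F: "(AE x in M. integrable M (\<lambda>y. k x y * f y)) \<and> (AE x in M. T f x = kernel_op M k f x)" if "f \<in> L2 M" for f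
    using assms that by (auto simp: has_kernel_def)
  show "AE x in M. T (\<lambda>y. a * f y + b * g y) x = a * T f x + b * T g x"
    using F[OF f, THEN conjunct1] F[OF f, THEN conjunct2] F[OF g, THEN conjunct1] F[OF g, THEN conjunct2] F[OF h, THEN conjunct2]
  proof eventually_elim
    case (elim x)
    have "kernel_op M k (\<lambda>y. a * f y + b * g y) x = (\<integral>y. a * (k x y * f y) + b * (k x y * g y) \<partial>M)"
      by (simp add: kernel_op_def algebra_simps)
    also have "\<dots> = a * kernel_op M k f x + b * kernel_op M k g x"
      using elim by (simp add: kernel_op_def)
    finally show ?case using elim by simp
  qed
qed (use assms in \<open>auto simp: has_kernel_def\<close>)

text \<open>
  The boundedness that \<open>acts\<close> demands is automatic, by \<open>kernel_bound_of_finite\<close>.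
\<close>

lemma has_kernel_acts:
  assumes T: "has_kernel M T (\<lambda>x y. complex_of_real (k x y))" and k: "\<And>x y. 0 \<le> k x y"
  shows "acts M T (\<lambda>x y. ennreal (k x y))"
proof -
  let ?K = "\<lambda>x y. ennreal (k x y)"
  have "(\<lambda>z. complex_of_real (k (fst z) (snd z))) \<in> borel_measurable (M \<Otimes>\<^sub>M M)"
    using T by (simp add: has_kernel_def case_prod_beta')
  then have "(\<lambda>z. Re (complex_of_real (k (fst z) (snd z)))) \<in> borel_measurable (M \<Otimes>\<^sub>M M)"
    by measurable
  then have [measurable]: "kernel_measurable M k"
    by (simp add: case_prod_beta')
  have meas: "kernel_measurable M ?K" by measurable
  have eq: "AE x in M. kernel_apply M ?K (\<lambda>y. ennreal (u y)) x < top
      \<and> T (\<lambda>x. complex_of_real (u x)) x = complex_of_real (enn2real (kernel_apply M ?K (\<lambda>y. ennreal (u y)) x))"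
    if u: "\<And>x. 0 \<le> u x" and uL: "(\<lambda>x. complex_of_real (u x)) \<in> L2 M" for u
  proof -
    have [measurable]: "u \<in> borel_measurable M" using uL by (simp add: L2_of_real)
    have "AE x in M. integrable M (\<lambda>y. complex_of_real (k x y) * complex_of_real (u y))"
      "AE x in M. T (\<lambda>x. complex_of_real (u x)) x = kernel_op M (\<lambda>x y. complex_of_real (k x y)) (\<lambda>x. complex_of_real (u x)) x"
      using T uL by (auto simp: has_kernel_def)
    then show ?thesis
    proof eventually_elim
      case (elim x)
      then have i: "integrable M (\<lambda>y. k x y * u y)"
        by (simp add: complex_of_real_integrable_eq flip: of_real_mult)
      have "kernel_apply M ?K (\<lambda>y. ennreal (u y)) x = (\<integral>\<^sup>+y. ennreal (k x y * u y) \<partial>M)"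
        using k u by (simp add: kernel_apply_def ennreal_mult)
      also have "\<dots> = ennreal (\<integral>y. k x y * u y \<partial>M)"
        using k u by (intro nn_integral_eq_integral i) auto
      finally show ?case
        using elim k u by (simp add: kernel_op_def integral_nonneg_AE flip: of_real_mult)
    qed
  qed
  have "\<exists>c>0. kernel_bound M ?K c"
  proof (rule kernel_bound_of_finite[OF meas])
    fix f :: "'a \<Rightarrow> ennreal" assume [measurable]: "f \<in> borel_measurable M" and fin: "sq_norm M f < top"
    let ?u = "\<lambda>x. enn2real (f x)"
    have "AE x in M. (f x)\<^sup>2 \<noteq> \<infinity>"
      using fin unfolding sq_norm_def by (intro nn_integral_PInf_AE) auto
    then have fu: "AE x in M. ennreal (?u x) = f x"
    proof eventually_elim
      case (elim x)
      then have "f x \<noteq> top" by (intro notI) simp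
      then show ?case by (simp add: less_top)
    qed
    have uL: "(\<lambda>x. complex_of_real (?u x)) \<in> L2 M"
      using fin sq_norm_cong_AE[OF fu] by (simp add: L2_iff)
    have TL: "T (\<lambda>x. complex_of_real (?u x)) \<in> L2 M"
      using T uL by (simp add: has_kernel_def)
    have "sq_norm M (kernel_apply M ?K f) = sq_norm M (kernel_apply M ?K (\<lambda>y. ennreal (?u y)))"
      using kernel_apply_cong_AE[OF fu] by simp
    also have "\<dots> = sq_norm M (\<lambda>x. ennreal (cmod (T (\<lambda>x. complex_of_real (?u x)) x)))"
    proof (rule sq_norm_cong_AE)
      show "AE x in M. kernel_apply M ?K (\<lambda>y. ennreal (?u y)) x
          = ennreal (cmod (T (\<lambda>x. complex_of_real (?u x)) x))"
        using eq[OF enn2real_nonneg uL] by eventually_elim simp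
    qed
    also have "\<dots> < top" using TL by (simp add: L2_iff)
    finally show "sq_norm M (kernel_apply M ?K f) < top" .
  qed
  then show ?thesis
    unfolding acts_def using meas has_kernel_linear[OF T] eq by (auto elim!: eventually_mono)
qed

lemma cmod_integrable_kernel:
  assumes [measurable]: "kernel_measurable M k" and k: "\<And>x y. 0 \<le> k x y"
    and bound: "kernel_bound M (\<lambda>x y. ennreal (k x y)) c" and f: "f \<in> L2 M"
  shows "AE x in M. integrable M (\<lambda>y. complex_of_real (k x y) * f y)
    \<and> ennreal (cmod (kernel_op M (\<lambda>x y. complex_of_real (k x y)) f x))
      \<le> kernel_apply M (\<lambda>x y. ennreal (k x y)) (\<lambda>y. ennreal (cmod (f y))) x"
proof -
  note [measurable] = L2_measurable[OF f]
  have "AE x in M. kernel_apply M (\<lambda>x y. ennreal (k x y)) (\<lambda>y. ennreal (cmod (f y))) x < top"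
    using f by (intro kernel_apply_AE_finite(1)[OF _ _ bound]) (auto simp: L2_iff)
  with AE_space show ?thesis
  proof eventually_elim
    case (elim x)
    note [measurable] = elim(1)
    have e: "kernel_apply M (\<lambda>x y. ennreal (k x y)) (\<lambda>y. ennreal (cmod (f y))) x
        = (\<integral>\<^sup>+y. ennreal (cmod (complex_of_real (k x y) * f y)) \<partial>M)"
      using k by (simp add: kernel_apply_def norm_mult ennreal_mult)
    then have i: "integrable M (\<lambda>y. complex_of_real (k x y) * f y)"
      using elim(2) by (simp add: integrable_iff_bounded)
    then show ?case
      unfolding e kernel_op_def using integral_norm_bound_ennreal[OF i] by simp
  qed
qed

lemma kernel_op_has_kernel:
  assumes [measurable]: "kernel_measurable M k" and k: "\<And>x y. 0 \<le> k x y"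
    and bound: "kernel_bound M (\<lambda>x y. ennreal (k x y)) c"
  shows "has_kernel M (kernel_op M (\<lambda>x y. complex_of_real (k x y))) (\<lambda>x y. complex_of_real (k x y))"
proof -
  let ?T = "kernel_op M (\<lambda>x y. complex_of_real (k x y))"
  have L: "?T f \<in> L2 M" if f: "f \<in> L2 M" for f
  proof -
    note [measurable] = L2_measurable[OF f]
    have [measurable]: "?T f \<in> borel_measurable M"
      unfolding kernel_op_def by measurable
    have "AE x in M. ennreal (cmod (?T f x))
        \<le> kernel_apply M (\<lambda>x y. ennreal (k x y)) (\<lambda>y. ennreal (cmod (f y))) x"
      using cmod_integrable_kernel[OF assms f] by eventually_elim simp
    then have "sq_norm M (\<lambda>x. ennreal (cmod (?T f x)))
        \<le> sq_norm M (kernel_apply M (\<lambda>x y. ennreal (k x y)) (\<lambda>y. ennreal (cmod (f y))))"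
      by (rule sq_norm_mono_AE)
    also have "\<dots> < top"
      using f by (intro kernel_apply_AE_finite(2)[OF _ _ bound]) (auto simp: L2_iff)
    finally show ?thesis by (simp add: L2_iff)
  qed
  have "(\<lambda>(x, y). complex_of_real (k x y)) \<in> borel_measurable (M \<Otimes>\<^sub>M M)"
    by measurable
  moreover have "AE x in M. integrable M (\<lambda>y. complex_of_real (k x y) * f y)" if "f \<in> L2 M" for f
    using cmod_integrable_kernel[OF assms that] by (auto elim: eventually_mono)
  ultimately show ?thesis
    using L by (auto simp: has_kernel_def)
qed


lemma acts_cong_kernel:
  assumes T: "acts M T L" and K: "kernel_measurable M K"
    and eq: "AE z in M \<Otimes>\<^sub>M M. L (fst z) (snd z) = K (fst z) (snd z)"
  shows "acts M T K"
proof -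
  have ap: "AE x in M. \<forall>f. kernel_apply M L f x = kernel_apply M K f x"
    by (rule kernel_apply_cong_kernel_AE[OF actsD(1)[OF T] K eq])
  obtain c where c: "0 < c" "kernel_bound M L c" using actsD(2)[OF T] by auto
  have "sq_norm M (kernel_apply M K f) = sq_norm M (kernel_apply M L f)" for f
    using ap by (intro sq_norm_cong_AE) (auto elim: eventually_mono)
  then have "kernel_bound M K c" using c by (simp add: kernel_bound_def)
  moreover have "AE x in M. T (\<lambda>x. complex_of_real (u x)) x
      = complex_of_real (enn2real (kernel_apply M K (\<lambda>y. ennreal (u y)) x))"
    if "\<And>x. 0 \<le> u x" "(\<lambda>x. complex_of_real (u x)) \<in> L2 M" for u
    using actsD(4)[OF T that] ap by eventually_elim simp
  ultimately show ?thesis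
    unfolding acts_def using K c(1) actsD(3)[OF T] by blast
qed

lemma acts_kernel_op:
  assumes k: "kernel_measurable M k" "\<And>x y. 0 \<le> k x y"
    and K: "kernel_measurable M K" "kernel_bound M K c"
    and eq: "AE z in M \<Otimes>\<^sub>M M. ennreal (k (fst z) (snd z)) = K (fst z) (snd z)"
  shows "acts M (kernel_op M (\<lambda>x y. complex_of_real (k x y))) K"
    and "has_kernel M (kernel_op M (\<lambda>x y. complex_of_real (k x y))) (\<lambda>x y. complex_of_real (k x y))"
proof -
  have m: "kernel_measurable M (\<lambda>x y. ennreal (k x y))"
    using k(1) by measurable
  have "sq_norm M (kernel_apply M K f) = sq_norm M (kernel_apply M (\<lambda>x y. ennreal (k x y)) f)" for f
    using kernel_apply_cong_kernel_AE[OF m K(1) eq] by (intro sq_norm_cong_AE) (auto elim: eventually_mono)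
  then have b: "kernel_bound M (\<lambda>x y. ennreal (k x y)) c" using K(2) by (simp add: kernel_bound_def)
  show hk: "has_kernel M (kernel_op M (\<lambda>x y. complex_of_real (k x y))) (\<lambda>x y. complex_of_real (k x y))"
    by (rule kernel_op_has_kernel[OF k b])
  show "acts M (kernel_op M (\<lambda>x y. complex_of_real (k x y))) K"
    by (rule acts_cong_kernel[OF has_kernel_acts[OF hk k(2)] K(1) eq])
qed

lemma acts_has_kernel:
  assumes T: "acts M T K"
  shows "has_kernel M T (\<lambda>x y. complex_of_real (enn2real (K x y)))"
proof -
  obtain c where c: "kernel_bound M K c" using actsD(2)[OF T] by auto
  note K [measurable] = actsD(1)[OF T]
  let ?k = "\<lambda>x y. enn2real (K x y)" and ?S = "kernel_op M (\<lambda>x y. complex_of_real (enn2real (K x y)))"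
  have m: "kernel_measurable M ?k" by measurable
  have eq: "AE z in M \<Otimes>\<^sub>M M. ennreal (?k (fst z) (snd z)) = K (fst z) (snd z)"
    using kernel_AE_finite[OF K c] by eventually_elim simp
  note S = acts_kernel_op[OF m enn2real_nonneg K c eq]
  have "AE x in M. T f x = ?S f x" if "f \<in> L2 M" for f
  proof (rule L2_linear_eq_of_nonneg[OF actsD(3)[OF T] actsD(3)[OF S(1)] _ that])
    fix u :: "'a \<Rightarrow> real" assume u: "\<And>x. 0 \<le> u x" "(\<lambda>x. complex_of_real (u x)) \<in> L2 M"
    show "AE x in M. T (\<lambda>x. complex_of_real (u x)) x = ?S (\<lambda>x. complex_of_real (u x)) x"
      using actsD(4)[OF T u] actsD(4)[OF S(1) u] by eventually_elim simp
  qed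
  then show ?thesis
    using S(2) L2_linearD(1)[OF actsD(3)[OF T]] by (auto simp: has_kernel_def)
qed

lemma acts_cmod_le:
  assumes T: "acts M T K" and f: "f \<in> L2 M"
  shows "AE x in M. ennreal (cmod (T f x)) \<le> kernel_apply M K (\<lambda>y. ennreal (cmod (f y))) x"
proof -
  obtain c where c: "kernel_bound M K c" using actsD(2)[OF T] by auto
  note K [measurable] = actsD(1)[OF T]
  let ?k = "\<lambda>x y. enn2real (K x y)"
  have m: "kernel_measurable M ?k" by measurable
  have le: "ennreal (?k x y) \<le> K x y" for x y
    by (cases "K x y") auto
  then have b: "kernel_bound M (\<lambda>x y. ennreal (?k x y)) c"
    by (rule kernel_bound_mono) (rule c)
  have "AE x in M. T f x = kernel_op M (\<lambda>x y. complex_of_real (?k x y)) f x"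
    using acts_has_kernel[OF T] f by (auto simp: has_kernel_def)
  then show ?thesis
    using cmod_integrable_kernel[OF m enn2real_nonneg b f] AE_space
  proof eventually_elim
    case (elim x)
    then show ?case
      using kernel_apply_mono[of M "\<lambda>x y. ennreal (?k x y)" K, OF le order_refl elim(3)]
      by (auto intro: order_trans)
  qed
qed

lemma acts_cong_AE:
  assumes T: "acts M T K" and f: "f \<in> L2 M" and g: "g \<in> L2 M" and eq: "AE x in M. f x = g x"
  shows "AE x in M. T f x = T g x"
proof -
  let ?h = "\<lambda>y. 1 * f y + (-1) * g y"
  have h: "?h \<in> L2 M" using f g by (rule L2_lincomb)
  have "AE y in M. ennreal (cmod (?h y)) = (\<lambda>_. 0) y"
    using eq by eventually_elim simp
  then have z: "kernel_apply M K (\<lambda>y. ennreal (cmod (?h y))) = kernel_apply M K (\<lambda>_. 0)"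
    by (rule kernel_apply_cong_AE)
  show ?thesis
    using L2_linearD(2)[OF actsD(3)[OF T] f g, of 1 "-1"] acts_cmod_le[OF T h]
    unfolding z by eventually_elim (simp add: kernel_apply_def)
qed

lemma acts_norm_le:
  assumes T: "acts M T K" and c: "kernel_bound M K c" and f: "f \<in> L2 M"
  shows "(L2_norm M (T f))\<^sup>2 \<le> c * (L2_norm M f)\<^sup>2"
proof -
  have Tf: "T f \<in> L2 M" using L2_linearD(1)[OF actsD(3)[OF T] f] .
  have m: "(\<lambda>y. ennreal (cmod (f y))) \<in> borel_measurable M"
    using L2_measurable[OF f] by measurable
  have "sq_norm M (\<lambda>x. ennreal (cmod (T f x))) \<le> sq_norm M (kernel_apply M K (\<lambda>y. ennreal (cmod (f y))))"
    by (rule sq_norm_mono_AE[OF acts_cmod_le[OF T f]])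
  also have "\<dots> \<le> ennreal c * sq_norm M (\<lambda>y. ennreal (cmod (f y)))"
    by (rule kernel_boundD(2)[OF c m])
  finally show ?thesis
    using kernel_boundD(1)[OF c]
    by (simp add: sq_norm_cmod f Tf ennreal_le_iff flip: ennreal_mult)
qed

lemma acts_bounded_operator:
  assumes T: "acts M T K"
  shows "bounded_operator M T"
proof -
  obtain c where c: "kernel_bound M K c" using actsD(2)[OF T] by auto
  have "L2_norm M (T f) \<le> sqrt c * L2_norm M f" if "f \<in> L2 M" for f
  proof -
    have "L2_norm M (T f) \<le> sqrt (c * (L2_norm M f)\<^sup>2)"
      by (rule real_le_rsqrt) (rule acts_norm_le[OF T c that])
    then show ?thesis by (simp add: real_sqrt_mult)
  qed
  then show ?thesis
    using actsD(3)[OF T] by (auto simp: bounded_operator_def L2_linear_def)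
qed

lemma acts_cong_operator:
  assumes T: "acts M T K" and S: "\<And>f. f \<in> L2 M \<Longrightarrow> S f \<in> L2 M" "\<And>f. f \<in> L2 M \<Longrightarrow> AE x in M. S f x = T f x"
  shows "acts M S K"
  unfolding acts_def L2_linear_def
proof (intro conjI ballI allI impI)
  fix f g a b assume f: "f \<in> L2 M" and g: "g \<in> L2 M"
  show "AE x in M. S (\<lambda>y. a * f y + b * g y) x = a * S f x + b * S g x"
    using S(2)[OF f] S(2)[OF g] S(2)[OF L2_lincomb[OF f g, of a b]] L2_linearD(2)[OF actsD(3)[OF T] f g, of a b]
    by eventually_elim simp
next
  fix u :: "'a \<Rightarrow> real" assume u: "(\<forall>x. 0 \<le> u x) \<and> (\<lambda>x. complex_of_real (u x)) \<in> L2 M"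
  then show "AE x in M. S (\<lambda>x. complex_of_real (u x)) x
      = complex_of_real (enn2real (kernel_apply M K (\<lambda>y. ennreal (u y)) x))"
    using S(2)[of "\<lambda>x. complex_of_real (u x)"] actsD(4)[OF T, of u] by (auto elim: eventually_elim2)
qed (use actsD[OF T] S in auto)

lemma acts_comp:
  assumes T: "acts M T K" and S: "acts M S L"
  shows "acts M (T \<circ> S) (kernel_comp M K L)"
  unfolding acts_def
proof (intro conjI allI impI)
  note K [measurable] = actsD(1)[OF T] and L [measurable] = actsD(1)[OF S]
  obtain c d where c: "0 < c" "kernel_bound M K c" and d: "0 < d" "kernel_bound M L d"
    using actsD(2)[OF T] actsD(2)[OF S] by auto
  show "kernel_measurable M (kernel_comp M K L)"
    by (rule kernel_comp_measurable[OF K L])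
  show "\<exists>e>0. kernel_bound M (kernel_comp M K L) e"
    using kernel_bound_comp[OF K L c(2) d(2)] c(1) d(1) by (intro exI[of _ "c * d"]) simp
  note T_L2 = L2_linearD[OF actsD(3)[OF T]] and S_L2 = L2_linearD[OF actsD(3)[OF S]]
  show "L2_linear M (T \<circ> S)"
    unfolding L2_linear_def
  proof (intro conjI ballI allI)
    fix f g a b assume f: "f \<in> L2 M" and g: "g \<in> L2 M"
    have "AE x in M. T (S (\<lambda>y. a * f y + b * g y)) x = T (\<lambda>y. a * S f y + b * S g y) x"
      by (intro acts_cong_AE[OF T] S_L2 L2_lincomb f g)
    then show "AE x in M. (T \<circ> S) (\<lambda>y. a * f y + b * g y) x = a * (T \<circ> S) f x + b * (T \<circ> S) g x"
      using T_L2(2)[OF S_L2(1)[OF f] S_L2(1)[OF g], of a b] by eventually_elim simp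
  qed (use T_L2 S_L2 in simp)
  fix u :: "'a \<Rightarrow> real" assume u: "(\<forall>x. 0 \<le> u x) \<and> (\<lambda>x. complex_of_real (u x)) \<in> L2 M"
  then have [measurable]: "u \<in> borel_measurable M" by (simp add: L2_of_real)
  let ?u = "\<lambda>x. complex_of_real (u x)" and ?v = "kernel_apply M L (\<lambda>y. ennreal (u y))"
  have "sq_norm M (\<lambda>y. ennreal (u y)) < top" using u by (auto simp: L2_iff abs_of_nonneg)
  note fin = kernel_apply_AE_finite[OF L _ d(2) this]
  have Sv: "AE x in M. S ?u x = complex_of_real (enn2real (?v x))"
    using actsD(4)[OF S, of u] u by blast
  have v: "(\<lambda>x. complex_of_real (enn2real (?v x))) \<in> L2 M"
  proof (rule L2_cong_AE)
    show "S ?u \<in> L2 M" using S_L2(1)[of ?u] u by blast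
    show "(\<lambda>x. complex_of_real (enn2real (?v x))) \<in> borel_measurable M" by measurable
    show "AE x in M. complex_of_real (enn2real (?v x)) = S ?u x" using Sv by eventually_elim simp
  qed
  have e1: "kernel_apply M K (\<lambda>y. ennreal (enn2real (?v y))) = kernel_apply M K ?v"
    using fin(1) by (intro kernel_apply_cong_AE) (auto elim: eventually_mono)
  have e2: "AE x in M. T (S ?u) x = T (\<lambda>x. complex_of_real (enn2real (?v x))) x"
    by (rule acts_cong_AE[OF T S_L2(1)[of ?u] v Sv]) (use u in simp)
  have e3: "kernel_apply M (kernel_comp M K L) (\<lambda>y. ennreal (u y)) x = kernel_apply M K ?v x"
    if "x \<in> space M" for x
    by (rule kernel_apply_comp[OF K L _ that]) measurable
  show "AE x in M. (T \<circ> S) ?u x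
      = complex_of_real (enn2real (kernel_apply M (kernel_comp M K L) (\<lambda>y. ennreal (u y)) x))"
    using actsD(4)[OF T enn2real_nonneg v] e2 AE_space unfolding e1
  proof eventually_elim
    case (elim x)
    show ?case unfolding comp_apply elim(2) elim(1) e3[OF elim(3)] ..
  qed
qed

lemma acts_funpow:
  assumes T: "acts M T K" and f: "f \<in> L2 M"
  shows "(T ^^ n) f \<in> L2 M"
    and "AE x in M. ennreal (cmod ((T ^^ n) f x)) \<le> (kernel_apply M K ^^ n) (\<lambda>y. ennreal (cmod (f y))) x"
proof -
  show L: "(T ^^ n) f \<in> L2 M" for n
    by (induction n) (use f L2_linearD(1)[OF actsD(3)[OF T]] in auto)
  show "AE x in M. ennreal (cmod ((T ^^ n) f x)) \<le> (kernel_apply M K ^^ n) (\<lambda>y. ennreal (cmod (f y))) x"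
  proof (induction n)
    case (Suc n)
    have "kernel_apply M K (\<lambda>y. ennreal (cmod ((T ^^ n) f y))) x
        \<le> kernel_apply M K ((kernel_apply M K ^^ n) (\<lambda>y. ennreal (cmod (f y)))) x" for x
    proof -
      have "AE y in M. K x y * ennreal (cmod ((T ^^ n) f y))
          \<le> K x y * (kernel_apply M K ^^ n) (\<lambda>y. ennreal (cmod (f y))) y"
        using Suc by eventually_elim (rule mult_left_mono, auto)
      then show ?thesis
        unfolding kernel_apply_def[of M K "\<lambda>y. ennreal (cmod ((T ^^ n) f y))"]
          kernel_apply_def[of M K "(kernel_apply M K ^^ n) (\<lambda>y. ennreal (cmod (f y)))"]
        by (rule nn_integral_mono_AE)
    qed
    then show ?case
      using acts_cmod_le[OF T L[of n]] by (auto elim!: eventually_mono intro: order_trans)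
  qed simp
qed

end

section \<open>Adjoints, Hadamard products, positive kernel operators and matrices\<close>

lemma borel_measurable_cnj [measurable (raw)]:
  assumes "f \<in> borel_measurable M"
  shows "(\<lambda>x. cnj (f x)) \<in> borel_measurable M"
  by (rule measurable_compose[OF assms])
     (intro borel_measurable_continuous_onI continuous_intros)

lemma L2_inner_integrable:
  assumes "f \<in> L2 M" "g \<in> L2 M"
  shows "integrable M (\<lambda>x. f x * cnj (g x))"
  by (rule Bochner_Integration.integrable_bound[OF L2_mult_integrable(1)[OF assms]])
     (use assms[THEN L2_measurable] in \<open>auto simp: norm_mult\<close>)

lemma L2_eq_of_inner_eq:
  assumes f: "f \<in> L2 M" and g: "g \<in> L2 M"
    and eq: "\<And>h. h \<in> L2 M \<Longrightarrow> L2_inner M h f = L2_inner M h g"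
  shows "AE x in M. f x = g x"
proof -
  define h where "h = (\<lambda>x. 1 * f x + (-1) * g x)"
  have h: "h \<in> L2 M" unfolding h_def using f g by (rule L2_lincomb)
  have "(\<integral>x. h x * cnj (h x) \<partial>M) = (\<integral>x. h x * cnj (f x) - h x * cnj (g x) \<partial>M)"
    by (intro Bochner_Integration.integral_cong) (auto simp: h_def algebra_simps)
  also have "\<dots> = 0"
    using eq[OF h] L2_inner_integrable[OF h f] L2_inner_integrable[OF h g] by (simp add: L2_inner_def)
  finally have "complex_of_real (\<integral>x. (cmod (h x))\<^sup>2 \<partial>M) = 0"
    by (simp only: complex_norm_square[symmetric] integral_complex_of_real)
  then have "L2_norm M h = 0" by (simp add: L2_norm_def)
  then have "AE x in M. h x = 0" by (simp add: L2_norm_eq_0_iff[OF h])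
  then show ?thesis by eventually_elim (simp add: h_def)
qed

context sigma_finite_measure
begin

interpretation pair: pair_sigma_finite M M ..

text \<open>
  The operator with the transposed kernel satisfies the defining identity of the adjoint by Fubini's
  theorem, and that identity determines the values of the adjoint almost everywhere; so whatever
  operator \<open>L2_adjoint\<close> selects agrees with it.
\<close>

lemma acts_adjoint:
  assumes T: "acts M T K"
  shows "acts M (L2_adjoint M T) (\<lambda>x y. K y x)"
proof -
  obtain c where c: "0 < c" "kernel_bound M K c" using actsD(2)[OF T] by auto
  note K [measurable] = actsD(1)[OF T]
  let ?k = "\<lambda>x y. enn2real (K x y)" and ?k' = "\<lambda>x y. enn2real (K y x)"
  let ?S = "kernel_op M (\<lambda>x y. complex_of_real (enn2real (K y x)))"
  note K' [measurable] = kernel_transpose_measurable[OF K]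
  have c': "kernel_bound M (\<lambda>x y. K y x) c" by (rule kernel_bound_transpose[OF K c(2,1)])
  have m: "kernel_measurable M ?k'" by measurable
  have eq: "AE z in M \<Otimes>\<^sub>M M. ennreal (?k' (fst z) (snd z)) = K (snd z) (fst z)"
    using kernel_AE_finite[OF K' c'] by eventually_elim simp
  note S = acts_kernel_op(1)[OF m enn2real_nonneg K' c' eq]
  have le: "ennreal (?k x y) \<le> K x y" for x y by (cases "K x y") auto
  have inner: "L2_inner M (T f) g = L2_inner M f (?S g)" if f: "f \<in> L2 M" and g: "g \<in> L2 M" for f g
  proof -
    note [measurable] = f[THEN L2_measurable] g[THEN L2_measurable]
    define F where "F x y = complex_of_real (?k x y) * f y * cnj (g x)" for x y
    have F_meas: "kernel_measurable M F" unfolding F_def by measurable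
    have "integrable (M \<Otimes>\<^sub>M M) (case_prod F)"
    proof (rule integrableI_bounded[OF F_meas])
      have "(\<integral>\<^sup>+z. ennreal (norm (case_prod F z)) \<partial>(M \<Otimes>\<^sub>M M))
          \<le> (\<integral>\<^sup>+z. K (fst z) (snd z) * ennreal (cmod (f (snd z))) * ennreal (cmod (g (fst z))) \<partial>(M \<Otimes>\<^sub>M M))"
      proof (rule nn_integral_mono)
        fix z
        have "ennreal (norm (case_prod F z)) = ennreal (?k (fst z) (snd z)) * ennreal (cmod (f (snd z))) * ennreal (cmod (g (fst z)))"
          by (simp add: F_def case_prod_beta norm_mult ennreal_mult)
        also have "\<dots> \<le> K (fst z) (snd z) * ennreal (cmod (f (snd z))) * ennreal (cmod (g (fst z)))"
          by (intro mult_right_mono le) auto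
        finally show "ennreal (norm (case_prod F z))
            \<le> K (fst z) (snd z) * ennreal (cmod (f (snd z))) * ennreal (cmod (g (fst z)))" .
      qed
      also have "\<dots> < top"
        by (rule nn_integral_weighted_kernel_finite[OF K _ _ c(2)]) (use f g in \<open>auto simp: L2_iff\<close>)
      finally show "(\<integral>\<^sup>+z. ennreal (norm (case_prod F z)) \<partial>(M \<Otimes>\<^sub>M M)) < \<infinity>" by simp
    qed
    note fub = pair.Fubini_integral[OF this]
    have Tf: "AE x in M. T f x = kernel_op M (\<lambda>x y. complex_of_real (?k x y)) f x"
      using acts_has_kernel[OF T] f by (auto simp: has_kernel_def)
    have [measurable]: "T f \<in> borel_measurable M"
      using L2_linearD(1)[OF actsD(3)[OF T] f] by (rule L2_measurable)
    have [measurable]: "kernel_op M (\<lambda>x y. complex_of_real (?k x y)) f \<in> borel_measurable M"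
      unfolding kernel_op_def by measurable
    have "L2_inner M (T f) g = (\<integral>x. kernel_op M (\<lambda>x y. complex_of_real (?k x y)) f x * cnj (g x) \<partial>M)"
      unfolding L2_inner_def
    proof (rule integral_cong_AE)
      show "AE x in M. T f x * cnj (g x) = kernel_op M (\<lambda>x y. complex_of_real (?k x y)) f x * cnj (g x)"
        using Tf by eventually_elim simp
    qed measurable
    also have "\<dots> = (\<integral>x. (\<integral>y. F x y \<partial>M) \<partial>M)"
      unfolding F_def kernel_op_def by simp
    also have "\<dots> = (\<integral>y. (\<integral>x. F x y \<partial>M) \<partial>M)"
      by (rule fub[symmetric])
    also have "\<dots> = L2_inner M f (?S g)"
      unfolding L2_inner_def kernel_op_def
    proof (intro Bochner_Integration.integral_cong refl)
      fix y
      have "(\<integral>x. F x y \<partial>M) = (\<integral>x. f y * cnj (complex_of_real (?k x y) * g x) \<partial>M)"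
        by (intro Bochner_Integration.integral_cong refl) (simp add: F_def)
      also have "\<dots> = f y * cnj (\<integral>x. complex_of_real (?k x y) * g x \<partial>M)"
        by (simp only: integral_mult_right_zero Bochner_Integration.integral_cnj)
      finally show "(\<integral>x. F x y \<partial>M) = f y * cnj (\<integral>x. complex_of_real (?k x y) * g x \<partial>M)" .
    qed
    finally show ?thesis .
  qed
  have S_L2: "\<forall>g\<in>L2 M. ?S g \<in> L2 M"
    using L2_linearD(1)[OF actsD(3)[OF S]] by blast
  have "\<exists>S. (\<forall>g \<in> L2 M. S g \<in> L2 M) \<and> (\<forall>f \<in> L2 M. \<forall>g \<in> L2 M. L2_inner M (T f) g = L2_inner M f (S g))"
    by (intro exI[of _ ?S] conjI S_L2 ballI inner)
  from someI_ex[OF this]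
  have adj: "\<And>g. g \<in> L2 M \<Longrightarrow> L2_adjoint M T g \<in> L2 M"
      "\<And>f g. f \<in> L2 M \<Longrightarrow> g \<in> L2 M \<Longrightarrow> L2_inner M (T f) g = L2_inner M f (L2_adjoint M T g)"
    unfolding L2_adjoint_def by auto
  show ?thesis
  proof (rule acts_cong_operator[OF S adj(1)])
    fix g assume g: "g \<in> L2 M"
    show "AE x in M. L2_adjoint M T g x = ?S g x"
    proof (rule L2_eq_of_inner_eq)
      show "L2_adjoint M T g \<in> L2 M" by (rule adj(1)[OF g])
      show "?S g \<in> L2 M" using S_L2 g by blast
      fix h assume h: "h \<in> L2 M"
      show "L2_inner M h (L2_adjoint M T g) = L2_inner M h (?S g)"
        unfolding adj(2)[OF h g, symmetric] by (rule inner[OF h g])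
    qed
  qed
qed

lemma pos_kernel_acts:
  assumes T: "acts M T K"
  shows "0 \<le> pos_kernel M T x y" "kernel_measurable M (pos_kernel M T)"
    "AE z in M \<Otimes>\<^sub>M M. ennreal (pos_kernel M T (fst z) (snd z)) = K (fst z) (snd z)"
proof -
  have "\<exists>k. (\<forall>x y. 0 \<le> k x y) \<and> has_kernel M T (\<lambda>x y. of_real (k x y))"
    by (intro exI[of _ "\<lambda>x y. enn2real (K x y)"] conjI acts_has_kernel[OF T]) simp
  from someI_ex[OF this]
  have p: "\<And>x y. 0 \<le> pos_kernel M T x y" "has_kernel M T (\<lambda>x y. of_real (pos_kernel M T x y))"
    unfolding pos_kernel_def by auto
  show "0 \<le> pos_kernel M T x y" by (rule p)
  note P = has_kernel_acts[OF p(2,1)]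
  show "AE z in M \<Otimes>\<^sub>M M. ennreal (pos_kernel M T (fst z) (snd z)) = K (fst z) (snd z)"
    by (rule acts_kernel_unique[OF P T])
  have "(\<lambda>z. enn2real (case_prod (\<lambda>x y. ennreal (pos_kernel M T x y)) z)) \<in> borel_measurable (M \<Otimes>\<^sub>M M)"
    using actsD(1)[OF P] by measurable
  then show "kernel_measurable M (pos_kernel M T)"
    using p(1) by (simp add: case_prod_beta')
qed

lemma acts_hadamard:
  assumes exp: "hadamard_exponent M m \<alpha>" and T: "\<And>i. i \<in> {1..m} \<Longrightarrow> acts M (T i) (K i)"
  shows "acts M (hadamard M \<alpha> m T) (hadamard_kernel \<alpha> m K)"
proof -
  let ?p = "\<lambda>x y. \<Prod>i=1..m. pos_kernel M (T i) x y powr \<alpha>"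
  note pk = pos_kernel_acts[OF T]
  have "\<forall>i\<in>{1..m}. \<exists>c. kernel_bound M (K i) c" using actsD(2)[OF T] by blast
  then obtain c where c: "\<And>i. i \<in> {1..m} \<Longrightarrow> kernel_bound M (K i) (c i)" by metis
  have m: "kernel_measurable M ?p"
  proof -
    have "(\<lambda>z. \<Prod>i=1..m. case_prod (pos_kernel M (T i)) z powr \<alpha>) \<in> borel_measurable (M \<Otimes>\<^sub>M M)"
      using pk(2) by (intro borel_measurable_prod powr_real_measurable borel_measurable_const)
    then show ?thesis by (simp add: case_prod_beta')
  qed
  have eq: "AE z in M \<Otimes>\<^sub>M M. ennreal (?p (fst z) (snd z)) = hadamard_kernel \<alpha> m K (fst z) (snd z)"
  proof -
    have "AE z in M \<Otimes>\<^sub>M M. \<forall>i\<in>{1..m}. ennreal (pos_kernel M (T i) (fst z) (snd z)) = K i (fst z) (snd z)"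
      by (subst AE_finite_all) (use pk(3) in auto)
    then show ?thesis
    proof eventually_elim
      case (elim z)
      have "ennreal (?p (fst z) (snd z)) = (\<Prod>i=1..m. ennreal (pos_kernel M (T i) (fst z) (snd z) powr \<alpha>))"
        by (simp add: prod_ennreal)
      also have "\<dots> = (\<Prod>i=1..m. ennpowr (K i (fst z) (snd z)) \<alpha>)"
        using elim pk(1) by (intro prod.cong refl) (simp flip: ennpowr_ennreal)
      finally show ?case by (simp add: hadamard_kernel_def)
    qed
  qed
  show ?thesis
    unfolding hadamard_def
    by (rule acts_kernel_op(1)[OF m _ hadamard_kernel_measurable kernel_bound_hadamard[OF exp _ c] eq])
       (auto intro: actsD(1)[OF T] prod_nonneg)
qed

lemma has_kernel_cong_AE:
  assumes T: "has_kernel M T k" and [measurable]: "kernel_measurable M k'"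
    and eq: "AE z in M \<Otimes>\<^sub>M M. k (fst z) (snd z) = k' (fst z) (snd z)"
  shows "has_kernel M T k'"
proof -
  have [measurable]: "kernel_measurable M k"
    using T by (simp add: has_kernel_def)
  have e: "AE x in M. AE y in M. k x y = k' x y"
    using pair.AE_pair[OF eq] by simp
  have "(AE x in M. integrable M (\<lambda>y. k' x y * f y)) \<and> (AE x in M. T f x = kernel_op M k' f x)"
    if f: "f \<in> L2 M" for f
  proof -
    note [measurable] = L2_measurable[OF f]
    have i: "AE x in M. integrable M (\<lambda>y. k x y * f y)" and o: "AE x in M. T f x = kernel_op M k f x"
      using T f by (auto simp: has_kernel_def)
    have "AE x in M. integrable M (\<lambda>y. k' x y * f y) \<and> kernel_op M k' f x = kernel_op M k f x"
      using e i AE_space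
    proof eventually_elim
      case (elim x)
      note [measurable] = elim(3)
      have ae: "AE y in M. k x y * f y = k' x y * f y" using elim(1) by eventually_elim simp
      have "integrable M (\<lambda>y. k' x y * f y)"
        by (rule integrable_cong_AE_imp[OF elim(2)]) (use ae in \<open>auto elim: eventually_mono\<close>)
      moreover have "(\<integral>y. k' x y * f y \<partial>M) = (\<integral>y. k x y * f y \<partial>M)"
        by (rule integral_cong_AE) (use ae in \<open>auto elim: eventually_mono\<close>)
      ultimately show ?case by (simp add: kernel_op_def)
    qed
    with o show ?thesis by (auto elim: eventually_elim2 eventually_mono)
  qed
  then show ?thesis using T by (auto simp: has_kernel_def)
qed

text \<open>
  Positivity says that for each measurable \<open>B\<close> the integral of the kernel over \<open>B\<close>, with a weight, is
  nonnegative at almost every \<open>x\<close>, with an exceptional set that depends on \<open>B\<close>.  Integrated over \<open>x\<close>, this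
  gives nonnegative integrals over all rectangles, to which \<open>AE_nonneg_of_rectangles\<close> applies.
\<close>

lemma positive_kernel_nonneg:
  assumes T: "has_kernel M T k" and pos: "positive_operator M T"
  shows "AE z in M \<Otimes>\<^sub>M M. k (fst z) (snd z) = complex_of_real (max 0 (Re (k (fst z) (snd z))))"
proof -
  have k [measurable]: "kernel_measurable M k"
    using T by (simp add: has_kernel_def)
  obtain w :: "'a \<Rightarrow> real" where w: "w \<in> borel_measurable M" "\<And>x. 0 < w x" "\<And>x. w x \<le> 1"
      "integrable M w" "sq_norm M (\<lambda>x. ennreal (w x)) < top"
    using square_integrable_weight by metis
  note [measurable] = w(1)
  have w0: "0 \<le> w x" for x using w(2)[of x] by simp
  define \<phi> where "\<phi> x = (\<integral>\<^sup>+y. ennreal (cmod (k x y) * w y) \<partial>M)" for x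
  have [measurable]: "\<phi> \<in> borel_measurable M" unfolding \<phi>_def by measurable
  have wL: "(\<lambda>x. complex_of_real (w x * indicator B x)) \<in> L2 M" if [measurable]: "B \<in> sets M" for B
  proof (rule L2_dominated)
    show "(\<lambda>x. complex_of_real (w x)) \<in> L2 M" using w w0 by (simp add: L2_iff)
  qed (auto split: split_indicator)
  have TB: "AE x in M. integrable M (\<lambda>y. k x y * complex_of_real (w y * indicator B y))
      \<and> (\<integral>y. k x y * complex_of_real (w y * indicator B y) \<partial>M) \<in> \<real>\<^sub>\<ge>\<^sub>0" if B: "B \<in> sets M" for B
  proof -
    let ?u = "\<lambda>x. complex_of_real (w x * indicator B x)"
    have "AE x in M. ?u x \<in> \<real>\<^sub>\<ge>\<^sub>0" using w0 by (intro AE_I2) (simp add: nonneg_Reals_of_real_iff)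
    then have "AE x in M. T ?u x \<in> \<real>\<^sub>\<ge>\<^sub>0" 
      by (rule bspec[OF pos[unfolded positive_operator_def] wL[OF B], THEN mp])
    moreover have "AE x in M. integrable M (\<lambda>y. k x y * ?u y)" "AE x in M. T ?u x = kernel_op M k ?u x"
      using T wL[OF B] by (auto simp: has_kernel_def)
    ultimately show ?thesis
      unfolding kernel_op_def by eventually_elim simp
  qed
  have \<phi>_fin: "AE x in M. \<phi> x < top"
    using TB[OF sets.top] AE_space
  proof eventually_elim
    case (elim x)
    have "\<phi> x = (\<integral>\<^sup>+y. ennreal (cmod (k x y * complex_of_real (w y * indicator (space M) y))) \<partial>M)"
      unfolding \<phi>_def using w0 by (intro nn_integral_cong) (simp add: norm_mult)
    then show ?case
      using elim by (simp add: integrable_iff_bounded)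
  qed
  \<comment> \<open>The second weight is small where the kernel is large, because \<open>\<phi>\<close> need not be square-integrable.\<close>
  define v where "v x = w x / (1 + enn2real (\<phi> x))" for x
  have [measurable]: "v \<in> borel_measurable M" unfolding v_def by measurable
  have v: "0 < v x" for x using w(2)[of x] by (simp add: v_def add_pos_nonneg)
  define F where "F z = k (fst z) (snd z) * complex_of_real (w (snd z)) * complex_of_real (v (fst z))" for z
  have F_meas [measurable]: "F \<in> borel_measurable (M \<Otimes>\<^sub>M M)" unfolding F_def by measurable
  have F: "integrable (M \<Otimes>\<^sub>M M) F"
  proof (rule integrableI_bounded[OF F_meas])
    have "(\<integral>\<^sup>+z. ennreal (norm (F z)) \<partial>(M \<Otimes>\<^sub>M M)) = (\<integral>\<^sup>+x. (\<integral>\<^sup>+y. ennreal (norm (F (x, y))) \<partial>M) \<partial>M)"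
      by (rule nn_integral_fst[symmetric]) measurable
    also have "\<dots> = (\<integral>\<^sup>+x. \<phi> x * ennreal (v x) \<partial>M)"
    proof (rule nn_integral_cong)
      fix x assume [measurable]: "x \<in> space M"
      have "(\<integral>\<^sup>+y. ennreal (norm (F (x, y))) \<partial>M) = (\<integral>\<^sup>+y. ennreal (cmod (k x y) * w y) * ennreal (v x) \<partial>M)"
        using v[of x] w0 by (intro nn_integral_cong) (simp add: F_def norm_mult ennreal_mult)
      also have "\<dots> = \<phi> x * ennreal (v x)" unfolding \<phi>_def by (rule nn_integral_multc) measurable
      finally show "(\<integral>\<^sup>+y. ennreal (norm (F (x, y))) \<partial>M) = \<phi> x * ennreal (v x)" .
    qed
    also have "\<dots> \<le> (\<integral>\<^sup>+x. ennreal (w x) \<partial>M)"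
    proof (rule nn_integral_mono_AE)
      show "AE x in M. \<phi> x * ennreal (v x) \<le> ennreal (w x)"
        using \<phi>_fin
      proof eventually_elim
        case (elim x)
        have "\<phi> x * ennreal (v x) = ennreal (enn2real (\<phi> x) * v x)"
          using elim v[of x] by (simp add: ennreal_mult)
        also have "\<dots> \<le> ennreal (w x)"
          using w0[of x] by (intro ennreal_leI) (simp add: v_def divide_le_eq add_pos_nonneg mult.commute mult_left_mono)
        finally show ?case .
      qed
    qed
    also have "\<dots> < \<infinity>" using nn_integral_eq_integral[OF w(4)] w0 by simp
    finally show "(\<integral>\<^sup>+z. ennreal (norm (F z)) \<partial>(M \<Otimes>\<^sub>M M)) < \<infinity>" .
  qed
  have rect: "0 \<le> Re (\<integral>z. indicator (A \<times> B) z * F z \<partial>(M \<Otimes>\<^sub>M M))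
      \<and> Im (\<integral>z. indicator (A \<times> B) z * F z \<partial>(M \<Otimes>\<^sub>M M)) = 0"
    and int: "integrable (M \<Otimes>\<^sub>M M) (\<lambda>z. indicator (A \<times> B) z * F z)"
    if A [measurable]: "A \<in> sets M" and B [measurable]: "B \<in> sets M" for A B
  proof -
    have AB: "A \<times> B \<in> sets (M \<Otimes>\<^sub>M M)" by simp
    show i: "integrable (M \<Otimes>\<^sub>M M) (\<lambda>z. indicator (A \<times> B) z * F z)"
      by (rule Bochner_Integration.integrable_bound[OF F]) (auto split: split_indicator)
    define G where "G x = (\<integral>y. indicator (A \<times> B) (x, y) * F (x, y) \<partial>M)" for x
    have "(\<integral>z. indicator (A \<times> B) z * F z \<partial>(M \<Otimes>\<^sub>M M)) = (\<integral>x. G x \<partial>M)"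
      unfolding G_def by (rule pair.integral_fst'[OF i, symmetric])
    moreover have G_int: "integrable M G"
      unfolding G_def using pair.integrable_fst'[OF i] by simp
    moreover have G: "AE x in M. 0 \<le> Re (G x) \<and> Im (G x) = 0"
      using TB[OF B]
    proof eventually_elim
      case (elim x)
      have "G x = (\<integral>y. complex_of_real (indicator A x * v x) * (k x y * complex_of_real (w y * indicator B y)) \<partial>M)"
        unfolding G_def F_def
        by (intro Bochner_Integration.integral_cong refl) (auto split: split_indicator)
      also have "\<dots> = complex_of_real (indicator A x * v x) * (\<integral>y. k x y * complex_of_real (w y * indicator B y) \<partial>M)"
        by simp
      finally show ?case
        using elim v[of x] by (auto simp: complex_nonneg_Reals_iff less_imp_le)
    qed
    moreover have "0 \<le> (\<integral>x. Re (G x) \<partial>M)"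
      using G by (intro integral_nonneg_AE) (auto elim: eventually_mono)
    moreover have "(\<integral>x. Im (G x) \<partial>M) = (\<integral>x. 0 \<partial>M)"
      using G G_int by (intro integral_cong_AE) (auto elim: eventually_mono)
    ultimately show "0 \<le> Re (\<integral>z. indicator (A \<times> B) z * F z \<partial>(M \<Otimes>\<^sub>M M))
      \<and> Im (\<integral>z. indicator (A \<times> B) z * F z \<partial>(M \<Otimes>\<^sub>M M)) = 0"
      by simp
  qed
  have re: "(\<integral>z. indicator (A \<times> B) z * Re (F z) \<partial>(M \<Otimes>\<^sub>M M)) = Re (\<integral>z. indicator (A \<times> B) z * F z \<partial>(M \<Otimes>\<^sub>M M))"
    and im: "(\<integral>z. indicator (A \<times> B) z * Im (F z) \<partial>(M \<Otimes>\<^sub>M M)) = Im (\<integral>z. indicator (A \<times> B) z * F z \<partial>(M \<Otimes>\<^sub>M M))"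
    if "A \<in> sets M" "B \<in> sets M" for A B
    unfolding integral_Re[OF int[OF that], symmetric] integral_Im[OF int[OF that], symmetric]
    by (intro Bochner_Integration.integral_cong refl; simp split: split_indicator)+
  have "AE z in M \<Otimes>\<^sub>M M. 0 \<le> Re (F z)"
    by (rule AE_nonneg_of_rectangles) (use F rect re in auto)
  moreover have "AE z in M \<Otimes>\<^sub>M M. 0 \<le> Im (F z)"
    by (rule AE_nonneg_of_rectangles) (use F rect im in auto)
  moreover have "AE z in M \<Otimes>\<^sub>M M. 0 \<le> - Im (F z)"
    by (rule AE_nonneg_of_rectangles) (use F rect im in auto)
  ultimately show ?thesis
  proof eventually_elim
    case (elim z)
    define c where "c = w (snd z) * v (fst z)"
    have c: "0 < c" using w(2) v by (simp add: c_def)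
    have "F z = k (fst z) (snd z) * complex_of_real c"
      by (simp add: F_def c_def)
    then have "Re (F z) = Re (k (fst z) (snd z)) * c" "Im (F z) = Im (k (fst z) (snd z)) * c"
      by simp_all
    then have "0 \<le> Re (k (fst z) (snd z))" "Im (k (fst z) (snd z)) = 0"
      using elim c by (simp_all add: zero_le_mult_iff mult_le_0_iff)
    then show ?case by (simp add: complex_eq_iff)
  qed
qed

lemma positive_kernel_operator_acts:
  assumes "positive_kernel_operator M T"
  shows "\<exists>K. acts M T K"
proof -
  obtain k where T: "has_kernel M T k" and pos: "positive_operator M T"
    using assms by (auto simp: positive_kernel_operator_def)
  have k [measurable]: "kernel_measurable M k"
    using T by (simp add: has_kernel_def)
  have "has_kernel M T (\<lambda>x y. complex_of_real (max 0 (Re (k x y))))"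
    by (rule has_kernel_cong_AE[OF T _ positive_kernel_nonneg[OF T pos]]) measurable
  then show ?thesis
    by (intro exI) (rule has_kernel_acts, auto)
qed

end

lemma matrix_op_positive_kernel_operator:
  assumes R: "countable R" and nonneg: "\<And>i j. i \<in> R \<Longrightarrow> j \<in> R \<Longrightarrow> 0 \<le> A i j" and A: "defines_l2_operator R A"
  shows "positive_kernel_operator (count_space R) (matrix_op R A)"
proof -
  let ?M = "count_space R" and ?k = "\<lambda>i j. complex_of_real (A i j)"
  have int: "integrable ?M (\<lambda>j. ?k i j * f j)" "matrix_op R A f i = kernel_op ?M ?k f i"
    if "f \<in> L2 ?M" "i \<in> R" for f i
  proof -
    have "(\<lambda>j. ?k i j * f j) summable_on R" using A that by (auto simp: defines_l2_operator_def)
    then have abs: "(\<lambda>j. norm (?k i j * f j)) summable_on R"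
      by (rule summable_on_iff_abs_summable_on_complex[THEN iffD1])
    then have s: "Infinite_Set_Sum.abs_summable_on (\<lambda>j. ?k i j * f j) R"
      by (simp add: abs_summable_equivalent)
    then show "integrable ?M (\<lambda>j. ?k i j * f j)" by (simp add: Infinite_Set_Sum.abs_summable_on_def)
    show "matrix_op R A f i = kernel_op ?M ?k f i"
      using infsetsum_infsum[OF s] by (simp add: matrix_op_def kernel_op_def infsetsum_def)
  qed
  have "has_kernel ?M (matrix_op R A) ?k"
    unfolding has_kernel_def
  proof (intro conjI ballI)
    show "(\<lambda>(x, y). ?k x y) \<in> borel_measurable (?M \<Otimes>\<^sub>M ?M)"
      using R by (simp add: pair_measure_countable)
  qed (use int A in \<open>auto simp: AE_count_space defines_l2_operator_def\<close>)
  moreover have "positive_operator ?M (matrix_op R A)"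
    unfolding positive_operator_def AE_count_space
  proof (intro ballI impI)
    fix f i assume f: "f \<in> L2 ?M" "\<forall>x\<in>R. f x \<in> \<real>\<^sub>\<ge>\<^sub>0" and i: "i \<in> R"
    have "kernel_op ?M ?k f i = (\<integral>j. complex_of_real (A i j * Re (f j)) \<partial>?M)"
      unfolding kernel_op_def
      by (intro Bochner_Integration.integral_cong refl)
         (use f in \<open>auto simp: complex_nonneg_Reals_iff complex_eq_iff\<close>)
    also have "\<dots> = complex_of_real (\<integral>j. A i j * Re (f j) \<partial>?M)" by (rule integral_complex_of_real)
    also have "\<dots> \<in> \<real>\<^sub>\<ge>\<^sub>0"
      using f i nonneg unfolding nonneg_Reals_of_real_iff
      by (intro integral_nonneg_AE) (auto simp: AE_count_space complex_nonneg_Reals_iff)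
    finally show "matrix_op R A f i \<in> \<real>\<^sub>\<ge>\<^sub>0" using int(2)[OF f(1) i] by simp
  qed
  ultimately show ?thesis by (auto simp: positive_kernel_operator_def)
qed

section \<open>Positive resolvents\<close>

text \<open>
  \<open>S\<close> is a two-sided inverse of \<open>z - T\<close>; the spectrum consists of the points without such an \<open>S\<close>.
\<close>

definition resolvent_at :: "'a measure \<Rightarrow> 'a operator \<Rightarrow> complex \<Rightarrow> 'a operator \<Rightarrow> bool" where
  "resolvent_at M T z S \<longleftrightarrow> bounded_operator M S \<and>
     (\<forall>f \<in> L2 M. (AE x in M. S (\<lambda>y. z * f y - T f y) x = f x) \<and>
                 (AE x in M. z * S f x - T (S f) x = f x))"

lemma op_spectrum_iff: "z \<in> op_spectrum M T \<longleftrightarrow> \<not> (\<exists>S. resolvent_at M T z S)"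
  by (simp add: op_spectrum_def resolvent_at_def)

lemma bounded_operatorD:
  assumes "bounded_operator M T"
  shows "f \<in> L2 M \<Longrightarrow> T f \<in> L2 M"
    "f \<in> L2 M \<Longrightarrow> g \<in> L2 M \<Longrightarrow> AE x in M. T (\<lambda>y. a * f y + b * g y) x = a * T f x + b * T g x"
    "\<exists>C\<ge>0. \<forall>f\<in>L2 M. L2_norm M (T f) \<le> C * L2_norm M f"
proof -
  obtain C where C: "\<forall>f\<in>L2 M. L2_norm M (T f) \<le> C * L2_norm M f"
    using assms by (auto simp: bounded_operator_def)
  have "L2_norm M (T f) \<le> \<bar>C\<bar> * L2_norm M f" if "f \<in> L2 M" for f
    using C that by (meson L2_norm_nonneg abs_ge_self mult_right_mono order_trans)
  then show "\<exists>C\<ge>0. \<forall>f\<in>L2 M. L2_norm M (T f) \<le> C * L2_norm M f"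
    by (intro exI[of _ "\<bar>C\<bar>"]) auto
qed (use assms in \<open>auto simp: bounded_operator_def\<close>)

lemma bounded_operator_cong_AE:
  assumes T: "bounded_operator M T" and f: "f \<in> L2 M" and g: "g \<in> L2 M" and eq: "AE x in M. f x = g x"
  shows "AE x in M. T f x = T g x"
proof -
  let ?h = "\<lambda>y. 1 * f y + (-1) * g y"
  have h: "?h \<in> L2 M" using f g by (rule L2_lincomb)
  have "AE x in M. ?h x = 0" using eq by eventually_elim simp
  then have "L2_norm M ?h = 0" using L2_norm_eq_0_iff[OF h] by blast
  moreover obtain C where "L2_norm M (T ?h) \<le> C * L2_norm M ?h"
    using bounded_operatorD(3)[OF T] h by blast
  ultimately have "L2_norm M (T ?h) = 0"
    by (intro antisym L2_norm_nonneg) simp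
  then have "AE x in M. T ?h x = 0"
    using L2_norm_eq_0_iff[OF bounded_operatorD(1)[OF T h]] by blast
  then show ?thesis
    using bounded_operatorD(2)[OF T f g, of 1 "-1"] by eventually_elim simp
qed

text \<open>
  The Cauchy-Schwarz inequality with the weights \<open>q\<^sup>n\<close>: it replaces the triangle inequality for countable
  sums at the price of the constant.
\<close>

lemma sq_norm_suminf_le:
  fixes a :: "nat \<Rightarrow> 'a \<Rightarrow> ennreal"
  assumes [measurable]: "\<And>n. a n \<in> borel_measurable M" and q: "0 < q" "q < 1" and "0 \<le> B"
    and le: "\<And>n. sq_norm M (a n) \<le> ennreal (B * q ^ (2 * n)) * N"
  shows "sq_norm M (\<lambda>x. \<Sum>n. a n x) \<le> ennreal (B / (1 - q)\<^sup>2) * N"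
proof -
  have geom: "(\<Sum>n. ennreal (q ^ n)) = ennreal (1 / (1 - q))"
    using q suminf_geometric[of q] by (subst suminf_ennreal2) (auto intro: summable_geometric)
  have cs: "(\<Sum>n. a n x)\<^sup>2 \<le> ennreal (1 / (1 - q)) * (\<Sum>n. ennreal (1 / q ^ n) * (a n x)\<^sup>2)" for x
  proof -
    let ?u = "\<lambda>n. ennreal (sqrt (q ^ n))" and ?v = "\<lambda>n. ennreal (1 / sqrt (q ^ n)) * a n x"
    have uv: "?u n * ?v n = a n x" for n
      using q by (simp add: mult.assoc[symmetric] flip: ennreal_mult)
    have u2: "(?u n)\<^sup>2 = ennreal (q ^ n)" for n
      using q by (simp add: ennreal_power)
    have v2: "(?v n)\<^sup>2 = ennreal (1 / q ^ n) * (a n x)\<^sup>2" for n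
      using q by (simp add: power_mult_distrib ennreal_power power_divide)
    show ?thesis
      using Cauchy_Schwarz_nn_integral[of ?u "count_space UNIV" ?v]
      unfolding nn_integral_count_space_nat uv u2 v2 geom by simp
  qed
  have "sq_norm M (\<lambda>x. \<Sum>n. a n x)
      \<le> (\<integral>\<^sup>+x. ennreal (1 / (1 - q)) * (\<Sum>n. ennreal (1 / q ^ n) * (a n x)\<^sup>2) \<partial>M)"
    unfolding sq_norm_def using cs by (intro nn_integral_mono) auto
  also have "\<dots> = ennreal (1 / (1 - q)) * (\<Sum>n. ennreal (1 / q ^ n) * sq_norm M (a n))"
    unfolding sq_norm_def by (subst nn_integral_cmult, measurable, subst nn_integral_suminf) (auto simp: nn_integral_cmult)
  also have "\<dots> \<le> ennreal (1 / (1 - q)) * (\<Sum>n. ennreal B * N * ennreal (q ^ n))"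
  proof (intro mult_left_mono suminf_le allI)
    fix n
    have "ennreal (1 / q ^ n) * sq_norm M (a n) \<le> ennreal (1 / q ^ n) * (ennreal (B * q ^ (2 * n)) * N)"
      by (intro mult_left_mono le) simp
    also have "\<dots> = ennreal (1 / q ^ n * (B * q ^ (2 * n))) * N"
      using q \<open>0 \<le> B\<close> by (subst ennreal_mult) (simp_all add: mult.assoc)
    also have "1 / q ^ n * (B * q ^ (2 * n)) = B * q ^ n"
      using q by (simp add: mult_2 power_add)
    also have "ennreal (B * q ^ n) * N = ennreal B * N * ennreal (q ^ n)"
      using q \<open>0 \<le> B\<close> by (simp add: ennreal_mult mult_ac)
    finally show "ennreal (1 / q ^ n) * sq_norm M (a n) \<le> ennreal B * N * ennreal (q ^ n)" .
  qed auto
  also have "\<dots> = ennreal (1 / (1 - q)) * (ennreal B * N * ennreal (1 / (1 - q)))"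
    by (simp add: ennreal_suminf_cmult geom)
  also have "\<dots> = ennreal (1 / (1 - q) * B * (1 / (1 - q))) * N"
    using q \<open>0 \<le> B\<close> by (simp add: ennreal_mult[symmetric] mult_ac)
  finally show ?thesis using q by (simp add: power2_eq_square)
qed

text \<open>
  The map that sends \<open>z\<close> to the maximum of \<open>0\<close> and its real part is the nearest-point projection onto the
  nonnegative half-line.
\<close>

lemma projection_nonneg_le:
  fixes z p e :: complex
  assumes "z = p + e" "p \<in> \<real>\<^sub>\<ge>\<^sub>0"
  shows "cmod (z - complex_of_real (max 0 (Re z))) \<le> cmod e"
proof (cases "0 \<le> Re z")
  case True
  then have "cmod (z - complex_of_real (max 0 (Re z))) = \<bar>Im z\<bar>"
    by (simp add: cmod_def)
  also have "\<dots> = \<bar>Im e\<bar>" using assms by (auto simp: complex_nonneg_Reals_iff)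
  also have "\<dots> \<le> cmod e" by (rule abs_Im_le_cmod)
  finally show ?thesis .
next
  case False
  then have "\<bar>Re z\<bar> \<le> \<bar>Re e\<bar>" "Im z = Im e" using assms by (auto simp: complex_nonneg_Reals_iff)
  then have "(Re z)\<^sup>2 + (Im z)\<^sup>2 \<le> (Re e)\<^sup>2 + (Im e)\<^sup>2"
    unfolding abs_le_square_iff by simp
  with False show ?thesis by (simp add: cmod_def)
qed

text \<open>
  Let \<open>p\<close> be the pointwise projection of \<open>g\<close> to the nonnegative half-line and \<open>\<eta> = g - p\<close>.  Then
  \<open>g = (h + B p) + B \<eta>\<close> with a nonnegative bracket, so that \<open>|\<eta>| \<le> |B \<eta>|\<close> pointwise; as \<open>B\<close> is a contraction, \<open>\<eta>\<close>
  vanishes.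
\<close>

lemma positive_fixpoint_nonneg:
  assumes B: "bounded_operator M B" "positive_operator M B"
    and q: "q < 1" "\<And>f. f \<in> L2 M \<Longrightarrow> L2_norm M (B f) \<le> q * L2_norm M f"
    and g: "g \<in> L2 M" and h: "AE x in M. h x \<in> \<real>\<^sub>\<ge>\<^sub>0" and eq: "AE x in M. g x = h x + B g x"
  shows "AE x in M. g x \<in> \<real>\<^sub>\<ge>\<^sub>0"
proof -
  note [measurable] = L2_measurable[OF g]
  define p where "p = (\<lambda>x. complex_of_real (max 0 (Re (g x))))"
  have p: "p \<in> L2 M"
  proof (rule L2_dominated(1)[OF g])
    show "p \<in> borel_measurable M" unfolding p_def by measurable
    have "cmod (p x) \<le> cmod (g x)" for x
      using abs_Re_le_cmod[of "g x"] by (auto simp: p_def max_def)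
    then show "AE x in M. cmod (p x) \<le> cmod (g x)" by simp
  qed
  define \<eta> where "\<eta> = (\<lambda>x. 1 * g x + (-1) * p x)"
  have \<eta>: "\<eta> \<in> L2 M" unfolding \<eta>_def using g p by (rule L2_lincomb)
  have g_eq: "g = (\<lambda>x. 1 * p x + 1 * \<eta> x)" by (simp add: \<eta>_def)
  have "AE x in M. p x \<in> \<real>\<^sub>\<ge>\<^sub>0" by (intro AE_I2) (simp add: p_def)
  then have "AE x in M. B p x \<in> \<real>\<^sub>\<ge>\<^sub>0"
    by (rule bspec[OF B(2)[unfolded positive_operator_def] p, THEN mp])
  moreover have "AE x in M. B g x = 1 * B p x + 1 * B \<eta> x"
    using bounded_operatorD(2)[OF B(1) p \<eta>, of 1 1] unfolding g_eq[symmetric] .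
  ultimately have "AE x in M. cmod (\<eta> x) \<le> cmod (B \<eta> x)"
    using h eq
  proof eventually_elim
    case (elim x)
    have "g x = (h x + B p x) + B \<eta> x" using elim by simp
    from projection_nonneg_le[OF this] show ?case
      using elim by (simp add: \<eta>_def p_def)
  qed
  then have "L2_norm M \<eta> \<le> L2_norm M (B \<eta>)"
    by (rule L2_dominated(2)[OF bounded_operatorD(1)[OF B(1) \<eta>] L2_measurable[OF \<eta>]])
  also have "\<dots> \<le> q * L2_norm M \<eta>" by (rule q(2)[OF \<eta>])
  finally have "(1 - q) * L2_norm M \<eta> \<le> 0" by (simp add: algebra_simps)
  then have "L2_norm M \<eta> = 0"
    using q(1) L2_norm_nonneg[of M \<eta>] by (simp add: mult_le_0_iff)
  then have "AE x in M. \<eta> x = 0" by (simp add: L2_norm_eq_0_iff[OF \<eta>])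
  then have "AE x in M. g x = complex_of_real (max 0 (Re (g x)))"
    by eventually_elim (simp add: \<eta>_def p_def)
  then show ?thesis
    by (rule eventually_mono) (metis nonneg_Reals_of_real_iff max.cobounded1)
qed

lemma bounded_operator_cmult:
  assumes T: "bounded_operator M T"
  shows "bounded_operator M (\<lambda>f x. a * T f x)"
proof -
  obtain C where C: "0 \<le> C" "\<forall>f\<in>L2 M. L2_norm M (T f) \<le> C * L2_norm M f"
    using bounded_operatorD(3)[OF T] by blast
  have "L2_norm M (\<lambda>x. a * T f x) \<le> (cmod a * C) * L2_norm M f" if "f \<in> L2 M" for f
    using C that by (simp add: L2_norm_cmult mult.assoc mult_left_mono)
  moreover have "AE x in M. a * T (\<lambda>y. b * f y + c * g y) x = b * (a * T f x) + c * (a * T g x)"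
    if "f \<in> L2 M" "g \<in> L2 M" for f g b c
    using bounded_operatorD(2)[OF T that, of b c] by eventually_elim (simp add: algebra_simps)
  ultimately show ?thesis
    unfolding bounded_operator_def using bounded_operatorD(1)[OF T] by (blast intro: L2_cmult)
qed

lemma positive_operator_cmult:
  assumes T: "positive_operator M T" and "0 \<le> a"
  shows "positive_operator M (\<lambda>f x. complex_of_real a * T f x)"
  unfolding positive_operator_def
proof (intro ballI impI)
  fix f assume f: "f \<in> L2 M" "AE x in M. f x \<in> \<real>\<^sub>\<ge>\<^sub>0"
  have "AE x in M. T f x \<in> \<real>\<^sub>\<ge>\<^sub>0"
    by (rule bspec[OF T[unfolded positive_operator_def] f(1), THEN mp, OF f(2)])
  then show "AE x in M. complex_of_real a * T f x \<in> \<real>\<^sub>\<ge>\<^sub>0"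
    by (rule eventually_mono) (use \<open>0 \<le> a\<close> in \<open>intro nonneg_Reals_mult_I; simp\<close>)
qed

text \<open>
  The function \<open>g = S f\<close> satisfies \<open>g = f / l + (T / l) g\<close>, and \<open>T / l\<close> is a positive contraction.
\<close>

lemma resolvent_positive_large:
  assumes T: "bounded_operator M T" "positive_operator M T"
    and C: "\<And>f. f \<in> L2 M \<Longrightarrow> L2_norm M (T f) \<le> C * L2_norm M f" and "0 \<le> C" "C < l"
    and S: "resolvent_at M T (complex_of_real l) S"
  shows "positive_operator M S"
  unfolding positive_operator_def
proof (intro ballI impI)
  fix f assume f: "f \<in> L2 M" "AE x in M. f x \<in> \<real>\<^sub>\<ge>\<^sub>0"
  have l: "0 < l" using \<open>0 \<le> C\<close> \<open>C < l\<close> by simp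
  have S_bdd: "bounded_operator M S" using S by (simp add: resolvent_at_def)
  let ?a = "complex_of_real (1 / l)"
  show "AE x in M. S f x \<in> \<real>\<^sub>\<ge>\<^sub>0"
  proof (rule positive_fixpoint_nonneg)
    show "bounded_operator M (\<lambda>f x. ?a * T f x)" by (rule bounded_operator_cmult[OF T(1)])
    show "positive_operator M (\<lambda>f x. ?a * T f x)" using l by (intro positive_operator_cmult[OF T(2)]) simp
    show "C / l < 1" using \<open>C < l\<close> l by simp
    show "L2_norm M (\<lambda>x. ?a * T f x) \<le> C / l * L2_norm M f" if "f \<in> L2 M" for f
      using C[OF that] l unfolding L2_norm_cmult norm_of_real by (simp add: divide_right_mono)
    show "S f \<in> L2 M" by (rule bounded_operatorD(1)[OF S_bdd f(1)])
    show "AE x in M. ?a * f x \<in> \<real>\<^sub>\<ge>\<^sub>0"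
      using f(2) by eventually_elim (use l in \<open>intro nonneg_Reals_mult_I; simp\<close>)
    have "AE x in M. complex_of_real l * S f x - T (S f) x = f x"
      using S f(1) by (simp add: resolvent_at_def)
    then show "AE x in M. S f x = ?a * f x + ?a * T (S f) x"
      by eventually_elim (use l in \<open>simp add: field_simps\<close>)
  qed
qed

lemma resolvent_identity:
  assumes T: "bounded_operator M T" and S: "resolvent_at M T z S" and S': "resolvent_at M T z' S'" and f: "f \<in> L2 M"
  shows "AE x in M. S' f x = S f x + (z - z') * S (S' f) x"
proof -
  have bS: "bounded_operator M S" "bounded_operator M S'" using S S' by (auto simp: resolvent_at_def)
  let ?g = "S' f"
  have g: "?g \<in> L2 M" by (rule bounded_operatorD(1)[OF bS(2) f])
  have m1: "(\<lambda>y. z * ?g y - T ?g y) \<in> L2 M"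
    using L2_lincomb[OF g bounded_operatorD(1)[OF T g], of z "-1"] by simp
  have m2: "(\<lambda>y. 1 * f y + (z - z') * ?g y) \<in> L2 M" by (rule L2_lincomb[OF f g])
  have "AE x in M. z' * ?g x - T ?g x = f x" using S' f by (simp add: resolvent_at_def)
  then have "AE x in M. z * ?g x - T ?g x = 1 * f x + (z - z') * ?g x"
    by eventually_elim (simp add: algebra_simps)
  then have "AE x in M. S (\<lambda>y. z * ?g y - T ?g y) x = S (\<lambda>y. 1 * f y + (z - z') * ?g y) x"
    by (rule bounded_operator_cong_AE[OF bS(1) m1 m2])
  moreover have "AE x in M. S (\<lambda>y. z * ?g y - T ?g y) x = ?g x" using S g by (simp add: resolvent_at_def)
  moreover note bounded_operatorD(2)[OF bS(1) f g, of 1 "z - z'"]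
  ultimately show ?thesis by eventually_elim simp
qed

text \<open>
  By the resolvent identity \<open>g = S' f\<close> satisfies \<open>g = S f + (l - l') S g\<close>; if \<open>l'\<close> is close to \<open>l\<close>, then
  \<open>(l - l') S\<close> is a positive contraction.
\<close>

lemma resolvent_positive_step:
  assumes T: "bounded_operator M T"
    and S: "resolvent_at M T (complex_of_real l) S" "positive_operator M S"
    and C: "\<And>f. f \<in> L2 M \<Longrightarrow> L2_norm M (S f) \<le> C * L2_norm M f"
    and S': "resolvent_at M T (complex_of_real l') S'" and l: "l' \<le> l" "(l - l') * C < 1"
  shows "positive_operator M S'"
  unfolding positive_operator_def
proof (intro ballI impI)
  fix f assume f: "f \<in> L2 M" "AE x in M. f x \<in> \<real>\<^sub>\<ge>\<^sub>0"
  have bS: "bounded_operator M S" "bounded_operator M S'" using S S' by (auto simp: resolvent_at_def)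
  let ?a = "complex_of_real (l - l')"
  show "AE x in M. S' f x \<in> \<real>\<^sub>\<ge>\<^sub>0"
  proof (rule positive_fixpoint_nonneg)
    show "bounded_operator M (\<lambda>f x. ?a * S f x)" by (rule bounded_operator_cmult[OF bS(1)])
    show "positive_operator M (\<lambda>f x. ?a * S f x)" using l by (intro positive_operator_cmult[OF S(2)]) simp
    show "(l - l') * C < 1" by (rule l)
    show "L2_norm M (\<lambda>x. ?a * S f x) \<le> (l - l') * C * L2_norm M f" if "f \<in> L2 M" for f
      using C[OF that] l unfolding L2_norm_cmult norm_of_real by (simp add: mult.assoc mult_left_mono)
    show "S' f \<in> L2 M" by (rule bounded_operatorD(1)[OF bS(2) f(1)])
    show "AE x in M. S f x \<in> \<real>\<^sub>\<ge>\<^sub>0"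
      by (rule bspec[OF S(2)[unfolded positive_operator_def] f(1), THEN mp, OF f(2)])
    show "AE x in M. S' f x = S f x + ?a * S (S' f) x"
      using resolvent_identity[OF T S(1) S' f(1)] by simp
  qed
qed

lemma resolvent_bound_near:
  assumes T: "bounded_operator M T"
    and S: "resolvent_at M T (complex_of_real l) S" and S': "resolvent_at M T (complex_of_real l') S'"
    and C: "\<And>f. f \<in> L2 M \<Longrightarrow> L2_norm M (S f) \<le> C * L2_norm M f"
    and l: "\<bar>l - l'\<bar> * C \<le> 1 / 2" and f: "f \<in> L2 M"
  shows "L2_norm M (S' f) \<le> 2 * C * L2_norm M f"
proof -
  have bS: "bounded_operator M S" "bounded_operator M S'" using S S' by (auto simp: resolvent_at_def)
  let ?a = "complex_of_real (l - l')"
  have g: "S' f \<in> L2 M" and Sf: "S f \<in> L2 M" and Sg: "S (S' f) \<in> L2 M"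
    using bounded_operatorD(1)[OF bS(1)] bounded_operatorD(1)[OF bS(2)] f by auto
  have h: "(\<lambda>x. ?a * S (S' f) x) \<in> L2 M" by (rule L2_cmult[OF Sg])
  have "L2_norm M (S' f) = L2_norm M (\<lambda>x. S f x + ?a * S (S' f) x)"
    using resolvent_identity[OF T S S' f] g L2_add_triangle(1)[OF Sf h]
    by (intro L2_norm_cong_AE L2_measurable) simp_all
  also have "\<dots> \<le> L2_norm M (S f) + \<bar>l - l'\<bar> * L2_norm M (S (S' f))"
    using L2_add_triangle(2)[OF Sf h] by (simp only: L2_norm_cmult norm_of_real)
  also have "\<dots> \<le> C * L2_norm M f + \<bar>l - l'\<bar> * (C * L2_norm M (S' f))"
    by (intro add_mono mult_left_mono C f g) simp
  also have "\<dots> \<le> C * L2_norm M f + 1 / 2 * L2_norm M (S' f)"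
    using mult_right_mono[OF l, of "L2_norm M (S' f)"] by (simp add: mult.assoc)
  finally show ?thesis by simp
qed

text \<open>
  Consider the infimum of the points to the right of \<open>r\<close> with a positive resolvent.  If it were larger
  than \<open>r\<close>, the resolvents near it would be uniformly bounded by \<open>resolvent_bound_near\<close>, and a step of
  \<open>resolvent_positive_step\<close> from a point slightly to its right would lead to a point on its left.
\<close>

lemma exists_positive_resolvent_near:
  assumes T: "bounded_operator M T" "positive_operator M T"
    and res: "\<And>l. r < l \<Longrightarrow> \<exists>S. resolvent_at M T (complex_of_real l) S" and "r < \<rho>"
  shows "\<exists>l S. r < l \<and> l < \<rho> \<and> resolvent_at M T (complex_of_real l) S \<and> positive_operator M S"
proof -
  define L where "L = {l. r < l \<and> (\<exists>S. resolvent_at M T (complex_of_real l) S \<and> positive_operator M S)}"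
  obtain C where C: "0 \<le> C" "\<And>f. f \<in> L2 M \<Longrightarrow> L2_norm M (T f) \<le> C * L2_norm M f"
    using bounded_operatorD(3)[OF T(1)] by blast
  have "max r C + 1 \<in> L"
  proof -
    obtain S where S: "resolvent_at M T (complex_of_real (max r C + 1)) S"
      using res[of "max r C + 1"] by (meson less_add_one max.strict_coboundedI1 max.cobounded1 order_le_less_trans)
    moreover have "positive_operator M S"
      by (rule resolvent_positive_large[OF T C(2,1) _ S]) simp_all
    ultimately show ?thesis by (auto simp: L_def)
  qed
  then have ne: "L \<noteq> {}" by auto
  have bdd: "bdd_below L" by (rule bdd_belowI[of _ r]) (auto simp: L_def)
  have "Inf L \<le> r"
  proof (rule ccontr)
    assume "\<not> Inf L \<le> r"
    then have r: "r < Inf L" by simp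
    then obtain S0 where S0: "resolvent_at M T (complex_of_real (Inf L)) S0" using res by blast
    then obtain D where D: "0 \<le> D" "\<And>f. f \<in> L2 M \<Longrightarrow> L2_norm M (S0 f) \<le> D * L2_norm M f"
      using bounded_operatorD(3)[of M S0] by (auto simp: resolvent_at_def)
    \<comment> \<open>Resolvents within \<open>d\<close> of the infimum have norm at most \<open>2 D\<close>, and a step of length \<open>2 d\<close> is then short enough.\<close>
    define d where "d = 1 / (8 * (D + 1))"
    have d: "0 < d" using D by (simp add: d_def)
    have dD: "d * D \<le> 1 / 8" using D by (simp add: d_def field_simps)
    obtain l where l: "l \<in> L" "l < Inf L + d"
      using cInf_lessD[OF ne, of "Inf L + d"] d by auto
    then obtain S where S: "resolvent_at M T (complex_of_real l) S" "positive_operator M S" by (auto simp: L_def)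
    have l_ge: "Inf L \<le> l" by (rule cInf_lower[OF l(1) bdd])
    have "\<bar>Inf L - l\<bar> * D \<le> d * D" using l l_ge D by (intro mult_right_mono) auto
    then have SD: "L2_norm M (S f) \<le> (2 * D) * L2_norm M f" if "f \<in> L2 M" for f
      using dD that by (intro resolvent_bound_near[OF T(1) S0 S(1) D(2)]) auto
    define l' where "l' = max ((r + Inf L) / 2) (Inf L - d)"
    have l': "r < l'" "l' < Inf L" using r d by (auto simp: l'_def max_def field_simps)
    obtain S' where S': "resolvent_at M T (complex_of_real l') S'" using res[OF l'(1)] by blast
    have "(l - l') * (2 * D) \<le> (2 * d) * (2 * D)"
      using l D by (intro mult_right_mono) (auto simp: l'_def)
    also have "\<dots> < 1" using dD by simp
    finally have "positive_operator M S'"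
      using l' l_ge by (intro resolvent_positive_step[OF T(1) S SD S']) auto
    with S' l'(1) have "l' \<in> L" by (auto simp: L_def)
    then have "Inf L \<le> l'" by (rule cInf_lower[OF _ bdd])
    with l' show False by simp
  qed
  then obtain l where "l \<in> L" "l < \<rho>"
    using cInf_lessD[OF ne, of \<rho>] \<open>r < \<rho>\<close> by auto
  then show ?thesis by (auto simp: L_def)
qed

section \<open>The spectral radius as the growth rate of iterates\<close>

context sigma_finite_measure
begin

lemma acts_funpow_linear:
  assumes T: "acts M T K" and f: "f \<in> L2 M" and g: "g \<in> L2 M"
  shows "AE x in M. (T ^^ n) (\<lambda>y. a * f y + b * g y) x = a * (T ^^ n) f x + b * (T ^^ n) g x"
proof (induction n)
  case (Suc n)
  note L = acts_funpow(1)[OF T]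
  have "AE x in M. T ((T ^^ n) (\<lambda>y. a * f y + b * g y)) x = T (\<lambda>y. a * (T ^^ n) f y + b * (T ^^ n) g y) x"
    by (rule acts_cong_AE[OF T L L2_lincomb[OF L L] Suc]) (intro L2_lincomb f g)+
  then show ?case
    using L2_linearD(2)[OF actsD(3)[OF T] acts_funpow(1)[OF T f, of n] acts_funpow(1)[OF T g, of n], of a b] by eventually_elim simp
qed simp

text \<open>
  The resolvent is the Neumann series, summed pointwise: the series of the kernel iterates of \<open>|f|\<close> is
  square-integrable and dominates it.  The same dominating series permits the interchange of sum and
  integral by which \<open>T\<close> is applied term by term.
\<close>

lemma neumann_resolvent:
  assumes T: "acts M T K" and growth: "kernel_growth M K \<rho>" and "0 < \<rho>" and z: "\<rho> < cmod z"
  shows "\<exists>S. resolvent_at M T z S"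
proof -
  note K = actsD(1)[OF T]
  obtain C where C: "0 \<le> C" "\<And>n f. f \<in> borel_measurable M \<Longrightarrow>
      sq_norm M ((kernel_apply M K ^^ n) f) \<le> ennreal (C * \<rho> ^ (2 * n)) * sq_norm M f"
    using growth by (auto simp: kernel_growth_def)
  have z0: "0 < cmod z" "z \<noteq> 0" using z \<open>0 < \<rho>\<close> by auto
  define c where "c n = 1 / z ^ Suc n" for n
  have c_norm: "cmod (c n) = 1 / cmod z ^ Suc n" for n by (simp add: c_def norm_divide norm_power norm_mult)
  define S where "S f x = (\<Sum>n. c n * (T ^^ n) f x)" for f x
  \<comment> \<open>The terms of the series have square norm at most \<open>B q\<^sup>2\<^sup>n\<close> times that of \<open>f\<close>.\<close>
  define q B where "q = \<rho> / cmod z" and "B = C / (cmod z)\<^sup>2"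
  have q: "0 < q" "q < 1" and B: "0 \<le> B" using z z0 \<open>0 < \<rho>\<close> C(1) by (auto simp: q_def B_def)
  define a where "a f n x = ennreal (cmod (c n)) * (kernel_apply M K ^^ n) (\<lambda>y. ennreal (cmod (f y))) x" for f n x
  define D where "D = B / (1 - q)\<^sup>2"
  have D: "0 \<le> D" using B by (simp add: D_def)
  note L = acts_funpow(1)[OF T]
  have a_meas: "a f n \<in> borel_measurable M" if "f \<in> L2 M" for f n
  proof -
    have "(\<lambda>y. ennreal (cmod (f y))) \<in> borel_measurable M" using L2_measurable[OF that] by measurable
    from funpow_kernel_apply_measurable[OF K this] show ?thesis unfolding a_def by measurable
  qed
  define G where "G f x = (\<Sum>n. a f n x)" for f x
  have G_meas: "G f \<in> borel_measurable M" if "f \<in> L2 M" for f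
    unfolding G_def using a_meas[OF that] by measurable
  have sq_G: "sq_norm M (G f) \<le> ennreal (D * (L2_norm M f)\<^sup>2)" if f: "f \<in> L2 M" for f
  proof -
    have fm: "(\<lambda>y. ennreal (cmod (f y))) \<in> borel_measurable M" using L2_measurable[OF f] by measurable
    have "sq_norm M (a f n) \<le> ennreal (B * q ^ (2 * n)) * sq_norm M (\<lambda>y. ennreal (cmod (f y)))" for n
    proof -
      have "sq_norm M (a f n) = (ennreal (cmod (c n)))\<^sup>2 * sq_norm M ((kernel_apply M K ^^ n) (\<lambda>y. ennreal (cmod (f y))))"
        unfolding a_def by (rule sq_norm_cmult[OF funpow_kernel_apply_measurable[OF K fm]])
      also have "\<dots> \<le> (ennreal (cmod (c n)))\<^sup>2 * (ennreal (C * \<rho> ^ (2 * n)) * sq_norm M (\<lambda>y. ennreal (cmod (f y))))"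
        by (intro mult_left_mono C(2) fm) simp
      also have "\<dots> = ennreal ((cmod (c n))\<^sup>2 * (C * \<rho> ^ (2 * n))) * sq_norm M (\<lambda>y. ennreal (cmod (f y)))"
        using C(1) \<open>0 < \<rho>\<close> by (subst ennreal_mult) (simp_all add: ennreal_power mult.assoc)
      also have "(cmod (c n))\<^sup>2 * (C * \<rho> ^ (2 * n)) = B * q ^ (2 * n)"
        unfolding c_norm B_def q_def by (simp add: power_divide power_mult power_mult_distrib power2_eq_square)
      finally show ?thesis .
    qed
    from sq_norm_suminf_le[OF a_meas[OF f] q B this]
    show ?thesis using D by (simp add: G_def[abs_def] D_def[symmetric] sq_norm_cmod[OF f] ennreal_mult)
  qed
  have G_fin: "AE x in M. G f x < top" if f: "f \<in> L2 M" for f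
  proof -
    have "(\<integral>\<^sup>+x. (G f x)\<^sup>2 \<partial>M) \<noteq> \<infinity>"
      using sq_G[OF f] by (auto simp: sq_norm_def top_unique)
    then have "AE x in M. (G f x)\<^sup>2 \<noteq> \<infinity>"
      using G_meas[OF f] by (intro nn_integral_PInf_AE) auto
    then show ?thesis
    proof eventually_elim
      case (elim x)
      then have "G f x \<noteq> top" by (intro notI) simp
      then show ?case by (simp add: less_top)
    qed
  qed
  have dom: "AE x in M. \<forall>n. ennreal (cmod (c n * (T ^^ n) f x)) \<le> a f n x" if f: "f \<in> L2 M" for f
    unfolding AE_all_countable
  proof
    fix n
    show "AE x in M. ennreal (cmod (c n * (T ^^ n) f x)) \<le> a f n x"
      using acts_funpow(2)[OF T f, of n]
      by eventually_elim (simp add: a_def norm_mult ennreal_mult mult_left_mono)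
  qed
  have summ: "AE x in M. summable (\<lambda>n. cmod (c n * (T ^^ n) f x)) \<and> ennreal (cmod (S f x)) \<le> G f x"
    if f: "f \<in> L2 M" for f
    using dom[OF f] G_fin[OF f]
  proof eventually_elim
    case (elim x)
    have le: "(\<Sum>n. ennreal (cmod (c n * (T ^^ n) f x))) \<le> G f x"
      unfolding G_def using elim by (intro suminf_le) auto
    then have s: "summable (\<lambda>n. cmod (c n * (T ^^ n) f x))"
      using elim by (intro summable_suminf_not_top) auto
    have "ennreal (cmod (S f x)) \<le> ennreal (\<Sum>n. cmod (c n * (T ^^ n) f x))"
      unfolding S_def by (intro ennreal_leI summable_norm s)
    also have "\<dots> = (\<Sum>n. ennreal (cmod (c n * (T ^^ n) f x)))"
      using s by (intro suminf_ennreal2[symmetric]) auto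
    finally show ?case using s le by simp
  qed
  have S_meas: "S f \<in> borel_measurable M" if f: "f \<in> L2 M" for f
    unfolding S_def using L2_measurable[OF L[OF f]] by measurable
  have S_sq: "sq_norm M (\<lambda>x. ennreal (cmod (S f x))) \<le> ennreal (D * (L2_norm M f)\<^sup>2)" if f: "f \<in> L2 M" for f
  proof -
    have "AE x in M. ennreal (cmod (S f x)) \<le> G f x" using summ[OF f] by eventually_elim simp
    from sq_norm_mono_AE[OF this] show ?thesis using sq_G[OF f] by (rule order_trans)
  qed
  have S_L2: "S f \<in> L2 M" if f: "f \<in> L2 M" for f
    using S_meas[OF f] S_sq[OF f] by (auto simp: L2_iff intro: order_le_less_trans)
  have S_bdd: "bounded_operator M S"
    unfolding bounded_operator_def
  proof (intro conjI ballI allI)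
    show "S f \<in> L2 M" if "f \<in> L2 M" for f by (rule S_L2[OF that])
    have "L2_norm M (S f) \<le> sqrt D * L2_norm M f" if f: "f \<in> L2 M" for f
    proof -
      have "(L2_norm M (S f))\<^sup>2 \<le> D * (L2_norm M f)\<^sup>2"
        using S_sq[OF f] D by (simp add: sq_norm_cmod[OF S_L2[OF f]] ennreal_le_iff)
      then have "L2_norm M (S f) \<le> sqrt (D * (L2_norm M f)\<^sup>2)" by (rule real_le_rsqrt)
      then show ?thesis by (simp add: real_sqrt_mult)
    qed
    then show "\<exists>E. \<forall>f\<in>L2 M. L2_norm M (S f) \<le> E * L2_norm M f" by blast
    fix f g \<alpha> \<beta> assume f: "f \<in> L2 M" and g: "g \<in> L2 M"
    have "AE x in M. \<forall>n. (T ^^ n) (\<lambda>y. \<alpha> * f y + \<beta> * g y) x = \<alpha> * (T ^^ n) f x + \<beta> * (T ^^ n) g x"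
      unfolding AE_all_countable using acts_funpow_linear[OF T f g] by blast
    then show "AE x in M. S (\<lambda>y. \<alpha> * f y + \<beta> * g y) x = \<alpha> * S f x + \<beta> * S g x"
      using summ[OF f] summ[OF g]
    proof eventually_elim
      case (elim x)
      have s: "summable (\<lambda>n. c n * (T ^^ n) f x)" "summable (\<lambda>n. c n * (T ^^ n) g x)"
        using elim by (auto intro: summable_norm_cancel)
      have "S (\<lambda>y. \<alpha> * f y + \<beta> * g y) x = (\<Sum>n. \<alpha> * (c n * (T ^^ n) f x) + \<beta> * (c n * (T ^^ n) g x))"
        using elim(1) by (simp add: S_def algebra_simps)
      also have "\<dots> = \<alpha> * S f x + \<beta> * S g x"
        unfolding S_def using s
        by (simp add: suminf_add[symmetric] suminf_mult summable_mult)
      finally show ?case .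
    qed
  qed
  have TS: "AE x in M. T (S f) x = (\<Sum>n. c n * (T ^^ Suc n) f x)
      \<and> summable (\<lambda>n. c n * (T ^^ Suc n) f x)" if f: "f \<in> L2 M" for f
  proof -
    let ?k = "\<lambda>x y. complex_of_real (enn2real (K x y))"
    have hk: "AE x in M. T h x = kernel_op M ?k h x" "AE x in M. integrable M (\<lambda>y. ?k x y * h y)" if "h \<in> L2 M" for h
      using acts_has_kernel[OF T] that by (auto simp: has_kernel_def)
    have A1: "AE x in M. \<forall>n. T ((T ^^ n) f) x = kernel_op M ?k ((T ^^ n) f) x \<and> integrable M (\<lambda>y. ?k x y * (T ^^ n) f y)"
      unfolding AE_all_countable
    proof
      fix n
      show "AE x in M. T ((T ^^ n) f) x = kernel_op M ?k ((T ^^ n) f) x \<and> integrable M (\<lambda>y. ?k x y * (T ^^ n) f y)"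
        using hk[OF L[OF f, of n]] by eventually_elim simp
    qed
    obtain d where d: "kernel_bound M K d" using actsD(2)[OF T] by auto
    have "sq_norm M (G f) < top" using sq_G[OF f] by (rule order_le_less_trans) simp
    note KG = kernel_apply_AE_finite(1)[OF K G_meas[OF f] d this]
    show ?thesis
      using A1 hk(1)[OF S_L2[OF f]] KG AE_space
    proof eventually_elim
      case (elim x)
      note [measurable] = elim(4) K a_meas[OF f]
      let ?t = "\<lambda>n y. c n * (?k x y * (T ^^ n) f y)"
      have int: "integrable M (?t n)" for n using elim(1) by simp
      have sum1: "AE y in M. summable (\<lambda>n. norm (?t n y))"
        using summ[OF f]
      proof eventually_elim
        case (elim y)
        then have "summable (\<lambda>n. enn2real (K x y) * cmod (c n * (T ^^ n) f y))"
          by (intro summable_mult) simp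
        then show ?case by (simp add: norm_mult mult_ac)
      qed
      have nn: "ennreal (\<integral>y. norm (?t n y) \<partial>M) \<le> (\<integral>\<^sup>+y. K x y * a f n y \<partial>M)" for n
      proof -
        have "ennreal (\<integral>y. norm (?t n y) \<partial>M) = (\<integral>\<^sup>+y. ennreal (norm (?t n y)) \<partial>M)"
          by (intro nn_integral_eq_integral[symmetric] integrable_norm int) auto
        also have "\<dots> \<le> (\<integral>\<^sup>+y. K x y * a f n y \<partial>M)"
        proof (rule nn_integral_mono_AE)
          show "AE y in M. ennreal (norm (?t n y)) \<le> K x y * a f n y"
            using dom[OF f]
          proof eventually_elim
            case (elim y)
            have "ennreal (norm (?t n y)) = ennreal (enn2real (K x y)) * ennreal (cmod (c n * (T ^^ n) f y))"
              by (simp add: norm_mult ennreal_mult mult_ac)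
            also have "\<dots> \<le> K x y * a f n y"
              using elim by (intro mult_mono) (cases "K x y"; auto)+
            finally show ?case .
          qed
        qed
        finally show ?thesis .
      qed
      have "(\<Sum>n. ennreal (\<integral>y. norm (?t n y) \<partial>M)) \<le> (\<Sum>n. \<integral>\<^sup>+y. K x y * a f n y \<partial>M)"
        by (intro suminf_le nn) auto
      also have "\<dots> = (\<integral>\<^sup>+y. (\<Sum>n. K x y * a f n y) \<partial>M)"
        by (rule nn_integral_suminf[symmetric]) measurable
      also have "\<dots> = kernel_apply M K (G f) x"
        by (simp add: kernel_apply_def G_def ennreal_suminf_cmult)
      finally have "(\<Sum>n. ennreal (\<integral>y. norm (?t n y) \<partial>M)) < top"
        using elim(3) by (rule order_le_less_trans)
      then have sum2: "summable (\<lambda>n. \<integral>y. norm (?t n y) \<partial>M)"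
        by (intro summable_suminf_not_top) auto
      note ex = integral_suminf[OF int sum1 sum2] summable_integral[OF int sum1 sum2]
      have tn: "(\<integral>y. ?t n y \<partial>M) = c n * (T ^^ Suc n) f x" for n
        using elim(1) by (simp add: kernel_op_def)
      have "(\<integral>y. ?k x y * S f y \<partial>M) = (\<integral>y. (\<Sum>n. ?t n y) \<partial>M)"
      proof (rule integral_cong_AE)
        show "AE y in M. ?k x y * S f y = (\<Sum>n. ?t n y)"
          using summ[OF f]
        proof eventually_elim
          case (elim y)
          then have "summable (\<lambda>n. c n * (T ^^ n) f y)" by (auto intro: summable_norm_cancel)
          from suminf_mult[OF this, of "?k x y"] show ?case by (simp add: S_def mult_ac)
        qed
        show "(\<lambda>y. ?k x y * S f y) \<in> borel_measurable M" using S_meas[OF f] by measurable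
        show "(\<lambda>y. \<Sum>n. ?t n y) \<in> borel_measurable M"
          using L2_measurable[OF L[OF f]] by measurable
      qed
      with ex show ?case using elim(2) unfolding tn kernel_op_def by simp
    qed
  qed
  have main: "z * (\<Sum>n. c n * u n) - (\<Sum>n. c n * u (Suc n)) = u 0"
    if s: "summable (\<lambda>n. c n * u n)" for u :: "nat \<Rightarrow> complex"
  proof -
    have b: "summable (\<lambda>n. z * (c n * u n))" by (rule summable_mult[OF s])
    have e: "z * (c (Suc n) * u (Suc n)) = c n * u (Suc n)" for n
      using z0 by (simp add: c_def)
    have "z * (\<Sum>n. c n * u n) = (\<Sum>n. z * (c n * u n))" by (rule suminf_mult[OF s, symmetric])
    also have "\<dots> = z * (c 0 * u 0) + (\<Sum>n. z * (c (Suc n) * u (Suc n)))"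
      using suminf_split_head[OF b] by simp
    also have "\<dots> = u 0 + (\<Sum>n. c n * u (Suc n))"
      unfolding e using z0 by (simp add: c_def)
    finally show ?thesis by simp
  qed
  have "resolvent_at M T z S"
    unfolding resolvent_at_def
  proof (intro conjI ballI S_bdd)
    fix f assume f: "f \<in> L2 M"
    show "AE x in M. z * S f x - T (S f) x = f x"
      using TS[OF f] summ[OF f]
    proof eventually_elim
      case (elim x)
      then have "summable (\<lambda>n. c n * (T ^^ n) f x)" by (auto intro: summable_norm_cancel)
      from main[OF this] show ?case using elim by (simp add: S_def)
    qed
    have Tf: "T f \<in> L2 M" using L2_linearD(1)[OF actsD(3)[OF T] f] .
    have "AE x in M. \<forall>n. (T ^^ n) (\<lambda>y. z * f y + (-1) * T f y) x = z * (T ^^ n) f x + (-1) * (T ^^ n) (T f) x"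
      unfolding AE_all_countable using acts_funpow_linear[OF T f Tf] by blast
    then show "AE x in M. S (\<lambda>y. z * f y - T f y) x = f x"
      using TS[OF f] summ[OF f]
    proof eventually_elim
      case (elim x)
      have s: "summable (\<lambda>n. c n * (T ^^ n) f x)" using elim by (auto intro: summable_norm_cancel)
      have "S (\<lambda>y. z * f y - T f y) x = (\<Sum>n. z * (c n * (T ^^ n) f x) - c n * (T ^^ Suc n) f x)"
      proof -
        have "(\<lambda>y. z * f y - T f y) = (\<lambda>y. z * f y + (-1) * T f y)" by simp
        then have "S (\<lambda>y. z * f y - T f y) x = (\<Sum>n. c n * (z * (T ^^ n) f x + (-1) * (T ^^ n) (T f) x))"
          by (simp only: S_def elim(1)[rule_format])
        then show ?thesis by (simp add: funpow_swap1 right_diff_distrib mult.left_commute)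
      qed
      also have "\<dots> = (\<Sum>n. z * (c n * (T ^^ n) f x)) - (\<Sum>n. c n * (T ^^ Suc n) f x)"
        using elim by (intro suminf_diff[symmetric] summable_mult s) simp
      also have "(\<Sum>n. z * (c n * (T ^^ n) f x)) = z * (\<Sum>n. c n * (T ^^ n) f x)" by (rule suminf_mult[OF s])
      also have "z * (\<Sum>n. c n * (T ^^ n) f x) - (\<Sum>n. c n * (T ^^ Suc n) f x) = f x"
        using main[OF s] by simp
      finally show ?case .
    qed
  qed
  then show ?thesis by blast
qed

lemma spectral_radius_le_of_growth:
  assumes T: "acts M T K" and growth: "kernel_growth M K \<rho>" and "0 < \<rho>"
  shows "op_spectral_radius M T \<le> \<rho>" "z \<in> op_spectrum M T \<Longrightarrow> cmod z \<le> \<rho>"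
proof -
  show *: "cmod z \<le> \<rho>" if "z \<in> op_spectrum M T" for z
    using that neumann_resolvent[OF T growth \<open>0 < \<rho>\<close>, of z] by (auto simp: op_spectrum_iff not_less[symmetric])
  show "op_spectral_radius M T \<le> \<rho>"
    unfolding op_spectral_radius_def using * \<open>0 < \<rho>\<close> by (intro cSup_least) auto
qed

lemma kernel_growth_of_bound:
  assumes K: "kernel_measurable M K" and c: "0 < c" "kernel_bound M K c"
  shows "kernel_growth M K (sqrt c)"
  unfolding kernel_growth_def
proof (intro exI[of _ 1] conjI allI ballI)
  fix n and f :: "'a \<Rightarrow> ennreal" assume f: "f \<in> borel_measurable M"
  have "sq_norm M ((kernel_apply M K ^^ n) f) \<le> ennreal (c ^ n) * sq_norm M f"
  proof (induction n)
    case (Suc n)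
    have "sq_norm M ((kernel_apply M K ^^ Suc n) f) \<le> ennreal c * sq_norm M ((kernel_apply M K ^^ n) f)"
      using kernel_boundD(2)[OF c(2) funpow_kernel_apply_measurable[OF K f]] by simp
    also have "\<dots> \<le> ennreal c * (ennreal (c ^ n) * sq_norm M f)"
      by (intro mult_left_mono Suc) simp
    finally show ?case using c by (simp add: ennreal_mult mult.assoc)
  qed simp
  then show "sq_norm M ((kernel_apply M K ^^ n) f) \<le> ennreal (1 * sqrt c ^ (2 * n)) * sq_norm M f"
    using c by (simp add: power_mult)
qed simp

lemma spectral_radius_bdd:
  assumes T: "acts M T K"
  shows "bdd_above (insert 0 (cmod ` op_spectrum M T))" "0 \<le> op_spectral_radius M T"
proof -
  obtain c where c: "0 < c" "kernel_bound M K c" using actsD(2)[OF T] by auto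
  show b: "bdd_above (insert 0 (cmod ` op_spectrum M T))"
    using spectral_radius_le_of_growth(2)[OF T kernel_growth_of_bound[OF actsD(1)[OF T] c]] c
    by (auto intro!: bdd_aboveI[of _ "sqrt c"])
  show "0 \<le> op_spectral_radius M T"
    unfolding op_spectral_radius_def by (rule cSup_upper[OF _ b]) simp
qed

lemma acts_positive_operator:
  assumes T: "acts M T K"
  shows "positive_operator M T"
  unfolding positive_operator_def
proof (intro ballI impI)
  fix f assume f: "f \<in> L2 M" "AE x in M. f x \<in> \<real>\<^sub>\<ge>\<^sub>0"
  note [measurable] = L2_measurable[OF f(1)]
  let ?u = "\<lambda>x. max 0 (Re (f x))"
  have eq: "AE x in M. f x = complex_of_real (?u x)"
    using f(2) by eventually_elim (auto simp: complex_nonneg_Reals_iff complex_eq_iff)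
  have u0: "0 \<le> ?u x" for x by simp
  have u: "(\<lambda>x. complex_of_real (?u x)) \<in> L2 M"
  proof (rule L2_cong_AE[OF f(1)])
    show "AE x in M. complex_of_real (?u x) = f x" using eq by eventually_elim simp
  qed measurable
  show "AE x in M. T f x \<in> \<real>\<^sub>\<ge>\<^sub>0"
    using acts_cong_AE[OF T f(1) u eq] actsD(4)[OF T u0 u] by eventually_elim simp
qed

text \<open>
  Let \<open>S\<close> be a positive resolvent at a point \<open>l\<close> between the spectral radius and \<open>\<rho>\<close>.  For \<open>f \<ge> 0\<close> the function
  \<open>s = S f \<ge> 0\<close> satisfies \<open>l s - T s = f\<close>, hence \<open>f \<le> l s\<close> and \<open>T s \<le> l s\<close>; by induction
  \<open>T\<^sup>n f \<le> l\<^sup>n\<^sup>+\<^sup>1 s\<close>.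
\<close>

lemma growth_of_spectral_radius:
  assumes T: "acts M T K" and r: "op_spectral_radius M T < \<rho>"
  shows "kernel_growth M K \<rho>"
proof -
  note K = actsD(1)[OF T] and bdd = spectral_radius_bdd[OF T]
  have "\<exists>S. resolvent_at M T (complex_of_real l) S" if l: "op_spectral_radius M T < l" for l
  proof (rule ccontr)
    assume "\<not> ?thesis"
    then have "complex_of_real l \<in> op_spectrum M T" by (simp add: op_spectrum_iff)
    then have "cmod (complex_of_real l) \<le> op_spectral_radius M T"
      unfolding op_spectral_radius_def by (intro cSup_upper bdd(1)) blast
    with l bdd(2) show False by simp
  qed
  then obtain l S where l: "op_spectral_radius M T < l" "l < \<rho>"
    and S: "resolvent_at M T (complex_of_real l) S" "positive_operator M S"
    using exists_positive_resolvent_near[OF acts_bounded_operator[OF T] acts_positive_operator[OF T] _ r] by blast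
  have l0: "0 < l" using l bdd(2) by simp
  have bS: "bounded_operator M S" using S by (simp add: resolvent_at_def)
  obtain C where C: "0 \<le> C" "\<And>f. f \<in> L2 M \<Longrightarrow> L2_norm M (S f) \<le> C * L2_norm M f"
    using bounded_operatorD(3)[OF bS] by blast
  define D where "D = (l * C)\<^sup>2 + 1"
  show ?thesis
    unfolding kernel_growth_def
  proof (intro exI[of _ D] conjI allI ballI)
    fix n and f :: "'a \<Rightarrow> ennreal" assume f [measurable]: "f \<in> borel_measurable M"
    have D0: "0 < D * \<rho> ^ (2 * n)" using l l0 by (simp add: D_def add_nonneg_pos)
    show "sq_norm M ((kernel_apply M K ^^ n) f) \<le> ennreal (D * \<rho> ^ (2 * n)) * sq_norm M f"
    proof (cases "sq_norm M f = top")
      case True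
      then show ?thesis by (rule sq_norm_top_bound[OF D0])
    next
      case False
      have "AE x in M. (f x)\<^sup>2 \<noteq> \<infinity>"
        using False unfolding sq_norm_def by (intro nn_integral_PInf_AE) auto
      then have fin: "AE x in M. ennreal (enn2real (f x)) = f x"
      proof eventually_elim
        case (elim x)
        then have "f x \<noteq> top" by (intro notI) simp
        then show ?case by (simp add: less_top)
      qed
      let ?f = "\<lambda>x. complex_of_real (enn2real (f x))"
      have fL: "?f \<in> L2 M"
        using False sq_norm_cong_AE[OF fin] by (simp add: L2_iff less_top)
      have SfL: "S ?f \<in> L2 M" by (rule bounded_operatorD(1)[OF bS fL])
      note [measurable] = L2_measurable[OF SfL]
      have "AE x in M. ?f x \<in> \<real>\<^sub>\<ge>\<^sub>0" by (intro AE_I2) simp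
      then have Sf_nonneg: "AE x in M. S ?f x \<in> \<real>\<^sub>\<ge>\<^sub>0"
        by (rule bspec[OF S(2)[unfolded positive_operator_def] fL, THEN mp])
      define u where "u x = max 0 (Re (S ?f x))" for x
      have u0: "0 \<le> u x" for x by (simp add: u_def)
      have [measurable]: "u \<in> borel_measurable M" unfolding u_def by measurable
      have u_eq: "AE x in M. S ?f x = complex_of_real (u x)"
        using Sf_nonneg by eventually_elim (auto simp: u_def complex_nonneg_Reals_iff complex_eq_iff)
      have uL: "(\<lambda>x. complex_of_real (u x)) \<in> L2 M"
      proof (rule L2_cong_AE[OF SfL])
        show "AE x in M. complex_of_real (u x) = S ?f x" using u_eq by eventually_elim simp
      qed measurable
      obtain c where c: "kernel_bound M K c" using actsD(2)[OF T] by auto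
      have sq_u: "sq_norm M (\<lambda>x. ennreal (u x)) = ennreal ((L2_norm M (S ?f))\<^sup>2)"
      proof -
        have "AE x in M. ennreal (u x) = ennreal (cmod (S ?f x))"
          using u_eq by eventually_elim (simp add: u0)
        then show ?thesis unfolding sq_norm_cmod[OF SfL, symmetric] by (rule sq_norm_cong_AE)
      qed
      have Ku_fin: "AE x in M. kernel_apply M K (\<lambda>y. ennreal (u y)) x < top"
        by (rule kernel_apply_AE_finite(1)[OF K _ c]) (simp_all add: sq_u)
      have res: "AE x in M. complex_of_real l * S ?f x - T (S ?f) x = ?f x"
        using S(1) fL by (simp add: resolvent_at_def)
      have step: "AE x in M. kernel_apply M K (\<lambda>y. ennreal (u y)) x \<le> ennreal l * ennreal (u x) \<and> f x \<le> ennreal l * ennreal (u x)"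
        using res u_eq acts_cong_AE[OF T SfL uL u_eq] actsD(4)[OF T u0 uL] Ku_fin fin
      proof eventually_elim
        case (elim x)
        let ?Ku = "kernel_apply M K (\<lambda>y. ennreal (u y)) x"
        have "complex_of_real (l * u x - enn2real ?Ku) = ?f x"
          using elim(1) unfolding elim(2,3,4) by simp
        then have e: "l * u x - enn2real ?Ku = enn2real (f x)" by (simp only: of_real_eq_iff)
        have "?Ku = ennreal (enn2real ?Ku)" using elim(5) by simp
        also have "\<dots> \<le> ennreal (l * u x)" using e enn2real_nonneg[of "f x"] by (intro ennreal_leI) linarith
        finally have 1: "?Ku \<le> ennreal (l * u x)" .
        have "f x = ennreal (enn2real (f x))" using elim(6) by simp
        also have "\<dots> \<le> ennreal (l * u x)" using e enn2real_nonneg[of ?Ku] by (intro ennreal_leI) linarith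
        finally show ?case using 1 l0 u0 by (simp add: ennreal_mult)
      qed
      have iter: "AE x in M. (kernel_apply M K ^^ n) f x \<le> ennreal (l ^ Suc n) * ennreal (u x)" for n
      proof (induction n)
        case (Suc n)
        have "kernel_apply M K ((kernel_apply M K ^^ n) f) x \<le> kernel_apply M K (\<lambda>y. ennreal (l ^ Suc n) * ennreal (u y)) x" for x
        proof -
          have "AE y in M. K x y * (kernel_apply M K ^^ n) f y \<le> K x y * (ennreal (l ^ Suc n) * ennreal (u y))"
            using Suc by eventually_elim (rule mult_left_mono, auto)
          then show ?thesis
            unfolding kernel_apply_def[of M K "(kernel_apply M K ^^ n) f"]
              kernel_apply_def[of M K "\<lambda>y. ennreal (l ^ Suc n) * ennreal (u y)"]
            by (rule nn_integral_mono_AE)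
        qed
        note le = this
        have cm: "kernel_apply M K (\<lambda>y. ennreal (l ^ Suc n) * ennreal (u y)) x
            = ennreal (l ^ Suc n) * kernel_apply M K (\<lambda>y. ennreal (u y)) x" if "x \<in> space M" for x
          using that by (intro kernel_apply_cmult[OF K]) measurable
        show ?case
          using step AE_space
        proof eventually_elim
          case (elim x)
          have "(kernel_apply M K ^^ Suc n) f x \<le> ennreal (l ^ Suc n) * kernel_apply M K (\<lambda>y. ennreal (u y)) x"
            using le[of x] cm[OF elim(2)] by simp
          also have "\<dots> \<le> ennreal (l ^ Suc n) * (ennreal l * ennreal (u x))"
            using elim by (intro mult_left_mono) auto
          also have "\<dots> = ennreal (l ^ Suc (Suc n)) * ennreal (u x)"
            using l0 by (simp add: ennreal_mult mult_ac)
          finally show ?case .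
        qed
      qed (use step in \<open>auto elim: eventually_mono\<close>)
      have "sq_norm M ((kernel_apply M K ^^ n) f) \<le> sq_norm M (\<lambda>x. ennreal (l ^ Suc n) * ennreal (u x))"
        by (rule sq_norm_mono_AE[OF iter])
      also have "\<dots> = (ennreal (l ^ Suc n))\<^sup>2 * ennreal ((L2_norm M (S ?f))\<^sup>2)"
        by (subst sq_norm_cmult) (simp_all add: sq_u)
      also have "\<dots> \<le> (ennreal (l ^ Suc n))\<^sup>2 * ennreal ((C * L2_norm M ?f)\<^sup>2)"
        by (intro mult_left_mono ennreal_leI power_mono C(2) fL) simp_all
      also have "\<dots> = ennreal ((l ^ Suc n)\<^sup>2 * C\<^sup>2) * ennreal ((L2_norm M ?f)\<^sup>2)"
        using l0 by (simp add: ennreal_power power_mult_distrib mult.assoc flip: ennreal_mult)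
      also have "ennreal ((L2_norm M ?f)\<^sup>2) = sq_norm M f"
        using sq_norm_cong_AE[OF fin] by (simp add: sq_norm_cmod[OF fL, symmetric])
      also have "ennreal ((l ^ Suc n)\<^sup>2 * C\<^sup>2) * sq_norm M f \<le> ennreal (D * \<rho> ^ (2 * n)) * sq_norm M f"
      proof (intro mult_right_mono ennreal_leI)
        have "(l ^ Suc n)\<^sup>2 * C\<^sup>2 = (l * C)\<^sup>2 * l ^ (2 * n)"
          by (simp add: power_mult_distrib power_mult power2_eq_square)
        also have "\<dots> \<le> D * \<rho> ^ (2 * n)"
          using l l0 by (intro mult_mono power_mono) (auto simp: D_def)
        finally show "(l ^ Suc n)\<^sup>2 * C\<^sup>2 \<le> D * \<rho> ^ (2 * n)" .
      qed simp
      finally show ?thesis .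
    qed
  qed (simp add: D_def)
qed

lemma operator_norm_le:
  assumes T: "acts M T K" and c: "kernel_bound M K c"
  shows "operator_norm M T \<le> sqrt c"
  unfolding operator_norm_def
proof (rule cSup_least)
  have "L2_norm M (\<lambda>x. 0) \<le> 1" by (simp add: L2_norm_def)
  then show "{L2_norm M (T f) | f. f \<in> L2 M \<and> L2_norm M f \<le> 1} \<noteq> {}" using L2_zero by blast
  fix y assume "y \<in> {L2_norm M (T f) | f. f \<in> L2 M \<and> L2_norm M f \<le> 1}"
  then obtain f where f: "y = L2_norm M (T f)" "f \<in> L2 M" "L2_norm M f \<le> 1" by auto
  have "(L2_norm M (T f))\<^sup>2 \<le> c * (L2_norm M f)\<^sup>2" by (rule acts_norm_le[OF T c f(2)])
  also have "\<dots> \<le> c * 1\<^sup>2"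
    using f(3) kernel_boundD(1)[OF c] by (intro mult_left_mono power_mono) auto
  finally show "y \<le> sqrt c" unfolding f(1) by (intro real_le_rsqrt) simp
qed

end

section \<open>Cyclic products and the inequalities\<close>

text \<open>
  The successor on the cycle \<open>1, \<dots>, m\<close>.  Its iterates enumerate the factors of a cyclic product, and each
  iterate is a permutation of the indices.
\<close>

definition cyclic_succ :: "nat \<Rightarrow> nat \<Rightarrow> nat" where
  "cyclic_succ m j = (if j = m then 1 else Suc j)"

lemma cyclic_succ_bij: "1 \<le> m \<Longrightarrow> bij_betw (cyclic_succ m) {1..m} {1..m}"
  by (rule bij_betw_byWitness[where f' = "\<lambda>j. if j = 1 then m else j - 1"])
     (auto simp: cyclic_succ_def)

lemma funpow_cyclic_succ_bij: "1 \<le> m \<Longrightarrow> bij_betw (cyclic_succ m ^^ p) {1..m} {1..m}"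
proof (induction p)
  case (Suc p)
  from bij_betw_trans[OF Suc.IH[OF Suc.prems] cyclic_succ_bij[OF Suc.prems]] show ?case
    by (simp only: funpow.simps)
qed (simp add: bij_betw_def)

lemma funpow_cyclic_succ:
  assumes "j \<in> {1..m}" "p \<le> m"
  shows "(cyclic_succ m ^^ p) j = (if j + p \<le> m then j + p else j + p - m)"
  using assms(2) by (induction p) (use assms(1) in \<open>auto simp: cyclic_succ_def\<close>)

lemma cyclic_indices:
  assumes "j \<in> {1..m}"
  shows "[j..<Suc m] @ [1..<j] = map (\<lambda>p. (cyclic_succ m ^^ p) j) [0..<m]"
proof (rule nth_equalityI)
  show "length ([j..<Suc m] @ [1..<j]) = length (map (\<lambda>p. (cyclic_succ m ^^ p) j) [0..<m])"
    using assms by auto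
  fix i assume "i < length ([j..<Suc m] @ [1..<j])"
  then have "i < m" using assms by auto
  then show "([j..<Suc m] @ [1..<j]) ! i = map (\<lambda>p. (cyclic_succ m ^^ p) j) [0..<m] ! i"
    using assms funpow_cyclic_succ[OF assms, of i] by (auto simp: nth_append)
qed

lemma hadamard_kernel_permute:
  assumes "bij_betw \<pi> {1..m} {1..m}"
  shows "hadamard_kernel \<alpha> m (\<lambda>i. K (\<pi> i)) = hadamard_kernel \<alpha> m K"
  unfolding hadamard_kernel_def using prod.reindex_bij_betw[OF assms, of "\<lambda>i. ennpowr (K i _ _) \<alpha>"]
  by (intro ext) blast

context sigma_finite_measure
begin

lemma kernel_comp_assoc:
  assumes "kernel_measurable M K" "kernel_measurable M L"
    and [measurable]: "kernel_measurable M N" and "x \<in> space M" and [measurable]: "y \<in> space M"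
  shows "kernel_comp M (kernel_comp M K L) N x y = kernel_comp M K (kernel_comp M L N) x y"
proof -
  have "(\<lambda>z. N z y) \<in> borel_measurable M" by measurable
  from kernel_apply_comp[OF assms(1,2) this assms(4)] show ?thesis
    by (simp add: kernel_apply_def kernel_comp_def)
qed

lemma kernel_prod_snoc:
  assumes "\<And>p. p \<le> Suc n \<Longrightarrow> kernel_measurable M (L p)" "x \<in> space M" "y \<in> space M"
  shows "kernel_prod M (Suc n) L x y = kernel_comp M (kernel_prod M n L) (L (Suc n)) x y"
  using assms
proof (induction n arbitrary: L x y)
  case (Suc n)
  let ?L = "\<lambda>p. L (Suc p)"
  have "kernel_prod M (Suc (Suc n)) L x y = kernel_comp M (L 0) (kernel_comp M (kernel_prod M n ?L) (L (Suc (Suc n)))) x y"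
  proof -
    have "kernel_prod M (Suc n) ?L u v = kernel_comp M (kernel_prod M n ?L) (L (Suc (Suc n))) u v"
      if "u \<in> space M" "v \<in> space M" for u v
      using Suc.IH[of ?L u v] Suc.prems that by auto
    then show ?thesis
      using Suc.prems(3) by (simp only: kernel_prod.simps(2)[of M "Suc n"] kernel_comp_def[of M "L 0"] cong: nn_integral_cong)
  qed
  also have "\<dots> = kernel_comp M (kernel_comp M (L 0) (kernel_prod M n ?L)) (L (Suc (Suc n))) x y"
    using Suc.prems by (intro kernel_comp_assoc[symmetric] kernel_prod_measurable) auto
  finally show ?case by simp
qed simp

lemma acts_foldr_comp:
  assumes "\<And>p. p \<le> n \<Longrightarrow> acts M (P p) (K p)"
  shows "acts M (foldr (\<circ>) (map P [0..<Suc n]) id) (kernel_prod M n K)"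
  using assms
proof (induction n arbitrary: P K)
  case (Suc n)
  have "map P [0..<Suc (Suc n)] = P 0 # map (\<lambda>p. P (Suc p)) [0..<Suc n]"
    by (simp only: upt_conv_Cons[of 0 "Suc (Suc n)"] zero_less_Suc list.map map_Suc_upt[symmetric] map_map comp_def)
  then have "foldr (\<circ>) (map P [0..<Suc (Suc n)]) id = P 0 \<circ> foldr (\<circ>) (map (\<lambda>p. P (Suc p)) [0..<Suc n]) id"
    by (simp only: foldr.simps comp_apply)
  moreover have "acts M (P 0 \<circ> foldr (\<circ>) (map (\<lambda>p. P (Suc p)) [0..<Suc n]) id)
      (kernel_comp M (K 0) (kernel_prod M n (\<lambda>p. K (Suc p))))"
    by (intro acts_comp Suc) auto
  ultimately show ?case by (simp only: kernel_prod.simps)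
qed simp

lemma acts_cyclic_product:
  assumes P: "\<And>i. i \<in> {1..m} \<Longrightarrow> acts M (P i) (K i)" and j: "j \<in> {1..m}"
  shows "acts M (cyclic_product m P j) (kernel_prod M (m - 1) (\<lambda>p. K ((cyclic_succ m ^^ p) j)))"
proof -
  have m: "1 \<le> m" "m = Suc (m - 1)" using j by auto
  have "acts M (P ((cyclic_succ m ^^ p) j)) (K ((cyclic_succ m ^^ p) j))" for p
    using bij_betw_apply[OF funpow_cyclic_succ_bij[OF m(1)] j] by (rule P)
  then have "acts M (foldr (\<circ>) (map (\<lambda>p. P ((cyclic_succ m ^^ p) j)) [0..<Suc (m - 1)]) id)
      (kernel_prod M (m - 1) (\<lambda>p. K ((cyclic_succ m ^^ p) j)))"
    by (intro acts_foldr_comp)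
  moreover have "map P ([j..<Suc m] @ [1..<j]) = map (\<lambda>p. P ((cyclic_succ m ^^ p) j)) [0..<Suc (m - 1)]"
    unfolding cyclic_indices[OF j] using m(2) by simp
  ultimately show ?thesis by (simp only: cyclic_product_def)
qed

text \<open>
  Passing from one cyclic product to the next moves the first factor to the end, which leaves the growth
  unchanged by \<open>kernel_growth_comp_commute\<close>.
\<close>

lemma cyclic_growth:
  assumes K: "\<And>i. i \<in> {1..m} \<Longrightarrow> kernel_measurable M (K i)"
      "\<And>i. i \<in> {1..m} \<Longrightarrow> \<exists>c. kernel_bound M (K i) c"
    and "0 < \<rho>" and j: "j \<in> {1..m}"
    and growth: "kernel_growth M (kernel_prod M (m - 1) (\<lambda>p. K ((cyclic_succ m ^^ p) 1))) \<rho>"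
  shows "kernel_growth M (kernel_prod M (m - 1) (\<lambda>p. K ((cyclic_succ m ^^ p) j))) \<rho>"
proof -
  have m: "1 \<le> m" using j by auto
  let ?s = "\<lambda>j p. (cyclic_succ m ^^ p) j"
  let ?Q = "\<lambda>j. kernel_prod M (m - 1) (\<lambda>p. K (?s j p))"
  have s: "?s j p \<in> {1..m}" if "j \<in> {1..m}" for j p
    by (rule bij_betw_apply[OF funpow_cyclic_succ_bij[OF m] that])
  have step: "kernel_growth M (?Q (cyclic_succ m j)) \<rho>" if g: "kernel_growth M (?Q j) \<rho>" and j: "j \<in> {1..m}" for j
  proof (cases "m - 1")
    case 0
    then have "cyclic_succ m j = j" using j by (auto simp: cyclic_succ_def)
    with g show ?thesis by simp
  next
    case (Suc n)
    let ?R = "kernel_prod M n (\<lambda>p. K (?s j (Suc p)))"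
    have R: "kernel_measurable M ?R" "\<exists>c. kernel_bound M ?R c"
      using s[OF j] K by (auto intro!: kernel_prod_measurable kernel_bound_prod simp del: funpow.simps)
    have "kernel_growth M (kernel_comp M (K j) ?R) \<rho>"
      using g unfolding Suc by simp
    then have g': "kernel_growth M (kernel_comp M ?R (K j)) \<rho>"
      by (rule kernel_growth_comp_commute[OF K(1)[OF j] K(2)[OF j] R \<open>0 < \<rho>\<close>])
    have sw: "?s (cyclic_succ m j) p = ?s j (Suc p)" for p
      by (simp add: funpow_swap1)
    have "?s j m = j" using j by (subst funpow_cyclic_succ) auto
    moreover have "Suc (Suc n) = m" using Suc m by simp
    ultimately have last: "?s j (Suc (Suc n)) = j" by simp
    have "?Q (cyclic_succ m j) x y = kernel_comp M ?R (K j) x y" if xy: "x \<in> space M" "y \<in> space M" for x y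
    proof -
      have "?Q (cyclic_succ m j) x y = kernel_prod M (Suc n) (\<lambda>p. K (?s j (Suc p))) x y"
        unfolding sw Suc ..
      also have "\<dots> = kernel_comp M ?R (K (?s j (Suc (Suc n)))) x y"
        by (rule kernel_prod_snoc[OF _ xy]) (rule K(1)[OF s[OF j]])
      finally show ?thesis unfolding last .
    qed
    then show ?thesis
      using K(1) s j R(1)
      by (intro kernel_growth_mono[OF _ _ _ g'] kernel_prod_measurable kernel_comp_measurable)
         (auto simp: cyclic_succ_def simp del: funpow.simps)
  qed
  have "Suc i \<le> m \<Longrightarrow> kernel_growth M (?Q (Suc i)) \<rho>" for i
  proof (induction i)
    case (Suc i)
    then have "cyclic_succ m (Suc i) = Suc (Suc i)" by (simp add: cyclic_succ_def)
    with step[of "Suc i"] Suc show ?case by simp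
  qed (use growth in simp)
  from this[of "j - 1"] j show ?thesis by auto
qed

text \<open>
  Each spectral radius is approached from above by numbers \<open>\<rho>\<close>; at such a \<open>\<rho>\<close> the kernel on the larger side
  has growth \<open>\<rho>\<close>, and the inequality between kernels transfers this to the smaller side.
\<close>

theorem hadamard_spectral_inequalities:
  fixes \<tau> \<nu> :: "nat \<Rightarrow> nat" and G :: "nat \<Rightarrow> 'a operator"
  assumes exp: "hadamard_exponent M m \<alpha>" and \<tau>: "\<tau> permutes {1..m}" and \<nu>: "\<nu> permutes {1..m}"
    and G: "\<And>i. i \<in> {1..m} \<Longrightarrow> positive_kernel_operator M (G i)"
    and P_def: "P = (\<lambda>j. L2_adjoint M (G (\<tau> j)) \<circ> G (\<nu> j))" and Q_def: "Q = cyclic_product m P"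
  shows "operator_norm M (hadamard M \<alpha> m G) \<le> op_spectral_radius M (hadamard M \<alpha> m P) powr (1 / 2)"
    and "op_spectral_radius M (hadamard M \<alpha> m P) powr (1 / 2)
      \<le> op_spectral_radius M (hadamard M \<alpha> m Q) powr (1 / (2 * real m))"
    and "op_spectral_radius M (hadamard M \<alpha> m Q) powr (1 / (2 * real m))
      \<le> op_spectral_radius M (foldr (\<circ>) (map P [1..<Suc m]) id) powr (\<alpha> / 2)"
proof -
  note \<alpha> = hadamard_exponent_pos[OF exp]
  have "\<forall>i\<in>{1..m}. \<exists>K. acts M (G i) K" using positive_kernel_operator_acts[OF G] by blast
  then obtain K where K: "\<And>i. i \<in> {1..m} \<Longrightarrow> acts M (G i) (K i)" by metis
  define Kp where "Kp j = kernel_comp M (\<lambda>x y. K (\<tau> j) y x) (K (\<nu> j))" for j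
  define Kq where "Kq j = kernel_prod M (m - 1) (\<lambda>p. Kp ((cyclic_succ m ^^ p) j))" for j
  have P: "acts M (P j) (Kp j)" if "j \<in> {1..m}" for j
    unfolding P_def Kp_def
    by (intro acts_comp acts_adjoint K) (use that permutes_in_image[OF \<tau>] permutes_in_image[OF \<nu>] in auto)
  have Q: "acts M (Q j) (Kq j)" if "j \<in> {1..m}" for j
    unfolding Q_def Kq_def by (rule acts_cyclic_product[OF P that])
  let ?hK = "hadamard_kernel \<alpha> m K" and ?hP = "hadamard_kernel \<alpha> m Kp" and ?hQ = "hadamard_kernel \<alpha> m Kq"
  have hG: "acts M (hadamard M \<alpha> m G) ?hK" by (rule acts_hadamard[OF exp K])
  have hP: "acts M (hadamard M \<alpha> m P) ?hP" by (rule acts_hadamard[OF exp P])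
  have hQ: "acts M (hadamard M \<alpha> m Q) ?hQ" by (rule acts_hadamard[OF exp Q])
  let ?rP = "op_spectral_radius M (hadamard M \<alpha> m P)" and ?rQ = "op_spectral_radius M (hadamard M \<alpha> m Q)"
  let ?r1 = "op_spectral_radius M (Q 1)"
  have r0: "0 \<le> ?rP" "0 \<le> ?rQ" "0 \<le> ?r1"
    using spectral_radius_bdd(2)[OF hP] spectral_radius_bdd(2)[OF hQ] spectral_radius_bdd(2)[OF Q[of 1]] \<alpha> by auto
  show "operator_norm M (hadamard M \<alpha> m G) \<le> ?rP powr (1 / 2)"
  proof -
    have le: "kernel_comp M (kernel_transpose ?hK) ?hK x y \<le> ?hP x y" if xy: "x \<in> space M" "y \<in> space M" for x y
    proof -
      have 1: "kernel_transpose ?hK = hadamard_kernel \<alpha> m (\<lambda>j x y. K (\<tau> j) y x)"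
      proof -
        have "kernel_transpose ?hK = hadamard_kernel \<alpha> m (\<lambda>j x y. K j y x)"
          by (simp add: hadamard_kernel_def fun_eq_iff)
        also have "\<dots> = hadamard_kernel \<alpha> m (\<lambda>j x y. K (\<tau> j) y x)"
          by (rule hadamard_kernel_permute[OF permutes_imp_bij[OF \<tau>], of \<alpha> "\<lambda>j x y. K j y x", symmetric])
        finally show ?thesis .
      qed
      have 2: "?hK = hadamard_kernel \<alpha> m (\<lambda>j. K (\<nu> j))"
        by (rule hadamard_kernel_permute[OF permutes_imp_bij[OF \<nu>], symmetric])
      have "kernel_comp M (hadamard_kernel \<alpha> m (\<lambda>j x y. K (\<tau> j) y x)) (hadamard_kernel \<alpha> m (\<lambda>j. K (\<nu> j))) x y
          \<le> hadamard_kernel \<alpha> m (\<lambda>j. kernel_comp M (\<lambda>x y. K (\<tau> j) y x) (K (\<nu> j))) x y"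
      proof (rule kernel_comp_hadamard_le[OF exp _ _ xy])
        fix i assume "i \<in> {1..m}"
        then have "\<tau> i \<in> {1..m}" "\<nu> i \<in> {1..m}"
          using permutes_in_image[OF \<tau>] permutes_in_image[OF \<nu>] by blast+
        from actsD(1)[OF K[OF this(1)]] actsD(1)[OF K[OF this(2)]]
        show "kernel_measurable M (\<lambda>x y. K (\<tau> i) y x)"
            "kernel_measurable M (K (\<nu> i))"
          by (auto intro: kernel_transpose_measurable)
      qed
      then show ?thesis unfolding 1 2[symmetric] Kp_def[abs_def] .
    qed
    have "operator_norm M (hadamard M \<alpha> m G) \<le> sqrt \<rho>" if \<rho>: "?rP < \<rho>" for \<rho>
    proof (rule operator_norm_le[OF hG])
      have "0 < \<rho>" using r0 \<rho> by simp
      then show "kernel_bound M ?hK \<rho>"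
        unfolding kernel_bound_def
        using sq_norm_le_of_transpose_growth[OF actsD(1)[OF hG] actsD(1)[OF hP] le growth_of_spectral_radius[OF hP \<rho>]]
        by auto
    qed
    \<comment> \<open>The maximum with \<open>0\<close> permits squaring before the nonnegativity of the operator norm is known.\<close>
    then have "(max 0 (operator_norm M (hadamard M \<alpha> m G)))\<^sup>2 \<le> \<rho>" if "?rP < \<rho>" for \<rho>
    proof -
      have "0 \<le> \<rho>" using r0 that by simp
      then have "max 0 (operator_norm M (hadamard M \<alpha> m G)) \<le> sqrt \<rho>"
        using \<open>\<And>\<rho>. ?rP < \<rho> \<Longrightarrow> operator_norm M (hadamard M \<alpha> m G) \<le> sqrt \<rho>\<close>[OF that] by simp
      then have "(max 0 (operator_norm M (hadamard M \<alpha> m G)))\<^sup>2 \<le> (sqrt \<rho>)\<^sup>2"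
        by (rule power_mono) simp
      with \<open>0 \<le> \<rho>\<close> show ?thesis by simp
    qed
    then have "(max 0 (operator_norm M (hadamard M \<alpha> m G)))\<^sup>2 \<le> ?rP"
      by (rule dense_ge)
    then have "max 0 (operator_norm M (hadamard M \<alpha> m G)) \<le> sqrt ?rP"
      by (rule real_le_rsqrt)
    then show ?thesis using r0 by (simp add: powr_half_sqrt)
  qed
  show "?rP powr (1 / 2) \<le> ?rQ powr (1 / (2 * real m))"
  proof -
    have "?rP ^ m \<le> \<rho>" if \<rho>: "?rQ < \<rho>" for \<rho>
    proof -
      have \<rho>0: "0 < \<rho>" using r0 \<rho> by simp
      let ?\<sigma> = "\<rho> powr (1 / real m)"
      have \<sigma>: "?\<sigma> ^ m = \<rho>" "0 < ?\<sigma>" "m = Suc (m - 1)"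
        using \<rho>0 \<alpha> by (auto simp: powr_powr simp flip: powr_realpow)
      have hP_m: "kernel_measurable M ?hP" by (rule actsD(1)[OF hP])
      have s: "(cyclic_succ m ^^ p) j \<in> {1..m}" if "j \<in> {1..m}" for j p
        by (rule bij_betw_apply[OF funpow_cyclic_succ_bij[OF \<alpha>(2)] that])
      have le: "kernel_prod M (m - 1) (\<lambda>_. ?hP) x y \<le> ?hQ x y" if xy: "x \<in> space M" "y \<in> space M" for x y
      proof -
        have "kernel_prod M (m - 1) (\<lambda>p. hadamard_kernel \<alpha> m (\<lambda>j. Kp ((cyclic_succ m ^^ p) j))) x y \<le> ?hQ x y"
          unfolding Kq_def[abs_def]
          by (rule kernel_prod_hadamard_le[OF exp _ xy]) (rule actsD(1)[OF P[OF s]])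
        then show ?thesis
          unfolding hadamard_kernel_permute[OF funpow_cyclic_succ_bij[OF \<alpha>(2)]] .
      qed
      have "kernel_growth M (kernel_prod M (m - 1) (\<lambda>_. ?hP)) \<rho>"
      proof (rule kernel_growth_mono[OF _ _ le growth_of_spectral_radius[OF hQ \<rho>]])
        show "kernel_measurable M (kernel_prod M (m - 1) (\<lambda>_. ?hP))"
          by (rule kernel_prod_measurable[OF hP_m])
        show "kernel_measurable M ?hQ" by (rule actsD(1)[OF hQ])
      qed
      then have "kernel_growth M (kernel_prod M (m - 1) (\<lambda>_. ?hP)) (?\<sigma> ^ Suc (m - 1))"
        using \<sigma> by simp
      then have "kernel_growth M ?hP ?\<sigma>"
        using actsD(2)[OF hP] by (intro kernel_growth_root[OF hP_m _ \<sigma>(2)]) auto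
      then have "?rP \<le> ?\<sigma>" by (rule spectral_radius_le_of_growth(1)[OF hP _ \<sigma>(2)])
      then have "?rP ^ m \<le> ?\<sigma> ^ m" using r0 by (intro power_mono)
      then show ?thesis using \<sigma> by simp
    qed
    then have "?rP ^ m \<le> ?rQ" by (rule dense_ge)
    then have "(?rP ^ m) powr (1 / (2 * real m)) \<le> ?rQ powr (1 / (2 * real m))"
      using r0 by (intro powr_mono2) auto
    moreover have "(?rP ^ m) powr (1 / (2 * real m)) = ?rP powr (1 / 2)"
      using r0 \<alpha> by (cases "?rP = 0") (auto simp: powr_powr simp flip: powr_realpow)
    ultimately show ?thesis by simp
  qed
  have m1: "1 \<in> {1..m}" using \<alpha> by simp
  have "?rQ powr (1 / (2 * real m)) \<le> ?r1 powr (\<alpha> / 2)"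
  proof -
    have ma: "0 < real m * \<alpha>" using \<alpha> by simp
    have "?rQ powr (1 / (real m * \<alpha>)) \<le> \<rho>" if \<rho>: "?r1 < \<rho>" for \<rho>
    proof -
      have \<rho>0: "0 < \<rho>" using r0 \<rho> by simp
      have "kernel_growth M (Kq 1) \<rho>" by (rule growth_of_spectral_radius[OF Q[OF m1] \<rho>])
      then have "kernel_growth M (Kq j) \<rho>" if "j \<in> {1..m}" for j
        unfolding Kq_def using actsD(1,2)[OF P] by (intro cyclic_growth[OF _ _ \<rho>0 that]) blast+
      then have "kernel_growth M ?hQ (\<rho> powr (real m * \<alpha>))"
        by (intro kernel_growth_hadamard[OF exp \<rho>0] actsD(1)[OF Q])
      then have "?rQ \<le> \<rho> powr (real m * \<alpha>)"
        using \<rho>0 by (intro spectral_radius_le_of_growth(1)[OF hQ]) auto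
      then have "?rQ powr (1 / (real m * \<alpha>)) \<le> (\<rho> powr (real m * \<alpha>)) powr (1 / (real m * \<alpha>))"
        using r0 ma by (intro powr_mono2) auto
      then show ?thesis using \<rho>0 \<alpha> by (simp add: powr_powr)
    qed
    then have "?rQ powr (1 / (real m * \<alpha>)) \<le> ?r1" by (rule dense_ge)
    then have "(?rQ powr (1 / (real m * \<alpha>))) powr (\<alpha> / 2) \<le> ?r1 powr (\<alpha> / 2)"
      using \<alpha> by (intro powr_mono2) auto
    then show ?thesis using \<alpha> by (simp add: powr_powr mult_ac)
  qed
  moreover have "Q 1 = foldr (\<circ>) (map P [1..<Suc m]) id"
    by (simp only: Q_def cyclic_product_def) simp
  ultimately show "?rQ powr (1 / (2 * real m)) \<le> op_spectral_radius M (foldr (\<circ>) (map P [1..<Suc m]) id) powr (\<alpha> / 2)"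
    by simp
qed

end

theorem theorem3p10:
  fixes m :: nat and \<tau> \<nu> :: "nat \<Rightarrow> nat"
    and M :: "'a measure" and H :: "nat \<Rightarrow> 'a operator"
    and R :: "nat set" and A :: "nat \<Rightarrow> nat \<Rightarrow> nat \<Rightarrow> real" and \<alpha> :: real
  assumes "1 \<le> m" and "\<tau> permutes {1..m}" and "\<nu> permutes {1..m}"
  shows
    "(sigma_finite_measure M \<and> space M \<noteq> {} \<and>
      (\<forall>i\<in>{1..m}. positive_kernel_operator M (H i)) \<longrightarrow>
      (let P = (\<lambda>j. L2_adjoint M (H (\<tau> j)) \<circ> H (\<nu> j));
           Q = cyclic_product m P
       in operator_norm M (hadamard M (1 / real m) m H)
            \<le> op_spectral_radius M (hadamard M (1 / real m) m P) powr (1 / 2) \<and>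
          op_spectral_radius M (hadamard M (1 / real m) m P) powr (1 / 2)
            \<le> op_spectral_radius M (hadamard M (1 / real m) m Q) powr (1 / (2 * real m)) \<and>
          op_spectral_radius M (hadamard M (1 / real m) m Q) powr (1 / (2 * real m))
            \<le> op_spectral_radius M (foldr (\<circ>) (map P [1..<Suc m]) id) powr (1 / (2 * real m))))
     \<and>
     (((\<exists>N\<ge>1. R = {1..N}) \<or> R = {1..}) \<and>
      (\<forall>l\<in>{1..m}. (\<forall>i\<in>R. \<forall>j\<in>R. 0 \<le> A l i j) \<and> defines_l2_operator R (A l)) \<and>
      1 / real m \<le> \<alpha> \<longrightarrow>
      (let L = count_space R;
           G = (\<lambda>l. matrix_op R (A l));
           P = (\<lambda>j. L2_adjoint L (G (\<tau> j)) \<circ> G (\<nu> j));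
           Q = cyclic_product m P
       in operator_norm L (hadamard L \<alpha> m G)
            \<le> op_spectral_radius L (hadamard L \<alpha> m P) powr (1 / 2) \<and>
          op_spectral_radius L (hadamard L \<alpha> m P) powr (1 / 2)
            \<le> op_spectral_radius L (hadamard L \<alpha> m Q) powr (1 / (2 * real m)) \<and>
          op_spectral_radius L (hadamard L \<alpha> m Q) powr (1 / (2 * real m))
            \<le> op_spectral_radius L (foldr (\<circ>) (map P [1..<Suc m]) id) powr (\<alpha> / 2)))"
proof (intro conjI impI)
  assume a: "sigma_finite_measure M \<and> space M \<noteq> {} \<and> (\<forall>i\<in>{1..m}. positive_kernel_operator M (H i))"
  then interpret sigma_finite_measure M by simp
  have exp: "hadamard_exponent M m (1 / real m)" using assms(1) by (simp add: hadamard_exponent_def)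
  have pos: "positive_kernel_operator M (H i)" if "i \<in> {1..m}" for i
    using a that by blast
  note main = hadamard_spectral_inequalities[OF exp assms(2,3) pos refl refl]
  have half: "1 / real m / 2 = 1 / (2 * real m)" by simp
  show "let P = (\<lambda>j. L2_adjoint M (H (\<tau> j)) \<circ> H (\<nu> j));
           Q = cyclic_product m P
       in operator_norm M (hadamard M (1 / real m) m H)
            \<le> op_spectral_radius M (hadamard M (1 / real m) m P) powr (1 / 2) \<and>
          op_spectral_radius M (hadamard M (1 / real m) m P) powr (1 / 2)
            \<le> op_spectral_radius M (hadamard M (1 / real m) m Q) powr (1 / (2 * real m)) \<and>
          op_spectral_radius M (hadamard M (1 / real m) m Q) powr (1 / (2 * real m))
            \<le> op_spectral_radius M (foldr (\<circ>) (map P [1..<Suc m]) id) powr (1 / (2 * real m))"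
    unfolding Let_def using main(1,2) main(3)[unfolded half] by (intro conjI)
next
  assume a: "((\<exists>N\<ge>1. R = {1..N}) \<or> R = {1..}) \<and>
      (\<forall>l\<in>{1..m}. (\<forall>i\<in>R. \<forall>j\<in>R. 0 \<le> A l i j) \<and> defines_l2_operator R (A l)) \<and> 1 / real m \<le> \<alpha>"
  have R: "countable R" by (rule countableI_type)
  interpret sigma_finite_measure "count_space R"
    by (rule sigma_finite_measure_count_space_countable[OF R])
  have exp: "hadamard_exponent (count_space R) m \<alpha>" using assms(1) a by (auto simp: hadamard_exponent_def)
  have pos: "positive_kernel_operator (count_space R) (matrix_op R (A l))" if "l \<in> {1..m}" for l
    using a that by (intro matrix_op_positive_kernel_operator[OF R]) auto
  note main = hadamard_spectral_inequalities[OF exp assms(2,3) pos refl refl]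
  show "let L = count_space R;
           G = (\<lambda>l. matrix_op R (A l));
           P = (\<lambda>j. L2_adjoint L (G (\<tau> j)) \<circ> G (\<nu> j));
           Q = cyclic_product m P
       in operator_norm L (hadamard L \<alpha> m G)
            \<le> op_spectral_radius L (hadamard L \<alpha> m P) powr (1 / 2) \<and>
          op_spectral_radius L (hadamard L \<alpha> m P) powr (1 / 2)
            \<le> op_spectral_radius L (hadamard L \<alpha> m Q) powr (1 / (2 * real m)) \<and>
          op_spectral_radius L (hadamard L \<alpha> m Q) powr (1 / (2 * real m))
            \<le> op_spectral_radius L (foldr (\<circ>) (map P [1..<Suc m]) id) powr (\<alpha> / 2)"
    unfolding Let_def using main by (intro conjI)
qed

end
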